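(* Let $\alpha,\beta\in \mathrm{On}\cup\{\mathrm{On}\}$ with $\beta<\alpha$ (an LST number which does not exist is considered equal to $\infty$). Then: (1) $\mathrm{LST}(I,Q^{\mathrm{e.c.}})=\mathrm{LST}(I,Q^{\mathrm{On}})$. (2) $\mathrm{LST}(I,Q^\alpha)\geq \mathrm{LST}(I,R^\alpha)$. (3) Either $\mathrm{LST}(I,Q^\alpha)\geq \mathrm{LST}(I,Q^\beta)$, or both $\beta\geq \mathrm{LST}(I,Q^\alpha)$ and $\mathrm{LST}(I,Q^\beta)>\min(\mathrm{Reg}_\beta)$. (4) Either $\mathrm{LST}(I,R^\alpha)\geq \mathrm{LST}(I,R^\beta)$, or both $\beta\geq \mathrm{LST}(I,R^\alpha)$ and $\mathrm{LST}(I,R^\beta)>\min(\mathrm{Reg}_\beta)$. (5) $\mathrm{LST}(I,R^1)=\mathrm{LST}(I,R^0)=\mathrm{LST}(I)$.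
   Context: Classes of regular cardinals. $\mathrm{On}$ is the class of ordinals, regarded as greater than every ordinal. $\mathrm{Reg}$ is the class of infinite regular cardinals. By recursion on ordinals $\alpha$: $\mathrm{Reg}_{<\alpha}=\bigcup_{\beta<\alpha}\mathrm{Reg}_\beta$; $\mathrm{Reg}_{\geq\alpha}=\mathrm{Reg}\setminus \mathrm{Reg}_{<\alpha}$; and $\mathrm{Reg}_\alpha$ is the class of successor elements of the closed class of ordinals generated by $\mathrm{Reg}_{\geq\alpha}$ (i.e. those elements of its closure that have an immediate predecessor in the closure; the minimum element $\omega$ is not a successor). So $\mathrm{Reg}_0$ is the class of uncountable successor cardinals. Generalised quantifiers. A generalised quantifier $Q$ of type $(n_1,\dots,n_k)$ assigns to each set $A$ a set $Q_A\subset \mathcal P(A^{n_1})\times\dots\times\mathcal P(A^{n_k})$. If $\mathcal A$ is a structure with domain $A$, the formula $Q\bar v_1\dots\bar v_k(\varphi_1,\dots,\varphi_k)$ (with $\bar v_i$ an $n_i$-tuple of variables, $\varphi_i$ possibly with further parameters) is true in $\mathcal A$ under an assignment $a$ iff $(S_1,\dots,S_k)\in Q_A$, where $S_i=\{\bar x\in A^{n_i}:\mathcal A\vDash\varphi_i(\bar x)[a]\}$. Such quantifiers may be nested and combined freely with first-order connectives and quantifiers. Cardinalities and cofinalities below are computed in the universe $V$. - The H\"artig quantifier $I$ has type $(1,1)$: $I_A=\{(X,Y)\in\mathcal P(A)^2: |X|=|Y|\}$. - The equal cofinality quantifier $Q^{\mathrm{e.c.}}$ has type $(2,2)$: $Q^{\mathrm{e.c.}}_A$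 is the set of $(X,Y)\in\mathcal P(A^2)^2$ such that $X$ and $Y$ are linear orders with the same cofinality. - For $\alpha\leq\mathrm{On}$, $Q^\alpha$ has type $(2,2,2)$: $Q^\alpha_A$ is the set of $(X,Y,Z)\in\mathcal P(A^2)^3$ such that $X$ and $Y$ are linear orders with the same cofinality, $Z$ is a well order of order type less than $\alpha$, and the common cofinality of $X$ and $Y$ is in $\mathrm{Reg}_{\mathrm{o.t.}(Z)}$. - For $\alpha\leq\mathrm{On}$, $R^\alpha$ has type $(1,2)$: $R^\alpha_A$ is the set of $(X,Z)\in\mathcal P(A)\times\mathcal P(A^2)$ such that $Z$ is a well order of order type less than $\alpha$ and $|X|\in\mathrm{Reg}_{\mathrm{o.t.}(Z)}$. LST numbers. $\mathrm{LST}(Q_0,\dots,Q_n)$ is the least infinite cardinal $\kappa$ such that for every first-order vocabulary $\mathcal L$ with $|\mathcal L|<\kappa$, every $\mathcal L$-structure $\mathcal A$ has a substructure of cardinality less than $\kappa$ that is elementary for all formulas of the language $\mathcal L\cup\{Q_0,\dots,Q_n\}$. If there is no such $\kappa$, the LST number is $\infty$ (greater than every cardinal). Also $\min(\emptyset)=\infty$. *)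

theory Defs
  imports "HOL-Library.Equipollence"
begin

section \<open>The universe of sets\<close>

text \<open>
  A type of this class plays the role of the universe \<open>V\<close> of ZFC; \<open>elts x\<close> is the
  extension of the set \<open>x\<close>. Separation, replacement and foundation are stated for arbitrary
  HOL predicates and functions. The axiom of choice need not be assumed: with separation and
  power set it follows from the choice operator of HOL. Classes are the HOL sets over the type.
\<close>

class zfc_universe =
  fixes elts :: "'a \<Rightarrow> 'a set"
  assumes extensionality: "elts x = elts y \<Longrightarrow> x = y"
    and foundation: "wf {(x, y). x \<in> elts y}"
    and pairing: "\<exists>z. elts z = {x, y}"
    and union: "\<exists>z. elts z = (\<Union>y\<in>elts x. elts y)"
    and power_set: "\<exists>z. elts z = {y. elts y \<subseteq> elts x}"
    and separation: "\<exists>z. elts z = {y \<in> elts x. P y}"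
    and replacement: "\<exists>z. elts z = F ` elts x"
    and infinity: "\<exists>w. (\<exists>e\<in>elts w. elts e = {}) \<and>
                     (\<forall>x\<in>elts w. \<exists>y\<in>elts w. elts y = insert x (elts x))"


section \<open>Ordinals, cardinals, cofinality\<close>

definition Ord :: "'v::zfc_universe \<Rightarrow> bool" where
  "Ord a \<longleftrightarrow> (\<forall>x\<in>elts a. elts x \<subseteq> elts a) \<and> (\<forall>x\<in>elts a. \<forall>y\<in>elts x. elts y \<subseteq> elts x)"

definition On :: "'v::zfc_universe set" where
  "On = {a. Ord a}"

text \<open>
  The members of \<open>On \<union> {On}\<close> are represented uniformly as classes: an ordinal \<open>a\<close> by
  \<open>elts a\<close>, and \<open>On\<close> by itself. The order is then inclusion, and an ordinal \<open>a\<close> lies below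
  the bound \<open>\<alpha>\<close> iff \<open>a \<in> \<alpha>\<close>. The value \<open>\<infinity>\<close>, which exceeds every cardinal, is
  represented by \<open>On\<close> as well.
\<close>

definition ext_On :: "'v::zfc_universe set set" where
  "ext_On = insert On (elts ` On)"

definition least_Ord :: "'v::zfc_universe set \<Rightarrow> 'v" where
  "least_Ord C = (THE a. a \<in> C \<inter> On \<and> (\<forall>b\<in>C \<inter> On. elts a \<subseteq> elts b))"

text \<open>Minimum of a class of ordinals as an extended value, with \<open>min \<emptyset> = \<infinity>\<close>.\<close>

definition min_or_infty :: "'v::zfc_universe set \<Rightarrow> 'v set" where
  "min_or_infty C = (if C = {} then On else elts (least_Ord C))"

definition vcard :: "'v::zfc_universe set \<Rightarrow> 'v" where
  "vcard X = least_Ord {a. elts a \<approx> X}"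

definition infinite_cardinal :: "'v::zfc_universe \<Rightarrow> bool" where
  "infinite_cardinal k \<longleftrightarrow> Ord k \<and> infinite (elts k) \<and> vcard (elts k) = k"

text \<open>
  Orders are reflexive relations on their field, as in the library. The reflexive convention
  makes every order type representable, including the order types 0 and 1.
\<close>

definition ord_rel :: "'v::zfc_universe \<Rightarrow> 'v rel" where
  "ord_rel a = {(x, y). x \<in> elts a \<and> y \<in> elts a \<and> (x = y \<or> x \<in> elts y)}"

definition otype :: "'v::zfc_universe rel \<Rightarrow> 'v" where
  "otype r = (THE a. Ord a \<and> (r, ord_rel a) \<in> ordIso)"

definition cofinal_in :: "'v set \<Rightarrow> 'v rel \<Rightarrow> bool" where
  "cofinal_in C r \<longleftrightarrow> C \<subseteq> Field r \<and> (\<forall>x\<in>Field r. \<exists>c\<in>C. (x, c) \<in> r)"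

definition cofinality :: "'v::zfc_universe rel \<Rightarrow> 'v" where
  "cofinality r = least_Ord {vcard C | C. cofinal_in C r}"


section \<open>Classes of regular cardinals\<close>

definition Reg :: "'v::zfc_universe set" where
  "Reg = {k. infinite_cardinal k \<and> cofinality (ord_rel k) = k}"

text \<open>Suprema are taken of nonempty sets only; otherwise 0 would belong to every closed class.\<close>

definition closed_class :: "'v::zfc_universe set \<Rightarrow> bool" where
  "closed_class D \<longleftrightarrow> D \<subseteq> On \<and>
     (\<forall>s u. elts s \<noteq> {} \<and> elts s \<subseteq> D \<and> elts u = (\<Union>x\<in>elts s. elts x) \<longrightarrow> u \<in> D)"

definition generated_closed_class :: "'v::zfc_universe set \<Rightarrow> 'v set" where
  "generated_closed_class C = \<Inter>{D. closed_class D \<and> C \<subseteq> D}"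

definition successor_elements :: "'v::zfc_universe set \<Rightarrow> 'v set" where
  "successor_elements D =
     {s \<in> D. \<exists>p\<in>D. p \<in> elts s \<and> \<not> (\<exists>d\<in>D. p \<in> elts d \<and> d \<in> elts s)}"

text \<open>\<open>Reg_at \<alpha>\<close> is $\mathrm{Reg}_\alpha$, by recursion on \<open>\<alpha>\<close> (see \<open>Reg_at_rec\<close> below).\<close>

definition ord_below :: "('v::zfc_universe set \<times> 'v set) set" where
  "ord_below = {(elts b, A) | b A. b \<in> A}"

definition Reg_at :: "'v::zfc_universe set \<Rightarrow> 'v set" where
  "Reg_at = wfrec ord_below
     (\<lambda>f \<alpha>. successor_elements (generated_closed_class (Reg - (\<Union>b\<in>\<alpha>. f (elts b)))))"

definition Reg_below :: "'v::zfc_universe set \<Rightarrow> 'v set" where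
  "Reg_below \<alpha> = (\<Union>b\<in>\<alpha>. Reg_at (elts b))"

definition Reg_from :: "'v::zfc_universe set \<Rightarrow> 'v set" where
  "Reg_from \<alpha> = Reg - Reg_below \<alpha>"

lemma wf_ord_below: "wf (ord_below :: ('v::zfc_universe set \<times> 'v set) set)"
proof -
  have step: "\<exists>z\<in>Q. \<forall>y. (y, z) \<in> ord_below \<longrightarrow> y \<notin> Q" if "A \<in> Q" for A and Q :: "'v set set"
  proof (cases "\<exists>b. elts b \<in> Q")
    case True
    then obtain b where b: "b \<in> {b. elts b \<in> Q}" by blast
    obtain m where "m \<in> {b. elts b \<in> Q}"
      and "\<And>y. (y, m) \<in> {(x, y). x \<in> elts y} \<Longrightarrow> y \<notin> {b. elts b \<in> Q}"
      using wfE_min[OF foundation b] by metis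
    then show ?thesis
      by (intro bexI[of _ "elts m"]) (auto simp: ord_below_def)
  next
    case False
    then show ?thesis using that by (auto simp: ord_below_def)
  qed
  show ?thesis
    by (rule wfI_min) (use step in blast)
qed

lemma Reg_at_rec: "Reg_at \<alpha> = successor_elements (generated_closed_class (Reg_from \<alpha>))"
proof -
  have "cut Reg_at ord_below \<alpha> (elts b) = Reg_at (elts b)" if "b \<in> \<alpha>" for b
    by (rule cut_apply) (use that in \<open>auto simp: ord_below_def\<close>)
  then have "(\<Union>b\<in>\<alpha>. cut Reg_at ord_below \<alpha> (elts b)) = Reg_below \<alpha>"
    by (simp add: Reg_below_def)
  then show ?thesis
    using def_wfrec[OF Reg_at_def[THEN eq_reflection] wf_ord_below, of \<alpha>]
    by (simp add: Reg_from_def)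
qed


section \<open>Languages with generalised quantifiers\<close>

text \<open>
  A quantifier consists of its type \<open>(n\<^sub>1, \<dots>, n\<^sub>k)\<close> and the assignment \<open>A \<mapsto> Q\<^sub>A\<close>. Tuples
  are lists, so an element of \<open>Q\<^sub>A\<close> is a list of length \<open>k\<close> whose \<open>i\<close>-th entry is a set of lists
  of length \<open>n\<^sub>i\<close>.
\<close>

type_synonym 'v gquant = "nat list \<times> ('v set \<Rightarrow> 'v list set list set)"

definition tuples :: "'v set \<Rightarrow> nat \<Rightarrow> 'v list set" where
  "tuples A n = {xs. length xs = n \<and> set xs \<subseteq> A}"

record 'v vocabulary =
  funs :: "'v set"
  fun_arity :: "'v \<Rightarrow> nat"
  rels :: "'v set"
  rel_arity :: "'v \<Rightarrow> nat"

text \<open>Constants are function symbols of arity 0. The same set may serve both as a function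
  symbol and as a relation symbol, so the size of a vocabulary is that of the disjoint union.\<close>

definition symbols :: "'v vocabulary \<Rightarrow> ('v + 'v) set" where
  "symbols L = funs L <+> rels L"

record 'v struct =
  dom :: "'v set"
  fun_int :: "'v \<Rightarrow> 'v list \<Rightarrow> 'v"
  rel_int :: "'v \<Rightarrow> 'v list set"

definition is_structure :: "'v::zfc_universe vocabulary \<Rightarrow> 'v struct \<Rightarrow> bool" where
  "is_structure L M \<longleftrightarrow> dom M \<in> range elts \<and> dom M \<noteq> {} \<and>
     (\<forall>f\<in>funs L. \<forall>xs\<in>tuples (dom M) (fun_arity L f). fun_int M f xs \<in> dom M) \<and>
     (\<forall>R\<in>rels L. rel_int M R \<subseteq> tuples (dom M) (rel_arity L R))"

definition is_substructure :: "'v::zfc_universe vocabulary \<Rightarrow> 'v struct \<Rightarrow> 'v struct \<Rightarrow> bool" where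
  "is_substructure L N M \<longleftrightarrow> is_structure L N \<and> dom N \<subseteq> dom M \<and>
     (\<forall>f\<in>funs L. \<forall>xs\<in>tuples (dom N) (fun_arity L f). fun_int N f xs = fun_int M f xs) \<and>
     (\<forall>R\<in>rels L. rel_int N R = rel_int M R \<inter> tuples (dom N) (rel_arity L R))"

datatype 'v trm = Var nat | App 'v "'v trm list"

text \<open>\<open>Quant i [(vs\<^sub>1, \<phi>\<^sub>1), \<dots>, (vs\<^sub>k, \<phi>\<^sub>k)]\<close> applies the \<open>i\<close>-th quantifier of a given list, binding
  the tuple of variables \<open>vs\<^sub>j\<close> in \<open>\<phi>\<^sub>j\<close>.\<close>

datatype 'v form =
    Equal "'v trm" "'v trm"
  | Rel 'v "'v trm list"
  | Neg "'v form"
  | Conj "'v form" "'v form"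
  | Exists nat "'v form"
  | Quant nat "(nat list \<times> 'v form) list"

fun trm_of :: "'v vocabulary \<Rightarrow> 'v trm \<Rightarrow> bool" where
  "trm_of L (Var n) = True"
| "trm_of L (App f ts) = (f \<in> funs L \<and> length ts = fun_arity L f \<and> (\<forall>t\<in>set ts. trm_of L t))"

fun form_of :: "'v vocabulary \<Rightarrow> 'v gquant list \<Rightarrow> 'v form \<Rightarrow> bool" where
  "form_of L Qs (Equal s t) = (trm_of L s \<and> trm_of L t)"
| "form_of L Qs (Rel R ts) =
     (R \<in> rels L \<and> length ts = rel_arity L R \<and> (\<forall>t\<in>set ts. trm_of L t))"
| "form_of L Qs (Neg p) = form_of L Qs p"
| "form_of L Qs (Conj p q) = (form_of L Qs p \<and> form_of L Qs q)"
| "form_of L Qs (Exists n p) = form_of L Qs p"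
| "form_of L Qs (Quant i bs) =
     (i < length Qs \<and> map (\<lambda>(vs, p). length vs) bs = fst (Qs ! i) \<and>
      (\<forall>(vs, p)\<in>set bs. distinct vs \<and> form_of L Qs p))"

fun trm_val :: "'v struct \<Rightarrow> (nat \<Rightarrow> 'v) \<Rightarrow> 'v trm \<Rightarrow> 'v" where
  "trm_val M a (Var n) = a n"
| "trm_val M a (App f ts) = fun_int M f (map (trm_val M a) ts)"

definition assign :: "(nat \<Rightarrow> 'v) \<Rightarrow> nat list \<Rightarrow> 'v list \<Rightarrow> nat \<Rightarrow> 'v" where
  "assign a vs xs n = (case map_of (zip vs xs) n of Some x \<Rightarrow> x | None \<Rightarrow> a n)"

fun sat :: "'v gquant list \<Rightarrow> 'v struct \<Rightarrow> (nat \<Rightarrow> 'v) \<Rightarrow> 'v form \<Rightarrow> bool" where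
  "sat Qs M a (Equal s t) = (trm_val M a s = trm_val M a t)"
| "sat Qs M a (Rel R ts) = (map (trm_val M a) ts \<in> rel_int M R)"
| "sat Qs M a (Neg p) = (\<not> sat Qs M a p)"
| "sat Qs M a (Conj p q) = (sat Qs M a p \<and> sat Qs M a q)"
| "sat Qs M a (Exists n p) = (\<exists>x\<in>dom M. sat Qs M (a(n := x)) p)"
| "sat Qs M a (Quant i bs) =
     (map (\<lambda>(vs, p). {xs \<in> tuples (dom M) (length vs). sat Qs M (assign a vs xs) p}) bs
        \<in> snd (Qs ! i) (dom M))"

definition elementary_substructure ::
    "'v::zfc_universe vocabulary \<Rightarrow> 'v gquant list \<Rightarrow> 'v struct \<Rightarrow> 'v struct \<Rightarrow> bool" where
  "elementary_substructure L Qs N M \<longleftrightarrow> is_substructure L N M \<and>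
     (\<forall>p a. form_of L Qs p \<and> range a \<subseteq> dom N \<longrightarrow> (sat Qs N a p \<longleftrightarrow> sat Qs M a p))"

definition LST :: "'v::zfc_universe gquant list \<Rightarrow> 'v set" where
  "LST Qs = min_or_infty {k. infinite_cardinal k \<and>
     (\<forall>L M. symbols L \<prec> elts k \<and> is_structure L M \<longrightarrow>
        (\<exists>N. elementary_substructure L Qs N M \<and> dom N \<prec> elts k))}"


section \<open>The quantifiers\<close>

definition unary :: "'v set \<Rightarrow> 'v list set" where
  "unary X = (\<lambda>x. [x]) ` X"

definition binary :: "'v rel \<Rightarrow> 'v list set" where
  "binary X = (\<lambda>(x, y). [x, y]) ` X"

definition Hartig :: "'v::zfc_universe gquant" where
  "Hartig = ([1, 1], \<lambda>A. {[unary X, unary Y] | X Y. X \<subseteq> A \<and> Y \<subseteq> A \<and> X \<approx> Y})"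

definition Q_ec :: "'v::zfc_universe gquant" where
  "Q_ec = ([2, 2], \<lambda>A. {[binary X, binary Y] | X Y.
     X \<subseteq> A \<times> A \<and> Y \<subseteq> A \<times> A \<and>
     Linear_order X \<and> Linear_order Y \<and> cofinality X = cofinality Y})"

definition Q_up :: "'v::zfc_universe set \<Rightarrow> 'v gquant" where
  "Q_up \<alpha> = ([2, 2, 2], \<lambda>A. {[binary X, binary Y, binary Z] | X Y Z.
     X \<subseteq> A \<times> A \<and> Y \<subseteq> A \<times> A \<and> Z \<subseteq> A \<times> A \<and>
     Linear_order X \<and> Linear_order Y \<and> cofinality X = cofinality Y \<and>
     Well_order Z \<and> otype Z \<in> \<alpha> \<and> cofinality X \<in> Reg_at (elts (otype Z))})"

definition R_up :: "'v::zfc_universe set \<Rightarrow> 'v gquant" where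
  "R_up \<alpha> = ([1, 2], \<lambda>A. {[unary X, binary Z] | X Z.
     X \<subseteq> A \<and> Z \<subseteq> A \<times> A \<and>
     Well_order Z \<and> otype Z \<in> \<alpha> \<and> vcard X \<in> Reg_at (elts (otype Z))})"

text \<open>The ordinals 0 and 1 as classes.\<close>

definition ord0 :: "'v::zfc_universe set" where
  "ord0 = {}"

definition ord1 :: "'v::zfc_universe set" where
  "ord1 = {a. elts a = {}}"

end

theory Submission
  imports Defs
begin

text \<open>
  To prove \<open>LST Qs' \<ge> LST Qs\<close> it suffices that every cardinal \<open>k\<close> with the defining property for
  \<open>Qs'\<close> has it for \<open>Qs\<close> (\<open>LST_antimono\<close>). For this, each structure \<open>M\<close> of size at least \<open>k\<close> is
  expanded, and sometimes extended, by fewer than \<open>k\<close> new relations so that the quantifiers \<open>Qs\<close>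
  become definable from \<open>Qs'\<close> on the original domain, not only in the new structure but in all
  its elementary substructures. A small elementary substructure of the new structure for \<open>Qs'\<close> then
  restricts to one of \<open>M\<close> for \<open>Qs\<close> (\<open>LST_at_transfer\<close>).

  The basic expansion is a well-order \<open>W\<close> of an infinite domain with a largest element. Its initial
  segments realise every order type up to the cardinality of the domain, and the same holds in any
  elementary substructure, where the segments may have smaller order types but are again computed in
  the universe. A class \<open>Reg_at (elts c)\<close> contains a regular \<open>s\<close> iff the regular cardinals left over
  at stage \<open>c\<close> are nonempty and bounded below \<open>s\<close> (\<open>Reg_at_iff\<close>). Hence the classes are disjoint,
  the index of a class never exceeds its elements (\<open>Reg_at_index_le\<close>), and every regular cardinal
  other than \<open>\<omega>\<close> is in one of them (\<open>Reg_at_exists\<close>). All indices and regular cardinals that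
  matter in a structure are therefore order types of segments of \<open>W\<close>.

  With \<open>Q_up \<alpha>\<close>, an ordinal is recognised as regular by its cofinality being different from the
  cofinalities of all smaller ordinals; this and the equicardinality quantifier define \<open>R_up \<alpha>\<close>
  (\<open>R_up_by_Q_up\<close>). Linear orders of uncountable cofinality are compared by \<open>Q_up On\<close> with a
  segment of \<open>W\<close> as third argument; the remaining cofinalities 0, 1 and \<open>\<omega>\<close> are distinguished by
  first-order properties (\<open>Q_ec_by_Q_up\<close>). The class \<open>Reg_at {}\<close> consists of the uncountable successor
  cardinals, and equicardinality alone defines these (\<open>R_up_1_by_Hartig\<close>).

  To lower the bound from \<open>\<alpha>\<close> to an ordinal \<open>b < k\<close>, the points of the segment of type \<open>b\<close> receive names,
  so that substructures keep this segment. As the classes are disjoint, the order type of the last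
  argument is below \<open>b\<close> iff the last argument can be replaced by a segment of type below \<open>b\<close>
  (\<open>defines_lower\<close>). If \<open>b \<ge> k\<close> but the number for \<open>b\<close> does not exceed \<open>min (Reg_at (elts b))\<close>, one
  first passes to a substructure in which no element of \<open>Reg_at (elts b)\<close> or of a later class
  can occur; there the two bounds make no difference (\<open>LST_at_lower_small\<close>).

  Defining \<open>Q_up On\<close> from \<open>Q_ec\<close> is the hardest step, as the order type of a definable well-order has to be
  compared with segments of \<open>W\<close>, and an elementary substructure must contain an isomorphism.
  Therefore the structure is extended by codes for all binary relations on its domain. For a
  linear order of the extended structure one of the following exists as a code: a subset without a
  minimum, an isomorphism with a segment, or an embedding of all of \<open>W\<close>. Elementary substructures
  inherit this trichotomy (\<open>sat_trichotomy_fm\<close>), and for a true well-order with a relevant order type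
  only the second case remains (\<open>not_order_embedding\<close>). The classes themselves are the unique solution
  of a recursion along \<open>W\<close> that is expressible with \<open>Q_ec\<close> (\<open>hierarchy_rec_iff\<close>).
\<close>

section \<open>Sets and ordinals in the universe\<close>

definition small :: "'v::zfc_universe set \<Rightarrow> bool" where
  "small X \<longleftrightarrow> X \<in> range elts"

definition set_of :: "'v::zfc_universe set \<Rightarrow> 'v" where
  "set_of X = (SOME z. elts z = X)"

lemma elts_set_of: "small X \<Longrightarrow> elts (set_of X) = X"
  unfolding small_def set_of_def by (rule someI_ex) auto

lemma elts_antisym: "elts x \<subseteq> elts y \<Longrightarrow> elts y \<subseteq> elts x \<Longrightarrow> x = y"
  by (rule extensionality) blast

lemma small_elts [simp, intro]: "small (elts x)"
  by (simp add: small_def)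

lemma small_subset: "small Y \<Longrightarrow> X \<subseteq> Y \<Longrightarrow> small X"
proof -
  assume "small Y" "X \<subseteq> Y"
  then obtain y where "Y = elts y" by (auto simp: small_def)
  then have "X = {x \<in> elts y. x \<in> X}" using \<open>X \<subseteq> Y\<close> by auto
  then show "small X" using separation[of y "\<lambda>x. x \<in> X"] by (auto simp: small_def)
qed

lemma small_image:
  fixes f :: "'v::zfc_universe \<Rightarrow> 'v"
  shows "small X \<Longrightarrow> small (f ` X)"
proof -
  assume "small X"
  then obtain x where "X = elts x" by (auto simp: small_def)
  then obtain z where "elts z = f ` X" using replacement[of f x] by auto
  then show "small (f ` X)" by (metis small_elts)
qed

lemma small_UN:
  fixes F :: "'v::zfc_universe \<Rightarrow> 'v set"
  shows "small X \<Longrightarrow> (\<And>x. x \<in> X \<Longrightarrow> small (F x)) \<Longrightarrow> small (\<Union>x\<in>X. F x)"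
proof -
  assume X: "small X" and F: "\<And>x. x \<in> X \<Longrightarrow> small (F x)"
  obtain z where z: "elts z = (\<lambda>x. set_of (F x)) ` X"
    using small_image[OF X, of "\<lambda>x. set_of (F x)"] by (auto simp: small_def)
  obtain u where "elts u = (\<Union>y\<in>elts z. elts y)" using union by blast
  then have "elts u = (\<Union>x\<in>X. F x)" using z F by (auto simp: elts_set_of)
  then show ?thesis by (metis small_elts)
qed

lemma small_doubleton: "small {x, y}"
  using pairing[of x y] by (metis small_elts)

lemma small_Un: "small X \<Longrightarrow> small Y \<Longrightarrow> small (X \<union> Y)"
  using small_UN[OF small_doubleton[of "set_of X" "set_of Y"], of elts]
  by (simp add: elts_set_of)

lemma small_insert: "small X \<Longrightarrow> small (insert x X)"
  using small_Un[OF small_doubleton[of x x]] by simp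

lemma small_lepoll:
  fixes X Y :: "'v::zfc_universe set"
  assumes "X \<lesssim> Y" "small Y" shows "small X"
proof -
  obtain g where "X \<subseteq> g ` Y" using assms(1) by (auto simp: lepoll_iff)
  then show ?thesis using small_image[OF assms(2)] small_subset by blast
qed

lemma small_Pow_codes:
  assumes "small A"
  shows "small {x. elts x \<subseteq> A}"
proof -
  obtain a where "A = elts a" using assms by (auto simp: small_def)
  then obtain z where "elts z = {x. elts x \<subseteq> A}" using power_set[of a] by auto
  then show ?thesis by (metis small_elts)
qed

lemma mem_not_refl: "x \<notin> elts x"
  using wf_irrefl[OF foundation] by auto

lemma mem_not_sym: "x \<in> elts y \<Longrightarrow> y \<notin> elts x"
  using wf_not_sym[OF foundation, of x y] by auto

lemma mem_induct: "(\<And>x. (\<And>y. y \<in> elts x \<Longrightarrow> P y) \<Longrightarrow> P x) \<Longrightarrow> P x"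
  using wf_induct_rule[OF foundation] by (metis case_prodI mem_Collect_eq)

text \<open>
  The pairs with a fixed second component \<open>t\<close> form a copy of the universe. By foundation no such
  pair is an element of \<open>t\<close>, so the copy provides as many new objects outside \<open>t\<close> as required.
\<close>

definition tag :: "'v::zfc_universe set \<Rightarrow> 'v \<Rightarrow> 'v" where
  "tag T x = set_of {x, set_of T}"

lemma elts_tag: "elts (tag T x) = {x, set_of T}"
  by (simp add: tag_def elts_set_of small_doubleton)

lemma tag_inject [simp]: "tag T x = tag T y \<longleftrightarrow> x = y"
  by (metis elts_tag doubleton_eq_iff)

lemma tag_notin: "small T \<Longrightarrow> tag T x \<notin> T"
  using mem_not_sym[of "tag T x" "set_of T"] by (auto simp: elts_tag elts_set_of)

lemma Ord_mem: "Ord a \<Longrightarrow> x \<in> elts a \<Longrightarrow> Ord x"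
  unfolding Ord_def by blast

lemma Ord_trans: "Ord a \<Longrightarrow> x \<in> elts a \<Longrightarrow> y \<in> elts x \<Longrightarrow> y \<in> elts a"
  unfolding Ord_def by blast

lemma Ord_mem_subset: "Ord a \<Longrightarrow> x \<in> elts a \<Longrightarrow> elts x \<subseteq> elts a"
  unfolding Ord_def by blast

lemma OrdI: "(\<And>x. x \<in> elts a \<Longrightarrow> Ord x) \<Longrightarrow> (\<And>x y. x \<in> elts a \<Longrightarrow> y \<in> elts x \<Longrightarrow> y \<in> elts a) \<Longrightarrow> Ord a"
  unfolding Ord_def by blast

lemma Ord_linear: "Ord x \<Longrightarrow> Ord y \<Longrightarrow> x \<in> elts y \<or> x = y \<or> y \<in> elts x"
proof (induction x arbitrary: y rule: mem_induct)
  case (1 x)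
  note IHx = 1
  show ?case using IHx(3)
  proof (induction y rule: mem_induct)
    case (1 y)
    have "x = y" if "x \<notin> elts y" "y \<notin> elts x"
    proof (rule extensionality, rule set_eqI)
      fix z
      show "z \<in> elts x \<longleftrightarrow> z \<in> elts y"
        using IHx(1)[of z y] 1(1)[of z] that IHx(2) 1(2) Ord_mem Ord_trans by metis
    qed
    then show ?case by blast
  qed
qed

lemma Ord_subset_iff: "Ord a \<Longrightarrow> Ord b \<Longrightarrow> elts a \<subseteq> elts b \<longleftrightarrow> a \<in> elts b \<or> a = b"
  using Ord_linear Ord_mem_subset mem_not_refl by blast

lemma Ord_not_mem: "Ord a \<Longrightarrow> Ord b \<Longrightarrow> a \<notin> elts b \<longleftrightarrow> elts b \<subseteq> elts a"
  using Ord_linear Ord_mem_subset mem_not_refl by blast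

lemma Ord_subset_linear: "Ord a \<Longrightarrow> Ord b \<Longrightarrow> elts a \<subseteq> elts b \<or> elts b \<subseteq> elts a"
  using Ord_linear Ord_mem_subset by blast

lemma least_Ord_props:
  assumes "C \<inter> On \<noteq> {}"
  shows "least_Ord C \<in> C" and "Ord (least_Ord C)"
    and "\<And>b. b \<in> C \<Longrightarrow> Ord b \<Longrightarrow> elts (least_Ord C) \<subseteq> elts b"
proof -
  obtain m where m: "m \<in> C \<inter> On" "\<And>y. y \<in> elts m \<Longrightarrow> y \<notin> C \<inter> On"
    using wfE_min'[OF foundation assms] by auto
  have "m \<in> C \<inter> On \<and> (\<forall>b\<in>C \<inter> On. elts m \<subseteq> elts b)"
    using m Ord_not_mem by (auto simp: On_def)
  then have "least_Ord C \<in> C \<inter> On \<and> (\<forall>b\<in>C \<inter> On. elts (least_Ord C) \<subseteq> elts b)"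
    unfolding least_Ord_def
    by (rule theI) (use \<open>m \<in> C \<inter> On \<and> _\<close> in \<open>blast intro: extensionality\<close>)
  then show "least_Ord C \<in> C" "Ord (least_Ord C)"
    "\<And>b. b \<in> C \<Longrightarrow> Ord b \<Longrightarrow> elts (least_Ord C) \<subseteq> elts b"
    by (auto simp: On_def)
qed

lemma Ord_least:
  assumes "P a" "Ord a"
  shows "\<exists>m. P m \<and> Ord m \<and> (\<forall>b. P b \<longrightarrow> Ord b \<longrightarrow> elts m \<subseteq> elts b)"
  using least_Ord_props[of "{a. P a}"] assms by (auto simp: On_def)

lemma not_small_On: "\<not> small (On :: 'v::zfc_universe set)"
proof
  assume s: "small (On :: 'v set)"
  have "Ord (set_of (On::'v set))"
    by (rule OrdI) (use Ord_mem in \<open>auto simp: elts_set_of[OF s, unfolded On_def] On_def\<close>)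
  then have "set_of On \<in> elts (set_of (On::'v set))"
    unfolding elts_set_of[OF s] by (simp add: On_def)
  then show False using mem_not_refl by blast
qed

lemma Ord_succ:
  assumes "Ord a" shows "Ord (set_of (insert a (elts a)))"
    and "elts (set_of (insert a (elts a))) = insert a (elts a)"
proof -
  show e: "elts (set_of (insert a (elts a))) = insert a (elts a)"
    by (simp add: elts_set_of small_insert)
  show "Ord (set_of (insert a (elts a)))"
    by (rule OrdI) (use assms in \<open>auto simp: e intro: Ord_mem Ord_trans\<close>)
qed

section \<open>Order types of well-orders\<close>

text \<open>The Mostowski collapse sends a point of a well-order to the order type of its predecessors.\<close>

definition coll :: "'v::zfc_universe rel \<Rightarrow> 'v \<Rightarrow> 'v" where
  "coll r = wfrec (r - Id) (\<lambda>f x. set_of (f ` underS r x))"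

lemma coll_rec:
  assumes "Well_order r" shows "coll r x = set_of (coll r ` underS r x)"
proof -
  have wf: "wf (r - Id)" using assms by (simp add: well_order_on_def)
  have "cut (coll r) (r - Id) x y = coll r y" if "y \<in> underS r x" for y
    by (rule cut_apply) (use that in \<open>auto simp: underS_def\<close>)
  then have "cut (coll r) (r - Id) x ` underS r x = coll r ` underS r x" by simp
  then show ?thesis
    using def_wfrec[OF coll_def[THEN eq_reflection] wf, of x] by simp
qed

lemma underS_subset_Field: "underS r x \<subseteq> Field r"
  by (auto simp: underS_def Field_def)

lemma underS_in_Field: "y \<in> underS r x \<Longrightarrow> y \<in> Field r"
  by (auto simp: underS_def Field_def)

context
  fixes r :: "'v::zfc_universe rel"
  assumes wo: "Well_order r" and sm: "small (Field r)"
begin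

lemma elts_coll: "elts (coll r x) = coll r ` underS r x"
  using coll_rec[OF wo, of x] small_image small_subset[OF sm underS_subset_Field]
  by (metis elts_set_of)

lemma wo_linear: "x \<in> Field r \<Longrightarrow> y \<in> Field r \<Longrightarrow> x \<in> underS r y \<or> x = y \<or> y \<in> underS r x"
  using wo by (auto simp: order_on_defs underS_def total_on_def)

lemma wo_transS: "x \<in> underS r y \<Longrightarrow> y \<in> underS r z \<Longrightarrow> x \<in> underS r z"
  using wo by (auto simp: order_on_defs underS_def dest: transD antisymD)

lemma wo_le_iff: "x \<in> Field r \<Longrightarrow> y \<in> Field r \<Longrightarrow> (x, y) \<in> r \<longleftrightarrow> x \<in> underS r y \<or> x = y"
  using wo by (auto simp: order_on_defs underS_def refl_on_def)

lemma wo_inductS: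
  assumes "\<And>x. (\<And>y. y \<in> underS r x \<Longrightarrow> P y) \<Longrightarrow> P x" shows "P x"
proof -
  have "wf (r - Id)" using wo by (simp add: well_order_on_def)
  then show ?thesis
    by (rule wf_induct_rule) (auto intro: assms simp: underS_def)
qed

lemma Ord_coll: "Ord (coll r x)"
proof (induction x rule: wo_inductS)
  case (1 x)
  show ?case
  proof (rule OrdI)
    show "Ord y" if "y \<in> elts (coll r x)" for y using that 1 by (auto simp: elts_coll)
    show "z \<in> elts (coll r x)" if "y \<in> elts (coll r x)" "z \<in> elts y" for y z
      using that wo_transS by (auto simp: elts_coll)
  qed
qed

lemma coll_mem_iff:
  assumes "x \<in> Field r" "y \<in> Field r"
  shows "coll r x \<in> elts (coll r y) \<longleftrightarrow> x \<in> underS r y"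
proof
  assume "coll r x \<in> elts (coll r y)"
  then have "coll r y \<notin> elts (coll r x)" "coll r x \<noteq> coll r y"
    using mem_not_sym mem_not_refl by metis+
  then show "x \<in> underS r y" using wo_linear[OF assms] elts_coll by blast
qed (simp add: elts_coll)

lemma coll_eq_iff: "x \<in> Field r \<Longrightarrow> y \<in> Field r \<Longrightarrow> coll r x = coll r y \<longleftrightarrow> x = y"
  using wo_linear coll_mem_iff mem_not_refl by metis

lemma inj_on_coll: "inj_on (coll r) (Field r)"
  by (simp add: inj_on_def coll_eq_iff)

lemma underS_eqpoll_coll: "underS r x \<approx> elts (coll r x)"
  using inj_on_image_eqpoll_self[OF inj_on_subset[OF inj_on_coll underS_subset_Field]]
  by (metis elts_coll eqpoll_sym)

end

lemma Field_ord_rel [simp]: "Field (ord_rel a) = elts a"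
  by (auto simp: ord_rel_def Field_def)

lemma Well_order_ord_rel: "Ord a \<Longrightarrow> Well_order (ord_rel a)"
proof -
  assume a: "Ord a"
  have "wf (ord_rel a - Id)"
    by (rule wf_subset[OF foundation]) (auto simp: ord_rel_def)
  moreover have "trans (ord_rel a)"
    using a Ord_mem Ord_trans by (fastforce simp: trans_def ord_rel_def)
  moreover have "antisym (ord_rel a)"
    by (auto simp: antisym_def ord_rel_def dest: mem_not_sym)
  moreover have "total_on (elts a) (ord_rel a)"
    using Ord_linear[OF Ord_mem[OF a] Ord_mem[OF a]] by (auto simp: total_on_def ord_rel_def)
  moreover have "refl_on (elts a) (ord_rel a)"
    by (auto simp: refl_on_def ord_rel_def)
  moreover have "ord_rel a \<subseteq> elts a \<times> elts a" by (auto simp: ord_rel_def)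
  ultimately show ?thesis by (simp add: order_on_defs)
qed

lemma underS_ord_rel: "x \<in> elts a \<Longrightarrow> Ord a \<Longrightarrow> underS (ord_rel a) x = elts x"
  using Ord_trans mem_not_refl by (auto simp: ord_rel_def underS_def)

lemma coll_ord_rel: "Ord a \<Longrightarrow> x \<in> elts a \<Longrightarrow> coll (ord_rel a) x = x"
proof (induction x rule: mem_induct)
  case (1 x)
  have "coll (ord_rel a) ` elts x = elts x" using 1 Ord_trans by force
  then have "elts (coll (ord_rel a) x) = elts x"
    using elts_coll[OF Well_order_ord_rel, of a x] 1(2,3) by (simp add: underS_ord_rel)
  then show ?case by (rule extensionality)
qed

text \<open>Isomorphic well-orders collapse to the same ordinals, hence the order type is unique.\<close>

lemma coll_iso:
  assumes r: "Well_order r" "small (Field r)" and s: "Well_order s" "small (Field s)"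
    and f: "iso r s f" and x: "x \<in> Field r"
  shows "coll s (f x) = coll r x"
  using x
proof (induction x rule: wo_inductS[OF r])
  case (1 x)
  have bij: "bij_betw f (Field r) (Field s)"
    and ord: "\<And>a b. a \<in> Field r \<Longrightarrow> b \<in> Field r \<Longrightarrow> (a, b) \<in> r \<longleftrightarrow> (f a, f b) \<in> s"
    using f by (auto simp: iso_iff2)
  have "underS s (f x) = f ` underS r x"
  proof safe
    fix y assume y: "y \<in> underS s (f x)"
    then obtain z where "z \<in> Field r" "y = f z"
      using bij underS_subset_Field by (metis bij_betw_imp_surj_on imageE subsetD)
    then show "y \<in> f ` underS r x" using y ord[of z x] 1(2) by (auto simp: underS_def)
  next
    fix y assume y: "y \<in> underS r x"
    then have "y \<in> Field r" by (rule underS_in_Field)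
    then show "f y \<in> underS s (f x)"
      using y ord[of y x] 1(2) bij by (auto simp: underS_def bij_betw_def inj_on_def)
  qed
  then have "coll s ` underS s (f x) = coll r ` underS r x"
    using 1 underS_in_Field[of _ r x] by (force simp: image_image)
  then show ?case using elts_coll[OF r] elts_coll[OF s] extensionality by metis
qed

lemma iso_ord_rel:
  assumes r: "Well_order r" "small (Field r)"
  defines "a \<equiv> set_of (coll r ` Field r)"
  shows "Ord a" and "elts a = coll r ` Field r" and "iso r (ord_rel a) (coll r)"
proof -
  show e: "elts a = coll r ` Field r"
    using assms by (simp add: elts_set_of small_image)
  show "Ord a"
    by (rule OrdI) (auto simp: e Ord_coll[OF r] elts_coll[OF r] intro!: imageI underS_in_Field)
  have "(x, y) \<in> r \<longleftrightarrow> (coll r x, coll r y) \<in> ord_rel a" if "x \<in> Field r" "y \<in> Field r" for x y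
    using that by (auto simp: e ord_rel_def wo_le_iff[OF r] coll_mem_iff[OF r] coll_eq_iff[OF r])
  then show "iso r (ord_rel a) (coll r)"
    using inj_on_coll[OF r] by (simp add: iso_iff2 bij_betw_def e)
qed

lemma otype_unique:
  assumes r: "Well_order r" "small (Field r)" and a: "Ord a" "(r, ord_rel a) \<in> ordIso"
  shows "elts a = coll r ` Field r"
proof -
  obtain f where f: "iso r (ord_rel a) f" using a by (auto simp: ordIso_def)
  then have im: "f ` Field r = elts a" by (auto simp: iso_iff2 bij_betw_def)
  have "f x = coll r x" if "x \<in> Field r" for x
  proof -
    have "f x \<in> elts a" using im that by blast
    then show ?thesis
      using coll_iso[OF r Well_order_ord_rel[OF a(1)] _ f that] coll_ord_rel[OF a(1), of "f x"]
      by simp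
  qed
  then show ?thesis using im by (metis image_cong)
qed

lemma otype_props:
  fixes r :: "'a::zfc_universe rel"
  assumes r: "Well_order r" "small (Field r)"
  shows "Ord (otype r)" "(r, ord_rel (otype r)) \<in> ordIso" "elts (otype r) = coll r ` Field r"
proof -
  let ?a = "set_of (coll r ` Field r)"
  have a: "Ord ?a \<and> (r, ord_rel ?a) \<in> ordIso"
    using iso_ord_rel[OF r] r Well_order_ord_rel unfolding ordIso_def by blast
  have "\<exists>!a. Ord (a::'a) \<and> (r, ord_rel a) \<in> ordIso"
  proof (rule ex1I[of _ ?a], rule a)
    fix b :: 'a assume "Ord b \<and> (r, ord_rel b) \<in> ordIso"
    then have "elts b = coll r ` Field r" using otype_unique[OF r] by blast
    then show "b = ?a" using iso_ord_rel(2)[OF r] extensionality by metis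
  qed
  then have *: "Ord (otype r) \<and> (r, ord_rel (otype r)) \<in> ordIso"
    unfolding otype_def by (rule theI')
  then show "Ord (otype r)" "(r, ord_rel (otype r)) \<in> ordIso" by auto
  show "elts (otype r) = coll r ` Field r" using otype_unique[OF r] * by blast
qed

lemma otype_ordIso_iff:
  assumes r: "Well_order r" "small (Field r)" and s: "Well_order s" "small (Field s)"
  shows "otype r = otype s \<longleftrightarrow> (r, s) \<in> ordIso"
proof
  show "(r, s) \<in> ordIso" if "otype r = otype s"
    using otype_props(2)[OF r] otype_props(2)[OF s] that ordIso_symmetric ordIso_transitive
    by metis
next
  assume "(r, s) \<in> ordIso"
  then have "(r, ord_rel (otype s)) \<in> ordIso"
    using otype_props(2)[OF s] ordIso_transitive by blast
  then have "elts (otype s) = coll r ` Field r" using otype_unique[OF r] otype_props(1)[OF s] by blast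
  then show "otype r = otype s" using otype_props(3)[OF r] extensionality by metis
qed

definition segm :: "'v rel \<Rightarrow> 'v \<Rightarrow> 'v rel" where
  "segm r x = Restr r (underS r x)"

lemma Well_order_segm: "Well_order r \<Longrightarrow> Well_order (segm r x)"
  by (simp add: segm_def Well_order_Restr)

lemma Field_segm: "Well_order r \<Longrightarrow> Field (segm r x) = underS r x"
  unfolding segm_def
  by (rule Refl_Field_Restr2) (auto simp: order_on_defs underS_subset_Field)

lemma small_segm: "Well_order r \<Longrightarrow> small (Field r) \<Longrightarrow> small (Field (segm r x))"
  by (metis Field_segm small_subset underS_subset_Field)

lemma coll_segm:
  assumes r: "Well_order r" "small (Field r)" and y: "y \<in> underS r x"
  shows "coll (segm r x) y = coll r y"
  using y
proof (induction y rule: wo_inductS[OF r])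
  case (1 y)
  note s = Well_order_segm[OF r(1), of x] small_segm[OF r, of x]
  have "underS (segm r x) y = underS r y"
    using 1(2) wo_transS[OF r _ 1(2)] by (auto simp: segm_def underS_def)
  then have "coll (segm r x) ` underS (segm r x) y = coll r ` underS r y"
    using 1 wo_transS[OF r] by force
  then show ?case using elts_coll[OF r] elts_coll[OF s] extensionality by metis
qed

lemma otype_segm:
  assumes r: "Well_order r" "small (Field r)" and x: "x \<in> Field r"
  shows "otype (segm r x) = coll r x"
proof (rule extensionality)
  have "elts (otype (segm r x)) = coll (segm r x) ` underS r x"
    using otype_props(3)[OF Well_order_segm[OF r(1)] small_segm[OF r]] Field_segm[OF r(1)] by simp
  also have "\<dots> = coll r ` underS r x" using coll_segm[OF r] by auto
  finally show "elts (otype (segm r x)) = elts (coll r x)" by (simp add: elts_coll[OF r])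
qed

lemma zfc_choose_ordinal:
  assumes "small (A :: 'v::zfc_universe set)" obtains a :: "'v::zfc_universe" where "Ord a" "elts a \<approx> A"
proof -
  obtain r where r: "well_order_on A r" using well_order_on by blast
  then have F: "Field r = A" "Well_order r" using well_order_on_Well_order by blast+
  have s: "small (Field r)" using F assms by simp
  have "coll r ` A \<approx> A" using inj_on_image_eqpoll_self inj_on_coll[of r] F s by metis
  then have "elts (set_of (coll r ` Field r)) \<approx> A" using iso_ord_rel(2)[OF F(2) s] F(1) by simp
  with iso_ord_rel(1)[OF F(2) s] show thesis by (rule that)
qed

section \<open>Cardinality and cofinality\<close>

lemma lepoll_iff_card_of: "A \<lesssim> B \<longleftrightarrow> ordLeq3 (card_of A) (card_of B)"
  by (simp add: lepoll_def card_of_ordLeq)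

lemma not_lesspoll_iff: "\<not> A \<prec> B \<longleftrightarrow> B \<lesssim> A"
proof
  assume "\<not> A \<prec> B"
  moreover have "A \<lesssim> B \<or> B \<lesssim> A"
    using ordLeq_total[OF card_of_Well_order card_of_Well_order, of A B]
    by (simp add: lepoll_iff_card_of)
  ultimately show "B \<lesssim> A"
    using eqpoll_imp_lepoll[OF eqpoll_sym] unfolding lesspoll_def by blast
next
  assume "B \<lesssim> A"
  then show "\<not> A \<prec> B" using lesspoll_trans1[of B A B] by blast
qed

lemma lesspoll_iff_card_of: "A \<prec> B \<longleftrightarrow> ordLess2 (card_of A) (card_of B)"
proof -
  have "\<not> ordLess2 (card_of A) (card_of B) \<longleftrightarrow> B \<lesssim> A"
    unfolding lepoll_iff_card_of by (rule not_ordLess_iff_ordLeq) (rule card_of_Well_order)+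
  then show ?thesis using not_lesspoll_iff by blast
qed

text \<open>The collapse of a set of ordinals moves no element upwards.\<close>

lemma subset_ordinal_eqpoll:
  assumes b: "Ord b" and S: "S \<subseteq> elts b"
  obtains c where "Ord c" "elts c \<subseteq> elts b" "elts c \<approx> S"
proof -
  define r where "r = Restr (ord_rel b) S"
  have F: "Field r = S"
    unfolding r_def
    by (rule Refl_Field_Restr2) (use S Well_order_ord_rel[OF b] in \<open>auto simp: order_on_defs\<close>)
  have r: "Well_order r" "small (Field r)"
    using Well_order_Restr[OF Well_order_ord_rel[OF b], of S] small_subset[OF small_elts S] F
    by (simp_all add: F) (simp add: r_def F[unfolded r_def])
  have le: "elts (coll r x) \<subseteq> elts x" if "x \<in> S" for x
    using that
  proof (induction x rule: wo_inductS[OF r])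
    case (1 x)
    show ?case
    proof
      fix z assume "z \<in> elts (coll r x)"
      then obtain y where y: "y \<in> underS r x" "z = coll r y" by (auto simp: elts_coll[OF r])
      then have yS: "y \<in> S" and yx: "y \<in> elts x"
        using F underS_in_Field by (auto simp: r_def underS_def ord_rel_def)
      have oy: "Ord x" "Ord y" using Ord_mem[OF b] S yS 1(2) by auto
      have "coll r y \<in> elts y \<or> coll r y = y"
        using 1(1)[OF y(1) yS] Ord_subset_iff[OF Ord_coll[OF r] oy(2)] by blast
      then show "z \<in> elts x" using y yx Ord_trans[OF oy(1)] by auto
    qed
  qed
  have "coll r x \<in> elts b" if "x \<in> S" for x
  proof -
    have xb: "x \<in> elts b" using S that by blast
    then have "coll r x \<in> elts x \<or> coll r x = x"
      using le[OF that] Ord_subset_iff[OF Ord_coll[OF r] Ord_mem[OF b xb]] by blast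
    then show ?thesis using Ord_trans[OF b xb] xb by auto
  qed
  then show thesis
    using that[of "otype r"] otype_props[OF r] F inj_on_image_eqpoll_self[OF inj_on_coll[OF r]]
    by auto
qed

lemma vcard_props:
  fixes X :: "'a::zfc_universe set"
  assumes "small X"
  shows "Ord (vcard X)" and "elts (vcard X) \<approx> X"
    and "\<And>b. Ord b \<Longrightarrow> X \<lesssim> elts b \<Longrightarrow> elts (vcard X) \<subseteq> elts b"
proof -
  have ne: "{a::'a. elts a \<approx> X} \<inter> On \<noteq> {}"
  proof -
    obtain a :: 'a where "Ord a" "elts a \<approx> X" by (rule zfc_choose_ordinal[OF assms])
    then show ?thesis by (auto simp: On_def)
  qed
  note l = least_Ord_props[OF ne, folded vcard_def]
  show "Ord (vcard X)" "elts (vcard X) \<approx> X" using l by auto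
  fix b :: 'a assume b: "Ord b" "X \<lesssim> elts b"
  then obtain S where S: "S \<subseteq> elts b" "X \<approx> S"
    by (meson inj_on_image_eqpoll_self eqpoll_sym lepoll_def)
  obtain c where c: "Ord c" "elts c \<subseteq> elts b" "elts c \<approx> S"
    by (rule subset_ordinal_eqpoll[OF b(1) S(1)])
  then have "elts c \<approx> X" using S eqpoll_sym eqpoll_trans by blast
  then show "elts (vcard X) \<subseteq> elts b" using l(3)[of c] c by auto
qed

lemma vcard_cong: "X \<approx> Y \<Longrightarrow> vcard X = vcard Y"
  unfolding vcard_def by (metis eqpoll_sym eqpoll_trans)

lemma vcard_mono: "small Y \<Longrightarrow> X \<lesssim> Y \<Longrightarrow> elts (vcard X) \<subseteq> elts (vcard Y)"
  using vcard_props(3)[of X "vcard Y"] vcard_props(1,2)[of Y] small_lepoll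
  by (metis eqpoll_sym lepoll_trans2)

lemma vcard_elts_subset: "Ord a \<Longrightarrow> elts (vcard (elts a)) \<subseteq> elts a"
  using vcard_props(3)[of "elts a" a] by auto

lemma vcard_vcard: "small X \<Longrightarrow> vcard (elts (vcard X)) = vcard X"
  using vcard_props(2) vcard_cong by blast

lemma mem_cardinal_lesspoll:
  assumes "Ord k" "vcard (elts k) = k" "b \<in> elts k" shows "elts b \<prec> elts k"
proof (rule ccontr)
  assume "\<not> elts b \<prec> elts k"
  then have "elts k \<lesssim> elts b" by (simp add: not_lesspoll_iff)
  then have "elts k \<subseteq> elts b" using vcard_props(3)[of "elts k" b] assms Ord_mem by auto
  then show False using assms mem_not_refl by blast
qed

lemma lesspoll_cardinal_iff:
  assumes k: "infinite_cardinal k" and X: "small X"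
  shows "X \<prec> elts k \<longleftrightarrow> vcard X \<in> elts k"
proof
  assume "vcard X \<in> elts k"
  then show "X \<prec> elts k"
    using mem_cardinal_lesspoll[of k "vcard X"] k vcard_props(2)[OF X] eqpoll_sym eq_lesspoll_trans
    unfolding infinite_cardinal_def by blast
next
  assume l: "X \<prec> elts k"
  have "\<not> elts k \<subseteq> elts (vcard X)"
    using l vcard_props(2)[OF X] by (meson lepoll_trans2 not_lesspoll_iff subset_imp_lepoll)
  then show "vcard X \<in> elts k"
    using Ord_not_mem vcard_props(1)[OF X] k unfolding infinite_cardinal_def by blast
qed

lemma infinite_cardinal_limit:
  assumes k: "infinite_cardinal k" and x: "x \<in> elts k"
  shows "\<exists>y\<in>elts k. x \<in> elts y" and "insert x (elts x) \<prec> elts k"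
proof -
  have ok: "Ord k" "Ord x" using k x Ord_mem unfolding infinite_cardinal_def by blast+
  have xk: "elts x \<prec> elts k"
    using mem_cardinal_lesspoll[of k x] k x unfolding infinite_cardinal_def by blast
  show l: "insert x (elts x) \<prec> elts k"
  proof (cases "finite (elts x)")
    case True
    then show ?thesis using k
      by (intro finite_lesspoll_infinite) (auto simp: infinite_cardinal_def)
  next
    case False
    then show ?thesis using eq_lesspoll_trans[OF infinite_insert_eqpoll xk] by blast
  qed
  let ?s = "set_of (insert x (elts x))"
  have "\<not> elts k \<subseteq> elts ?s"
    using l Ord_succ(2)[OF ok(2)] by (metis not_lesspoll_iff subset_imp_lepoll)
  then have "?s \<in> elts k" using Ord_not_mem[OF Ord_succ(1)[OF ok(2)] ok(1)] by blast
  then show "\<exists>y\<in>elts k. x \<in> elts y" using Ord_succ(2)[OF ok(2)] by blast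
qed

definition has_max :: "'v rel \<Rightarrow> bool" where
  "has_max r \<longleftrightarrow> (\<exists>m\<in>Field r. \<forall>x\<in>Field r. (x, m) \<in> r)"

lemma cofinal_in_Field: "Linear_order r \<Longrightarrow> cofinal_in (Field r) r"
  by (auto simp: cofinal_in_def order_on_defs refl_on_def)

lemma cofinality_props:
  assumes "Linear_order r" "small (Field r)"
  obtains C where "cofinal_in C r" "vcard C = cofinality r" "small C"
proof -
  let ?K = "{vcard C | C. cofinal_in C r}"
  have "Ord (vcard (Field r))" using vcard_props(1) assms by blast
  then have "?K \<inter> On \<noteq> {}" using cofinal_in_Field[OF assms(1)] by (auto simp: On_def)
  then have "cofinality r \<in> ?K" unfolding cofinality_def by (rule least_Ord_props(1))
  then obtain C where "cofinal_in C r" "vcard C = cofinality r" by auto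
  then show thesis using that small_subset[OF assms(2)] by (auto simp: cofinal_in_def)
qed

lemma cofinality_le:
  assumes "small (Field r)" "cofinal_in C r"
  shows "elts (cofinality r) \<subseteq> elts (vcard C)"
proof -
  let ?K = "{vcard C | C. cofinal_in C r}"
  have "small C" using assms small_subset by (auto simp: cofinal_in_def)
  then have "vcard C \<in> ?K \<inter> On" using assms vcard_props(1) by (auto simp: On_def)
  then show ?thesis
    using least_Ord_props(3)[of ?K "vcard C"] unfolding cofinality_def by (auto simp: On_def)
qed

lemma cofinality_cardinal:
  assumes "Linear_order r" "small (Field r)"
  shows "Ord (cofinality r)" "vcard (elts (cofinality r)) = cofinality r"
proof -
  obtain C where "cofinal_in C r" "vcard C = cofinality r" "small C"
    using cofinality_props[OF assms] .
  then show "Ord (cofinality r)" "vcard (elts (cofinality r)) = cofinality r"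
    using vcard_props(1)[of C] vcard_vcard[of C] by auto
qed

lemma cofinality_le_vcard:
  assumes "Linear_order r" "small (Field r)"
  shows "elts (cofinality r) \<subseteq> elts (vcard (Field r))"
  using cofinality_le cofinal_in_Field assms by blast

lemma cofinality_iso:
  assumes f: "iso r s f"
  shows "cofinality r = cofinality s"
proof -
  have bij: "bij_betw f (Field r) (Field s)"
    and ord: "\<And>a b. a \<in> Field r \<Longrightarrow> b \<in> Field r \<Longrightarrow> (a, b) \<in> r \<longleftrightarrow> (f a, f b) \<in> s"
    using f by (auto simp: iso_iff2)
  have im: "f ` Field r = Field s" and inj: "inj_on f (Field r)"
    using bij by (auto simp: bij_betw_def)
  have 1: "cofinal_in C r \<longleftrightarrow> cofinal_in (f ` C) s" if "C \<subseteq> Field r" for C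
    unfolding cofinal_in_def im[symmetric] using that ord by (auto simp: subset_iff)
  have 2: "vcard (f ` C) = vcard C" if "C \<subseteq> Field r" for C
    using vcard_cong inj_on_image_eqpoll_self inj_on_subset[OF inj that] by blast
  have "{vcard C | C. cofinal_in C r} = {vcard C | C. cofinal_in C s}"
  proof safe
    fix C assume C: "cofinal_in C r"
    then have "C \<subseteq> Field r" by (auto simp: cofinal_in_def)
    then show "\<exists>C'. vcard C = vcard C' \<and> cofinal_in C' s" using 1 2 C by metis
  next
    fix C assume C: "cofinal_in C s"
    then have "C \<subseteq> f ` Field r" by (auto simp: cofinal_in_def im)
    then obtain C' where "C' \<subseteq> Field r" "C = f ` C'" by (auto simp: subset_image_iff)
    then show "\<exists>C'. vcard C = vcard C' \<and> cofinal_in C' r" using 1 2 C by metis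
  qed
  then show ?thesis by (simp add: cofinality_def)
qed

lemma cofinality_ordIso: "(r, s) \<in> ordIso \<Longrightarrow> cofinality r = cofinality s"
  using cofinality_iso by (auto simp: ordIso_def)

lemma cofinality_ord_rel_le: "Ord a \<Longrightarrow> elts (cofinality (ord_rel a)) \<subseteq> elts a"
  using cofinality_le_vcard[of "ord_rel a"] vcard_elts_subset[of a] Well_order_ord_rel[of a]
  by (simp add: well_order_on_def)

lemma cofinality_empty_iff:
  assumes "Linear_order r" "small (Field r)"
  shows "elts (cofinality r) = {} \<longleftrightarrow> Field r = {}"
proof -
  obtain C where C: "cofinal_in C r" "vcard C = cofinality r" "small C"
    using cofinality_props[OF assms] .
  then have "elts (cofinality r) = {} \<longleftrightarrow> C = {}"
    using vcard_props(2)[OF C(3)] by (metis eqpoll_empty_iff_empty eqpoll_sym)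
  moreover have "Field r = {} \<Longrightarrow> C = {}" "C = {} \<Longrightarrow> Field r = {}"
    using C(1) by (auto simp: cofinal_in_def)
  ultimately show ?thesis by blast
qed

lemma finite_chain_max:
  assumes "Linear_order r" "finite C" "C \<noteq> {}" "C \<subseteq> Field r"
  shows "\<exists>m\<in>C. \<forall>c\<in>C. (c, m) \<in> r"
  using assms(2-)
proof (induction C rule: finite_ne_induct)
  case (singleton x)
  then show ?case using assms(1) by (auto simp: order_on_defs refl_on_def)
next
  case (insert x F)
  then obtain m where m: "m \<in> F" "\<forall>c\<in>F. (c, m) \<in> r" by auto
  have r: "(x, x) \<in> r" "(x, m) \<in> r \<or> (m, x) \<in> r"
    using insert m assms(1) by (auto simp: order_on_defs refl_on_def total_on_def)
  have "trans r" using assms(1) by (simp add: order_on_defs)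
  then show ?case using m r by (metis insert_iff transD)
qed

lemma cofinality_has_max_iff:
  assumes r: "Linear_order r" "small (Field r)"
  shows "finite (elts (cofinality r)) \<and> Field r \<noteq> {} \<longleftrightarrow> has_max r"
    and "has_max r \<Longrightarrow> cofinality r = vcard {x}"
proof -
  obtain C where C: "cofinal_in C r" "vcard C = cofinality r" "small C"
    using cofinality_props[OF assms] .
  have fin: "finite (elts (cofinality r)) \<longleftrightarrow> finite C"
    using vcard_props(2)[OF C(3)] C(2) eqpoll_finite_iff by metis
  show max: "cofinality r = vcard {x}" if "has_max r" for x
  proof -
    obtain m where m: "m \<in> Field r" "\<forall>x\<in>Field r. (x, m) \<in> r" using \<open>has_max r\<close> by (auto simp: has_max_def)
    have "elts (cofinality r) \<subseteq> elts (vcard {m})"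
      using m r by (intro cofinality_le) (auto simp: cofinal_in_def)
    moreover have "C \<noteq> {}" using m C(1) by (auto simp: cofinal_in_def)
    then have "{m} \<lesssim> C" using image_lepoll[of "\<lambda>_. m" C] by (simp add: image_constant_conv)
    then have "elts (vcard {m}) \<subseteq> elts (cofinality r)"
      using vcard_mono[OF C(3)] C(2) by metis
    moreover have "vcard {m} = vcard {x}" by (rule vcard_cong[OF singleton_eqpoll])
    ultimately show ?thesis by (intro elts_antisym) auto
  qed
  show "finite (elts (cofinality r)) \<and> Field r \<noteq> {} \<longleftrightarrow> has_max r"
  proof
    assume "has_max r"
    then show "finite (elts (cofinality r)) \<and> Field r \<noteq> {}"
      using max[of undefined] vcard_props(2)[OF small_doubleton[of undefined undefined]]
      by (auto simp: has_max_def dest: eqpoll_finite_iff)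
  next
    assume f: "finite (elts (cofinality r)) \<and> Field r \<noteq> {}"
    then have "finite C" "C \<noteq> {}" "C \<subseteq> Field r" using fin C(1) by (auto simp: cofinal_in_def)
    then obtain m where m: "m \<in> C" "\<forall>c\<in>C. (c, m) \<in> r" using finite_chain_max[OF r(1)] by blast
    have "trans r" using r by (simp add: order_on_defs)
    then show "has_max r"
      using m C(1) by (auto simp: has_max_def cofinal_in_def) (meson subsetD transD)
  qed
qed

text \<open>
  Let \<open>C = {g i | i < k}\<close> be cofinal in \<open>r\<close>, where \<open>k\<close> is the cofinality. If \<open>D\<close> is cofinal in
  \<open>k\<close>, then every initial piece \<open>{g j | j \<le> d}\<close> with \<open>d \<in> D\<close> has fewer than \<open>k\<close> elements and so
  lies below some \<open>x\<^sub>d\<close>; these \<open>x\<^sub>d\<close> are cofinal in \<open>r\<close>, so \<open>D\<close> has at least \<open>k\<close> elements.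
\<close>

lemma cofinality_in_Reg:
  assumes r: "Linear_order r" "small (Field r)" and inf: "infinite (elts (cofinality r))"
  shows "cofinality r \<in> Reg"
proof -
  define k where "k = cofinality r"
  have k: "infinite_cardinal k" "Ord k"
    using cofinality_cardinal[OF r] inf by (auto simp: infinite_cardinal_def k_def)
  obtain C where C: "cofinal_in C r" "vcard C = k" "small C"
    using cofinality_props[OF r] unfolding k_def .
  obtain g where g: "g ` elts k = C"
    using vcard_props(2)[OF C(3)] C(2) by (auto simp: eqpoll_def bij_betw_def)
  have lk: "Linear_order (ord_rel k)" using Well_order_ord_rel[OF k(2)] by (simp add: well_order_on_def)
  obtain D where D: "cofinal_in D (ord_rel k)" "vcard D = cofinality (ord_rel k)" "small D"
    using cofinality_props[OF lk] by auto
  have "\<exists>x\<in>Field r. \<forall>j\<in>insert d (elts d). (g j, x) \<in> r" if d: "d \<in> D" for d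
  proof -
    have dk: "d \<in> elts k" using d D by (auto simp: cofinal_in_def)
    let ?G = "g ` insert d (elts d)"
    have sub: "?G \<subseteq> Field r" using g C(1) dk Ord_trans[OF k(2)] by (force simp: cofinal_in_def)
    have "?G \<prec> elts k"
      using infinite_cardinal_limit(2)[OF k(1) dk] image_lepoll lesspoll_trans1 by blast
    moreover have "small ?G" using small_image small_insert by blast
    ultimately have "vcard ?G \<in> elts k" using lesspoll_cardinal_iff[OF k(1)] by blast
    then have "\<not> cofinal_in ?G r" using cofinality_le[OF r(2), of ?G] mem_not_refl k_def by blast
    then obtain x where x: "x \<in> Field r" "\<forall>c\<in>?G. (x, c) \<notin> r" using sub by (auto simp: cofinal_in_def)
    then have "\<forall>c\<in>?G. (c, x) \<in> r"
      using sub r(1) by (auto simp: order_on_defs total_on_def refl_on_def) (metis insertCI subsetD image_eqI)+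
    then show ?thesis using x by blast
  qed
  then obtain h where h: "\<And>d. d \<in> D \<Longrightarrow> h d \<in> Field r"
      "\<And>d j. d \<in> D \<Longrightarrow> j \<in> insert d (elts d) \<Longrightarrow> (g j, h d) \<in> r" by metis
  have tr: "trans r" using r by (simp add: order_on_defs)
  have "cofinal_in (h ` D) r"
    unfolding cofinal_in_def
  proof safe
    fix x assume "x \<in> Field r"
    then obtain i where i: "i \<in> elts k" "(x, g i) \<in> r" using C(1) g by (auto simp: cofinal_in_def)
    then obtain d where "d \<in> D" "(i, d) \<in> ord_rel k" using D(1) by (auto simp: cofinal_in_def)
    then have "d \<in> D" "i \<in> insert d (elts d)" by (auto simp: ord_rel_def)
    then show "\<exists>c\<in>h ` D. (x, c) \<in> r" using h(2) i tr by (meson imageI transD)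
  qed (use h in auto)
  then have "elts k \<subseteq> elts (vcard (h ` D))" using cofinality_le r k_def by blast
  also have "\<dots> \<subseteq> elts (cofinality (ord_rel k))"
    using vcard_mono[OF D(3) image_lepoll] D(2) by metis
  finally have "cofinality (ord_rel k) = k"
    using elts_antisym[OF cofinality_ord_rel_le[OF k(2)]] by blast
  then show ?thesis using k unfolding Reg_def k_def by blast
qed

lemma RegD: "k \<in> Reg \<Longrightarrow> Ord k" "k \<in> Reg \<Longrightarrow> infinite (elts k)" "k \<in> Reg \<Longrightarrow> infinite_cardinal k"
    "k \<in> Reg \<Longrightarrow> cofinality (ord_rel k) = k"
  by (auto simp: Reg_def infinite_cardinal_def)

text \<open>
  A characterisation that mentions cofinalities of initial segments only by equality, as the equal
  cofinality quantifier does.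
\<close>

lemma Reg_iff_limit:
  assumes "Ord a"
  shows "a \<in> Reg \<longleftrightarrow> elts a \<noteq> {} \<and> (\<forall>x\<in>elts a. \<exists>y\<in>elts a. x \<in> elts y) \<and>
    (\<forall>x\<in>elts a. cofinality (ord_rel x) \<noteq> cofinality (ord_rel a))" (is "_ \<longleftrightarrow> ?R")
proof
  assume a: "a \<in> Reg"
  have "cofinality (ord_rel x) \<noteq> cofinality (ord_rel a)" if "x \<in> elts a" for x
    using that RegD(4)[OF a] cofinality_ord_rel_le[OF Ord_mem[OF assms that]] mem_not_refl by auto
  then show ?R using infinite_cardinal_limit(1)[OF RegD(3)[OF a]] RegD(2)[OF a] by auto
next
  assume R: ?R
  have la: "Linear_order (ord_rel a)" using Well_order_ord_rel[OF assms] by (simp add: well_order_on_def)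
  have "\<not> has_max (ord_rel a)"
  proof
    assume "has_max (ord_rel a)"
    then obtain m where m: "m \<in> elts a" "\<forall>x\<in>elts a. (x, m) \<in> ord_rel a"
      unfolding has_max_def Field_ord_rel by blast
    then have m: "m \<in> elts a" "\<forall>x\<in>elts a. x = m \<or> x \<in> elts m"
      by (simp_all add: ord_rel_def)
    then obtain y where "y \<in> elts a" "m \<in> elts y" using R by blast
    then show False using m mem_not_refl mem_not_sym by metis
  qed
  then have "infinite (elts (cofinality (ord_rel a)))"
    using cofinality_has_max_iff(1)[OF la] R by auto
  then have c: "cofinality (ord_rel a) \<in> Reg" using cofinality_in_Reg[OF la] by simp
  have "cofinality (ord_rel a) \<notin> elts a" using R RegD(4)[OF c] by blast
  then have "cofinality (ord_rel a) = a"
    using cofinality_ord_rel_le[OF assms] Ord_subset_iff[OF RegD(1)[OF c] assms] by blast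
  then show "a \<in> Reg" using c by simp
qed

section \<open>The classes of regular cardinals\<close>

text \<open>
  One step generates the closure: a supremum of suprema of elements of \<open>C\<close> is the supremum of all
  elements of \<open>C\<close> that do not exceed it.
\<close>

lemma generated_closed_class_iff:
  assumes C: "C \<subseteq> On"
  shows "u \<in> generated_closed_class C \<longleftrightarrow>
    Ord u \<and> (\<exists>S\<subseteq>C. S \<noteq> {} \<and> elts u = (\<Union>c\<in>S. elts c))" (is "_ \<longleftrightarrow> ?P u")
proof
  have "closed_class (Collect ?P)"
    unfolding closed_class_def
  proof (intro conjI allI impI)
    show "Collect ?P \<subseteq> On" by (auto simp: On_def)
    fix s u assume s: "elts s \<noteq> {} \<and> elts s \<subseteq> Collect ?P \<and> elts u = (\<Union>x\<in>elts s. elts x)"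
    have "Ord u"
    proof (rule OrdI)
      show "Ord x" if "x \<in> elts u" for x using that s Ord_mem by auto
      show "y \<in> elts u" if "x \<in> elts u" "y \<in> elts x" for x y
      proof -
        have "x \<in> (\<Union>z\<in>elts s. elts z)" using that(1) s by blast
        then obtain z where z: "z \<in> elts s" "x \<in> elts z" by blast
        then have "y \<in> elts z" using s that(2) Ord_trans[of z x y] by blast
        then show ?thesis using z s by auto
      qed
    qed
    moreover have "elts u = (\<Union>c\<in>{c\<in>C. elts c \<subseteq> elts u}. elts c)"
    proof safe
      fix z assume "z \<in> elts u"
      then obtain x where x: "x \<in> elts s" "z \<in> elts x" using s by auto
      then obtain S where S: "S \<subseteq> C" "elts x = (\<Union>c\<in>S. elts c)" using s by blast
      then obtain c where c: "c \<in> S" "z \<in> elts c" using x by auto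
      then have "elts c \<subseteq> elts u" using S x s by auto
      then show "z \<in> (\<Union>c\<in>{c\<in>C. elts c \<subseteq> elts u}. elts c)" using c S by auto
    qed auto
    moreover have "{c\<in>C. elts c \<subseteq> elts u} \<noteq> {}"
    proof -
      obtain x where x: "x \<in> elts s" using s by blast
      then obtain S where S: "S \<subseteq> C" "S \<noteq> {}" "elts x = (\<Union>c\<in>S. elts c)" using s by blast
      then obtain c where "c \<in> S" by blast
      then have "c \<in> C" "elts c \<subseteq> elts u" using S x s by auto
      then show ?thesis by blast
    qed
    ultimately show "u \<in> Collect ?P"
      by (intro CollectI conjI exI[of _ "{c\<in>C. elts c \<subseteq> elts u}"]) auto
  qed
  moreover have "C \<subseteq> Collect ?P"
  proof
    fix c assume "c \<in> C"
    then have "{c} \<subseteq> C" "elts c = (\<Union>c\<in>{c}. elts c)" "Ord c" using C by (auto simp: On_def)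
    then show "c \<in> Collect ?P" by blast
  qed
  ultimately show "u \<in> generated_closed_class C \<Longrightarrow> ?P u"
    by (auto simp: generated_closed_class_def)
next
  assume "?P u"
  then obtain S where S: "Ord u" "S \<subseteq> C" "S \<noteq> {}" "elts u = (\<Union>c\<in>S. elts c)" by blast
  have "S \<subseteq> insert u (elts u)"
  proof
    fix c assume "c \<in> S"
    then have "Ord c" "elts c \<subseteq> elts u" using S C by (auto simp: On_def)
    then show "c \<in> insert u (elts u)" using Ord_subset_iff[OF _ S(1)] by blast
  qed
  then have e: "elts (set_of S) = S"
    by (intro elts_set_of) (rule small_subset[OF small_insert[OF small_elts]])
  show "u \<in> generated_closed_class C"
    unfolding generated_closed_class_def
  proof safe
    fix D assume D: "closed_class D" "C \<subseteq> D"
    then have "elts (set_of S) \<noteq> {} \<and> elts (set_of S) \<subseteq> D \<and> elts u = (\<Union>x\<in>elts (set_of S). elts x)"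
      using S e by auto
    then show "u \<in> D" using D(1) unfolding closed_class_def by blast
  qed
qed

text \<open>
  An immediate predecessor of \<open>s\<close> in the closure of \<open>C\<close> bounds \<open>C\<close> below \<open>s\<close>. Conversely, if \<open>C\<close>
  is nonempty and bounded below \<open>s\<close>, then its supremum below \<open>s\<close> is the immediate predecessor.
\<close>

lemma successor_elements_iff:
  assumes C: "C \<subseteq> On"
  shows "s \<in> successor_elements (generated_closed_class C) \<longleftrightarrow>
    s \<in> C \<and> (\<exists>c\<in>C. c \<in> elts s) \<and> (\<exists>x\<in>elts s. \<forall>c\<in>C. c \<in> elts s \<longrightarrow> elts c \<subseteq> elts x)"
proof
  note gcc = generated_closed_class_iff[OF C]
  have CD: "c \<in> generated_closed_class C" if "c \<in> C" for c
    using that by (auto simp: generated_closed_class_def)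
  have oC: "Ord c" if "c \<in> C" for c using that C by (auto simp: On_def)
  {
    assume "s \<in> successor_elements (generated_closed_class C)"
    then obtain p where p: "s \<in> generated_closed_class C" "p \<in> generated_closed_class C" "p \<in> elts s"
      and none: "\<And>d. d \<in> generated_closed_class C \<Longrightarrow> p \<in> elts d \<Longrightarrow> d \<notin> elts s"
      by (auto simp: successor_elements_def)
    have os: "Ord s" and op: "Ord p" using p gcc[of s] gcc[of p] by blast+
    obtain S where S: "S \<subseteq> C" "S \<noteq> {}" "elts s = (\<Union>c\<in>S. elts c)"
      using p(1) gcc[of s] by blast
    obtain T where T: "T \<subseteq> C" "T \<noteq> {}" "elts p = (\<Union>c\<in>T. elts c)"
      using p(2) gcc[of p] by blast
    have "s \<in> C"
    proof -
      obtain c where c: "c \<in> S" "p \<in> elts c" using S p by auto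
      then have "c \<in> C" "elts c \<subseteq> elts s" using S by auto
      moreover have "c \<notin> elts s" using none[OF CD[OF \<open>c \<in> C\<close>] c(2)] .
      ultimately have "c = s" using Ord_subset_iff[OF oC os] by blast
      then show ?thesis using \<open>c \<in> C\<close> by simp
    qed
    moreover have "\<exists>c\<in>C. c \<in> elts s"
    proof -
      obtain c where c: "c \<in> T" using T by blast
      then have "elts c \<subseteq> elts p" "c \<in> C" using T by auto
      then have "c \<in> elts p \<or> c = p" using Ord_subset_iff[OF oC op] by blast
      then have "c \<in> elts s" using p(3) Ord_trans[OF os] by blast
      then show ?thesis using \<open>c \<in> C\<close> by blast
    qed
    moreover have "elts c \<subseteq> elts p" if "c \<in> C" "c \<in> elts s" for c
      using none[OF CD[OF that(1)]] that(2) Ord_not_mem[OF op oC[OF that(1)]] by blast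
    ultimately show "s \<in> C \<and> (\<exists>c\<in>C. c \<in> elts s) \<and> (\<exists>x\<in>elts s. \<forall>c\<in>C. c \<in> elts s \<longrightarrow> elts c \<subseteq> elts x)"
      using p(3) by blast
  next
    assume R: "s \<in> C \<and> (\<exists>c\<in>C. c \<in> elts s) \<and> (\<exists>x\<in>elts s. \<forall>c\<in>C. c \<in> elts s \<longrightarrow> elts c \<subseteq> elts x)"
    then obtain x where x: "x \<in> elts s" "\<And>c. c \<in> C \<Longrightarrow> c \<in> elts s \<Longrightarrow> elts c \<subseteq> elts x" by blast
    have os: "Ord s" and ox: "Ord x" using R oC x Ord_mem by blast+
    define S where "S = {c \<in> C. c \<in> elts s}"
    define p where "p = set_of (\<Union>c\<in>S. elts c)"
    have "small S" unfolding S_def by (rule small_subset[OF small_elts[of s]]) blast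
    then have p: "elts p = (\<Union>c\<in>S. elts c)" unfolding p_def by (intro elts_set_of small_UN) auto
    have op: "Ord p"
    proof (rule OrdI)
      show "Ord y" if "y \<in> elts p" for y using that p oC Ord_mem by (auto simp: S_def)
      show "z \<in> elts p" if "y \<in> elts p" "z \<in> elts y" for y z
        using that p Ord_trans[OF oC] by (auto simp: S_def)
    qed
    have "elts p \<subseteq> elts x" using p x by (auto simp: S_def)
    then have "p \<in> elts x \<or> p = x" using Ord_subset_iff[OF op ox] by blast
    then have ps: "p \<in> elts s" using x(1) Ord_trans[OF os] by blast
    have pD: "p \<in> generated_closed_class C" unfolding gcc using op p R by (auto simp: S_def)
    have "\<not> (p \<in> elts d \<and> d \<in> elts s)" if d: "d \<in> generated_closed_class C" for d
    proof
      assume pd: "p \<in> elts d \<and> d \<in> elts s"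
      obtain T where T: "Ord d" "T \<subseteq> C" "elts d = (\<Union>c\<in>T. elts c)" using d gcc[of d] by blast
      then obtain c where c: "c \<in> T" "p \<in> elts c" using pd by auto
      then have cC: "c \<in> C" "elts c \<subseteq> elts d" using T by auto
      then have "c \<in> elts d \<or> c = d" using Ord_subset_iff[OF oC T(1)] by blast
      then have "c \<in> S" using pd Ord_trans[OF os] cC by (auto simp: S_def)
      then have "p \<in> elts p" using c p by auto
      then show False using mem_not_refl by blast
    qed
    then show "s \<in> successor_elements (generated_closed_class C)"
      using R CD pD ps by (auto simp: successor_elements_def)
  }
qed

lemma Reg_from_subset: "Reg_from A \<subseteq> Reg"
  by (auto simp: Reg_from_def)

lemma Reg_at_iff:
  "s \<in> Reg_at A \<longleftrightarrow> s \<in> Reg_from A \<and> (\<exists>c\<in>Reg_from A. c \<in> elts s) \<and>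
     (\<exists>x\<in>elts s. \<forall>c\<in>Reg_from A. c \<in> elts s \<longrightarrow> elts c \<subseteq> elts x)"
  unfolding Reg_at_rec
  by (rule successor_elements_iff) (use RegD(1) Reg_from_subset in \<open>auto simp: On_def\<close>)

lemma Reg_at_Reg: "s \<in> Reg_at A \<Longrightarrow> s \<in> Reg"
  using Reg_at_iff Reg_from_subset by blast

lemma Reg_from_iff: "s \<in> Reg_from A \<longleftrightarrow> s \<in> Reg \<and> (\<forall>b\<in>A. s \<notin> Reg_at (elts b))"
  by (auto simp: Reg_from_def Reg_below_def)

lemma Reg_at_disjoint:
  assumes "s \<in> Reg_at (elts a)" "s \<in> Reg_at (elts b)" "Ord a" "Ord b" shows "a = b"
  using assms Ord_linear[of a b] Reg_at_iff[of s "elts a"] Reg_at_iff[of s "elts b"]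
  by (auto simp: Reg_from_iff)

text \<open>
  This cardinal is \<open>\<omega>\<close>. By minimality it never has a predecessor in a closure, so it survives all
  stages and is the first element of every \<open>Reg_from A\<close>.
\<close>

definition least_Reg :: "'v::zfc_universe" where
  "least_Reg = least_Ord Reg"

lemma least_Reg_le:
  fixes s :: "'v::zfc_universe"
  assumes "s \<in> Reg" shows "(least_Reg :: 'v) \<in> Reg" "elts least_Reg \<subseteq> elts s"
proof -
  have "Reg \<inter> On \<noteq> ({} :: 'v set)" using assms RegD(1) by (auto simp: On_def)
  then show "(least_Reg :: 'v) \<in> Reg" "elts least_Reg \<subseteq> elts s"
    using least_Ord_props[of "Reg :: 'v set"] assms RegD(1) by (auto simp: least_Reg_def)
qed

lemma least_Reg_notin_Reg_at: "(least_Reg :: 'v::zfc_universe) \<notin> Reg_at A"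
proof
  assume "least_Reg \<in> Reg_at A"
  then obtain c where "c \<in> Reg" "c \<in> elts (least_Reg :: 'v)"
    unfolding Reg_at_iff using Reg_from_subset[of A] by blast
  then show False using least_Reg_le(2)[of c] mem_not_refl[of c] by blast
qed

text \<open>
  The stages of the hierarchy below a regular cardinal \<open>s\<close>: if \<open>s\<close> has survived beyond stage \<open>d\<close>,
  then the classes \<open>Reg_from d\<close> accumulate at \<open>s\<close>, and the second smallest element of
  \<open>Reg_from d\<close> is a successor element of stage \<open>d\<close> below \<open>s\<close>.
\<close>

lemma Reg_at_below:
  assumes s: "s \<in> Reg_from (elts g)" "s \<noteq> least_Reg" and d: "d \<in> elts g" and og: "Ord g"
  shows "\<exists>t\<in>Reg_at (elts d). t \<in> elts s"
proof -
  define C where "C = Reg_from (elts d)"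
  have sR: "s \<in> Reg" using s Reg_from_subset by blast
  have os: "Ord s" using RegD(1)[OF sR] .
  have l: "least_Reg \<in> C" "least_Reg \<in> elts s"
  proof -
    show "least_Reg \<in> C"
      using least_Reg_le(1)[OF sR] by (simp add: C_def Reg_from_iff least_Reg_notin_Reg_at)
    show "least_Reg \<in> elts s"
      using least_Reg_le[OF sR] Ord_subset_iff[OF RegD(1) os] s(2) by metis
  qed
  have sC: "s \<in> C"
    using s Ord_trans[OF og d] unfolding C_def Reg_from_iff by blast
  have nat: "s \<notin> Reg_at (elts d)" using s d unfolding Reg_from_iff by blast
  then have "\<exists>c\<in>C. c \<in> elts s \<and> \<not> elts c \<subseteq> elts least_Reg"
    using Reg_at_iff[of s "elts d", folded C_def] sC l by blast
  then obtain c where c: "c \<in> C \<and> c \<in> elts s \<and> \<not> elts c \<subseteq> elts least_Reg" by blast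
  have oC: "Ord c" if "c \<in> C" for c using that RegD(1) Reg_from_subset unfolding C_def by blast
  \<comment> \<open>the least element of \<open>C\<close> above \<open>least_Reg\<close>: below it, \<open>C\<close> is bounded by \<open>least_Reg\<close>\<close>
  obtain t where t: "t \<in> C \<and> t \<in> elts s \<and> \<not> elts t \<subseteq> elts least_Reg"
    and tmin: "\<And>b. b \<in> C \<and> b \<in> elts s \<and> \<not> elts b \<subseteq> elts least_Reg \<Longrightarrow> Ord b \<Longrightarrow> elts t \<subseteq> elts b"
    using Ord_least[of "\<lambda>c. c \<in> C \<and> c \<in> elts s \<and> \<not> elts c \<subseteq> elts least_Reg" c, OF c] c oC by blast
  have ot: "Ord t" using t oC by blast
  have lt: "least_Reg \<in> elts t" using t Ord_not_mem[OF oC[OF l(1)] ot] by blast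
  have "elts c' \<subseteq> elts least_Reg" if c': "c' \<in> C" "c' \<in> elts t" for c'
  proof (rule ccontr)
    assume "\<not> elts c' \<subseteq> elts least_Reg"
    then have "elts t \<subseteq> elts c'" using tmin[of c'] c' t Ord_trans[OF os] oC by blast
    then show False using c' mem_not_refl by blast
  qed
  then have "t \<in> Reg_at (elts d)"
    using Reg_at_iff[of t "elts d", folded C_def] t lt l(1) by blast
  then show ?thesis using t by blast
qed

text \<open>
  By induction: for each \<open>d < g\<close> there is an element of stage \<open>d\<close> below \<open>s\<close>, and this element is at
  least \<open>d\<close>.
\<close>

lemma Reg_from_index_le:
  assumes "s \<in> Reg_from (elts g)" "s \<noteq> least_Reg" "Ord g"
  shows "elts g \<subseteq> elts s"
  using assms
proof (induction s arbitrary: g rule: mem_induct)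
  case (1 s)
  have os: "Ord s" using 1(2) Reg_from_subset RegD(1) by blast
  show ?case
  proof
    fix d assume d: "d \<in> elts g"
    obtain t where t: "t \<in> Reg_at (elts d)" "t \<in> elts s"
      using Reg_at_below[OF 1(2,3) d 1(4)] by blast
    have od: "Ord d" using d 1(4) Ord_mem by blast
    have "t \<in> Reg_from (elts d)" "t \<noteq> least_Reg"
      using t(1) Reg_at_iff least_Reg_notin_Reg_at by blast+
    then have "elts d \<subseteq> elts t" using 1(1)[OF t(2)] od by blast
    then have "d \<in> elts t \<or> d = t" using Ord_subset_iff[OF od Ord_mem[OF os t(2)]] by blast
    then show "d \<in> elts s" using t(2) Ord_trans[OF os] by blast
  qed
qed

lemma Reg_at_index_le: "s \<in> Reg_at (elts g) \<Longrightarrow> Ord g \<Longrightarrow> elts g \<subseteq> elts s"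
  using Reg_from_index_le[of s g] least_Reg_notin_Reg_at Reg_at_iff by metis

text \<open>Since indices do not exceed elements, \<open>s\<close> cannot survive stage \<open>s\<close>.\<close>

lemma Reg_at_exists:
  assumes s: "s \<in> Reg" "s \<noteq> least_Reg"
  obtains g where "Ord g" "s \<in> Reg_at (elts g)" "elts g \<subseteq> elts s"
proof -
  have os: "Ord s" using RegD(1) s by blast
  note succ = Ord_succ[OF os]
  have "s \<notin> Reg_from (elts (set_of (insert s (elts s))))"
    using Reg_from_index_le[OF _ s(2) succ(1)] succ(2) mem_not_refl by blast
  then obtain g where g: "g \<in> insert s (elts s)" "s \<in> Reg_at (elts g)"
    using s unfolding Reg_from_iff succ(2) by blast
  then have "Ord g" using os Ord_mem by blast
  then show thesis using that g Reg_at_index_le by blast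
qed

lemma Reg_at_antimono:
  assumes s: "s \<in> Reg_at (elts g)" and "Ord g" "Ord b" "elts b \<subseteq> elts g"
  shows "\<exists>t\<in>Reg_at (elts b). elts t \<subseteq> elts s"
proof (cases "b = g")
  case False
  then have "b \<in> elts g" using assms Ord_subset_iff by blast
  then obtain t where "t \<in> Reg_at (elts b)" "t \<in> elts s"
    using Reg_at_below[of s g b] s Reg_at_iff least_Reg_notin_Reg_at assms(2) by metis
  then show ?thesis using Ord_mem_subset RegD(1)[OF Reg_at_Reg[OF s]] by blast
qed (use s in blast)

text \<open>The least infinite ordinal is a limit, so its cofinality is infinite and hence regular.\<close>

lemma Reg_exists_le:
  fixes n :: "'a::zfc_universe"
  assumes n: "Ord n" "infinite (elts n)"
  shows "\<exists>r\<in>Reg. elts r \<subseteq> elts n"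
proof -
  obtain w where w: "infinite (elts w)" "Ord w"
    and wmin: "\<And>b::'a. infinite (elts b) \<Longrightarrow> Ord b \<Longrightarrow> elts w \<subseteq> elts b"
    using Ord_least[of "\<lambda>a. infinite (elts a)" n, OF n(2,1)] by blast
  have wn: "elts w \<subseteq> elts n" using wmin[OF n(2,1)] .
  have lw: "Linear_order (ord_rel w)" using Well_order_ord_rel[OF w(2)] by (simp add: well_order_on_def)
  have "\<not> has_max (ord_rel w)"
  proof
    assume "has_max (ord_rel w)"
    then obtain m where m: "m \<in> elts w" "\<forall>x\<in>elts w. (x, m) \<in> ord_rel w"
      unfolding has_max_def Field_ord_rel by blast
    then have "elts w \<subseteq> insert m (elts m)" by (auto simp: ord_rel_def)
    then have "infinite (elts m)" using w(1) by (meson finite_insert finite_subset)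
    then have "elts w \<subseteq> elts m" using wmin Ord_mem[OF w(2) m(1)] by blast
    then show False using m(1) mem_not_refl by blast
  qed
  then have "infinite (elts (cofinality (ord_rel w)))"
    using cofinality_has_max_iff(1)[OF lw] w(1) by auto
  then have "cofinality (ord_rel w) \<in> Reg" using cofinality_in_Reg[OF lw] by simp
  then show ?thesis using cofinality_ord_rel_le[OF w(2)] wn by blast
qed

text \<open>
  A short cofinal subset would cover the successor cardinal of \<open>n\<close> by at most \<open>n\<close> sets of size at most \<open>n\<close>.
\<close>

lemma successor_cardinal_Reg:
  assumes s: "Ord s" "\<And>m. m \<in> elts s \<Longrightarrow> \<not> elts m \<approx> elts s"
    and n: "n \<in> elts s" "infinite (elts n)" "\<And>m. m \<in> elts s \<Longrightarrow> elts n \<subseteq> elts m \<Longrightarrow> elts n \<approx> elts m"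
  shows "s \<in> Reg"
proof -
  have on: "Ord n" using n s Ord_mem by blast
  have ns: "elts n \<subseteq> elts s" using Ord_mem_subset s n by blast
  have "vcard (elts s) \<notin> elts s" using s(2) vcard_props(2)[of "elts s"] by blast
  then have c: "vcard (elts s) = s"
    using vcard_elts_subset[OF s(1)] Ord_subset_iff[OF vcard_props(1)[OF small_elts] s(1)] by blast
  have "infinite (elts s)" using ns n(2) finite_subset by blast
  then have k: "infinite_cardinal s" using s c by (simp add: infinite_cardinal_def)
  have le: "elts m \<lesssim> elts n" if "m \<in> elts s" for m
    using Ord_subset_linear[OF on Ord_mem[OF s(1) that]] n(3)[OF that]
    by (metis eqpoll_imp_lepoll eqpoll_sym subset_imp_lepoll)
  have ls: "Linear_order (ord_rel s)" using Well_order_ord_rel[OF s(1)] by (simp add: well_order_on_def)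
  obtain C where C: "cofinal_in C (ord_rel s)" "vcard C = cofinality (ord_rel s)" "small C"
    using cofinality_props[OF ls] by auto
  have "cofinality (ord_rel s) = s"
  proof (rule ccontr)
    assume "cofinality (ord_rel s) \<noteq> s"
    then have "cofinality (ord_rel s) \<in> elts s"
      using cofinality_ord_rel_le[OF s(1)] Ord_subset_iff[OF cofinality_cardinal(1)[OF ls] s(1)] by auto
    then have "elts (vcard C) \<lesssim> elts n" using le C(2) by simp
    then have Cn: "C \<lesssim> elts n" using vcard_props(2)[OF C(3)] by (meson eqpoll_sym lepoll_trans1)
    have "insert c (elts c) \<lesssim> elts n" if "c \<in> C" for c
    proof -
      have "c \<in> elts s" using C that by (auto simp: cofinal_in_def)
      then have "elts c \<lesssim> elts n" by (rule le)
      then show ?thesis using infinite_insert_eqpoll[OF n(2), of n] n(2)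
        by (meson finite_lepoll_infinite finite_insert infinite_insert_eqpoll lepoll_trans1)
    qed
    then have "(\<Union>c\<in>C. insert c (elts c)) \<lesssim> elts n"
      using card_of_UNION_ordLeq_infinite[OF n(2), of C "\<lambda>c. insert c (elts c)"] Cn
      by (simp add: lepoll_iff_card_of)
    moreover have "elts s \<subseteq> (\<Union>c\<in>C. insert c (elts c))"
    proof
      fix x assume "x \<in> elts s"
      then obtain c where "c \<in> C" "(x, c) \<in> ord_rel s"
        using C(1) unfolding cofinal_in_def Field_ord_rel by blast
      then show "x \<in> (\<Union>c\<in>C. insert c (elts c))" by (auto simp: ord_rel_def)
    qed
    ultimately have "elts s \<lesssim> elts n" by (meson lepoll_trans subset_imp_lepoll)
    then have "elts n \<approx> elts s" using ns lepoll_antisym subset_imp_lepoll by blast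
    then show False using s(2) n(1) by blast
  qed
  then show ?thesis using k by (simp add: Reg_def)
qed

text \<open>
  If the regular cardinals below \<open>s\<close> are bounded by \<open>x\<close>, then there is no cardinal strictly between
  \<open>x\<close> and \<open>s\<close>, because the successor of \<open>x\<close> would be regular. The right-hand side says that \<open>s\<close> is
  an uncountable successor cardinal.
\<close>

lemma Reg_at_0_iff:
  fixes s :: "'a::zfc_universe"
  assumes os: "Ord s"
  shows "s \<in> Reg_at {} \<longleftrightarrow> (\<forall>m\<in>elts s. \<not> elts m \<approx> elts s) \<and>
    (\<exists>n\<in>elts s. infinite (elts n) \<and> (\<forall>m\<in>elts s. elts n \<subseteq> elts m \<longrightarrow> elts n \<approx> elts m))"
    (is "_ \<longleftrightarrow> ?R")
proof -
  have R0: "Reg_from {} = Reg" by (auto simp: Reg_from_iff)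
  note iff = Reg_at_iff[of s "{}", unfolded R0]
  show ?thesis
  proof
    assume s: "s \<in> Reg_at {}"
    then have sR: "s \<in> Reg" using iff by blast
    have c: "vcard (elts s) = s" using RegD(3)[OF sR] by (simp add: infinite_cardinal_def)
    have card: "\<not> elts m \<approx> elts s" if "m \<in> elts s" for m
      using mem_cardinal_lesspoll[OF os c that] by (simp add: lesspoll_def)
    obtain c0 x where c0: "c0 \<in> Reg" "c0 \<in> elts s"
      and x: "x \<in> elts s" "\<And>c. c \<in> Reg \<Longrightarrow> c \<in> elts s \<Longrightarrow> elts c \<subseteq> elts x"
      using s iff by blast
    have ox: "Ord x" using os x Ord_mem by blast
    have infx: "infinite (elts x)" using x(2)[OF c0] RegD(2)[OF c0(1)] finite_subset by blast
    have "elts x \<approx> elts m" if m: "m \<in> elts s" "elts x \<subseteq> elts m" for m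
    proof (rule ccontr)
      assume "\<not> elts x \<approx> elts m"
      then have l: "elts x \<prec> elts m" using m(2) subset_imp_lepoll by (auto simp: lesspoll_def)
      have om: "Ord m" using os m Ord_mem by blast
      obtain t where t: "elts x \<prec> elts t" "Ord t"
        and tmin: "\<And>b::'a. elts x \<prec> elts b \<Longrightarrow> Ord b \<Longrightarrow> elts t \<subseteq> elts b"
        using Ord_least[of "\<lambda>t. elts x \<prec> elts t" m, OF l om] by blast
      have tm: "elts t \<subseteq> elts m" using tmin[OF l om] .
      have small: "elts q \<lesssim> elts x" if q: "q \<in> elts t" for q
      proof (rule ccontr)
        assume "\<not> elts q \<lesssim> elts x"
        then have "elts x \<prec> elts q" using not_lesspoll_iff by blast
        then show False using tmin[of q] q t(2) Ord_mem mem_not_refl by blast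
      qed
      have xt: "x \<in> elts t"
        using t Ord_not_mem[OF ox t(2)] not_lesspoll_iff subset_imp_lepoll by blast
      have "t \<in> Reg"
      proof (rule successor_cardinal_Reg[OF t(2) _ xt infx])
        show "\<not> elts q \<approx> elts t" if "q \<in> elts t" for q
          using small[OF that] t(1) by (meson eqpoll_sym lepoll_trans1 not_lesspoll_iff)
        show "elts x \<approx> elts q" if "q \<in> elts t" "elts x \<subseteq> elts q" for q
          using small[OF that(1)] that(2) by (simp add: lepoll_antisym subset_imp_lepoll)
      qed
      moreover have "t \<in> elts s"
        using Ord_subset_iff[OF t(2) om] tm m(1) Ord_trans[OF os m(1)] by blast
      ultimately show False using x(2)[of t] xt mem_not_refl by blast
    qed
    then show ?R using card x(1) infx by blast
  next
    assume R: ?R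
    then obtain n where n: "n \<in> elts s" "infinite (elts n)"
      "\<And>m. m \<in> elts s \<Longrightarrow> elts n \<subseteq> elts m \<Longrightarrow> elts n \<approx> elts m" by blast
    have on: "Ord n" using os n Ord_mem by blast
    have "s \<in> Reg" using successor_cardinal_Reg[OF os _ n] R by blast
    moreover have "\<exists>c\<in>Reg. c \<in> elts s"
    proof -
      obtain r where r: "r \<in> Reg" "elts r \<subseteq> elts n" using Reg_exists_le[OF on n(2)] by blast
      then have "r \<in> elts n \<or> r = n" using Ord_subset_iff[OF RegD(1) on] by blast
      then show ?thesis using n(1) Ord_trans[OF os] r(1) by blast
    qed
    moreover have "elts c \<subseteq> elts n" if c: "c \<in> Reg" "c \<in> elts s" for c
    proof (rule ccontr)
      assume "\<not> elts c \<subseteq> elts n"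
      then have nc: "n \<in> elts c" using Ord_not_mem[OF on RegD(1)[OF c(1)]] by blast
      then have "elts n \<approx> elts c" using n(3)[OF c(2)] Ord_mem_subset RegD(1)[OF c(1)] by blast
      moreover have "elts n \<prec> elts c"
        using mem_cardinal_lesspoll[OF RegD(1)[OF c(1)] _ nc] RegD(3)[OF c(1)]
        by (simp add: infinite_cardinal_def)
      ultimately show False by (simp add: lesspoll_def)
    qed
    ultimately show "s \<in> Reg_at {}" using iff n(1) by blast
  qed
qed

section \<open>Translating one quantifier into another\<close>

definition LST_at :: "'v::zfc_universe gquant list \<Rightarrow> 'v \<Rightarrow> bool" where
  "LST_at Qs k \<longleftrightarrow> infinite_cardinal k \<and>
     (\<forall>L M. symbols L \<prec> elts k \<and> is_structure L M \<longrightarrow>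
        (\<exists>N. elementary_substructure L Qs N M \<and> dom N \<prec> elts k))"

lemma LST_eq: "LST Qs = min_or_infty {k. LST_at Qs k}"
  by (simp add: LST_def LST_at_def)

lemma LST_at_Ord: "LST_at Qs k \<Longrightarrow> Ord k"
  by (simp add: LST_at_def infinite_cardinal_def)

lemma min_or_infty_mono:
  fixes A B :: "'v::zfc_universe set"
  assumes "A \<subseteq> B" "B \<subseteq> On"
  shows "min_or_infty B \<subseteq> min_or_infty A"
proof -
  have on: "elts x \<subseteq> On" if "x \<in> On" for x :: 'v using that Ord_mem by (auto simp: On_def)
  have l: "least_Ord C \<in> C" "\<And>b. b \<in> C \<Longrightarrow> elts (least_Ord C) \<subseteq> elts b"
    if "C \<subseteq> On" "C \<noteq> {}" for C :: "'v set"
    using least_Ord_props[of C] that by (auto simp: On_def Int_absorb2)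
  show ?thesis
  proof (cases "A = {}")
    case True
    then show ?thesis using l[of B] on assms by (auto simp: min_or_infty_def)
  next
    case False
    then have A: "least_Ord A \<in> B" "B \<noteq> {}" using l(1)[of A] assms by blast+
    show ?thesis using l(2)[OF assms(2) A(2,1)] A(2) False by (simp add: min_or_infty_def)
  qed
qed

lemma LST_antimono: "(\<And>k. LST_at Qs k \<Longrightarrow> LST_at Qs' k) \<Longrightarrow> LST Qs' \<subseteq> LST Qs"
  unfolding LST_eq by (rule min_or_infty_mono) (auto simp: On_def dest: LST_at_Ord)

fun vars_trm :: "'v trm \<Rightarrow> nat set" where
  "vars_trm (Var n) = {n}"
| "vars_trm (App f ts) = (\<Union>t\<in>set ts. vars_trm t)"

fun vars :: "'v form \<Rightarrow> nat set" where
  "vars (Equal s t) = vars_trm s \<union> vars_trm t"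
| "vars (Rel R ts) = (\<Union>t\<in>set ts. vars_trm t)"
| "vars (Neg p) = vars p"
| "vars (Conj p q) = vars p \<union> vars q"
| "vars (Exists n p) = insert n (vars p)"
| "vars (Quant i bs) = (\<Union>(vs, p)\<in>set bs. set vs \<union> vars p)"

lemma finite_vars_trm: "finite (vars_trm t)"
  by (induction t) auto

lemma finite_vars: "finite (vars p)"
  by (induction p) (auto simp: finite_vars_trm)

definition ext :: "'v gquant list \<Rightarrow> 'v struct \<Rightarrow> (nat \<Rightarrow> 'v) \<Rightarrow> nat list \<times> 'v form \<Rightarrow> 'v list set" where
  "ext Qs M a = (\<lambda>(vs, p). {xs \<in> tuples (dom M) (length vs). sat Qs M (assign a vs xs) p})"

lemma sat_Quant: "sat Qs M a (Quant i bs) \<longleftrightarrow> map (ext Qs M a) bs \<in> snd (Qs ! i) (dom M)"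
  by (simp add: ext_def)

declare sat.simps(6) [simp del]

lemma assign_notin: "n \<notin> set vs \<Longrightarrow> assign a vs xs n = a n"
  by (auto simp: assign_def split: option.split dest!: map_of_SomeD set_zip_leftD)

lemma map_of_zip_in: "n \<in> set vs \<Longrightarrow> length xs = length vs \<Longrightarrow> \<exists>x\<in>set xs. map_of (zip vs xs) n = Some x"
  by (metis map_of_SomeD map_of_zip_is_Some set_zip_rightD)

lemma assign_cong: "(n \<notin> set vs \<Longrightarrow> a n = b n) \<Longrightarrow> length xs = length vs \<Longrightarrow> assign a vs xs n = assign b vs xs n"
proof (cases "n \<in> set vs")
  case True
  then show "length xs = length vs \<Longrightarrow> assign a vs xs n = assign b vs xs n"
    using map_of_zip_in[of n vs xs] by (auto simp: assign_def)
qed (simp add: assign_notin)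

lemma range_assign:
  assumes "range a \<subseteq> D" "set xs \<subseteq> D" shows "range (assign a vs xs) \<subseteq> D"
proof (rule image_subsetI)
  fix n
  show "assign a vs xs n \<in> D"
    using assms by (cases "map_of (zip vs xs) n") (auto simp: assign_def dest!: map_of_SomeD set_zip_rightD)
qed

lemma image_assign:
  assumes "length xs = length vs" "distinct vs" shows "assign a vs xs ` set vs = set xs"
proof -
  have "assign a vs xs (vs ! i) = xs ! i" if "i < length vs" for i
    using that assms by (simp add: assign_def map_of_zip_nth)
  then have "(\<lambda>i. assign a vs xs (vs ! i)) ` {..<length vs} = (\<lambda>i. xs ! i) ` {..<length xs}"
    using assms by (intro image_cong) auto
  moreover have "set vs = (\<lambda>i. vs ! i) ` {..<length vs}" "set xs = (\<lambda>i. xs ! i) ` {..<length xs}"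
    by (auto simp: set_conv_nth)
  ultimately show ?thesis by (simp add: image_image)
qed

lemma assign_single: "assign a [v] [x] = a(v := x)"
  by (auto simp: assign_def)

lemma assign_pair: "u \<noteq> v \<Longrightarrow> assign a [u, v] [x, y] = a(u := x, v := y)"
  by (auto simp: assign_def)

lemma trm_val_cong: "(\<And>n. n \<in> vars_trm t \<Longrightarrow> a n = b n) \<Longrightarrow> trm_val M a t = trm_val M b t"
proof (induction t)
  case (App f ts)
  have "trm_val M a t = trm_val M b t" if "t \<in> set ts" for t
    by (rule App(1)) (use that App(2) in auto)
  then have "map (trm_val M a) ts = map (trm_val M b) ts" by simp
  then show ?case by (simp del: map_eq_conv)
qed simp

lemma sat_cong: "(\<And>n. n \<in> vars p \<Longrightarrow> a n = b n) \<Longrightarrow> sat Qs M a p = sat Qs M b p"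
proof (induction p arbitrary: a b)
  case (Equal s t)
  then show ?case using trm_val_cong[of s a b M] trm_val_cong[of t a b M] by simp
next
  case (Rel R ts)
  have "trm_val M a t = trm_val M b t" if "t \<in> set ts" for t
    by (rule trm_val_cong) (use that Rel in auto)
  then have "map (trm_val M a) ts = map (trm_val M b) ts" by simp
  then show ?case by (simp del: map_eq_conv)
next
  case (Neg p)
  have "sat Qs M a p = sat Qs M b p" by (rule Neg(1)) (use Neg(2) in simp)
  then show ?case by simp
next
  case (Conj p q)
  have "sat Qs M a p = sat Qs M b p" by (rule Conj(1)) (use Conj(3) in simp)
  moreover have "sat Qs M a q = sat Qs M b q" by (rule Conj(2)) (use Conj(3) in simp)
  ultimately show ?case by simp
next
  case (Exists n p)
  have "sat Qs M (a(n := x)) p = sat Qs M (b(n := x)) p" for x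
    by (rule Exists(1)) (use Exists(2) in simp)
  then show ?case by simp
next
  case (Quant i bs)
  have "ext Qs M a e = ext Qs M b e" if e: "e \<in> set bs" for e
  proof -
    obtain vs p where ep: "e = (vs, p)" by (cases e)
    have "sat Qs M (assign a vs xs) p = sat Qs M (assign b vs xs) p" if "length xs = length vs" for xs
    proof (rule Quant(1)[OF e])
      show "p \<in> Basic_BNFs.snds e" by (simp add: ep)
      fix n assume "n \<in> vars p"
      then have "n \<in> vars (Quant i bs)" using e ep by force
      then show "assign a vs xs n = assign b vs xs n" using Quant(2) that assign_cong by metis
    qed
    then show ?thesis by (auto simp: ext_def ep tuples_def)
  qed
  then have "map (ext Qs M a) bs = map (ext Qs M b) bs" by auto
  then show ?case by (simp add: sat_Quant del: map_eq_conv)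
qed

lemma ext_cong:
  assumes "\<And>n. n \<in> vars p \<Longrightarrow> a n = b n"
  shows "ext Qs M a (vs, p) = ext Qs M b (vs, p)"
proof -
  have "sat Qs M (assign a vs xs) p = sat Qs M (assign b vs xs) p" if "length xs = length vs" for xs
    by (rule sat_cong) (use assms assign_cong that in metis)
  then show ?thesis by (auto simp: ext_def tuples_def)
qed

definition Imp :: "'v form \<Rightarrow> 'v form \<Rightarrow> 'v form" where "Imp p q = Neg (Conj p (Neg q))"
definition Disj :: "'v form \<Rightarrow> 'v form \<Rightarrow> 'v form" where "Disj p q = Neg (Conj (Neg p) (Neg q))"
definition Iff :: "'v form \<Rightarrow> 'v form \<Rightarrow> 'v form" where "Iff p q = Conj (Imp p q) (Imp q p)"
definition All :: "nat \<Rightarrow> 'v form \<Rightarrow> 'v form" where "All n p = Neg (Exists n (Neg p))"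

lemma sat_connectives [simp]:
  "sat Qs M a (Imp p q) \<longleftrightarrow> (sat Qs M a p \<longrightarrow> sat Qs M a q)"
  "sat Qs M a (Disj p q) \<longleftrightarrow> sat Qs M a p \<or> sat Qs M a q"
  "sat Qs M a (Iff p q) \<longleftrightarrow> (sat Qs M a p \<longleftrightarrow> sat Qs M a q)"
  "sat Qs M a (All n p) \<longleftrightarrow> (\<forall>x\<in>dom M. sat Qs M (a(n := x)) p)"
  by (auto simp: Imp_def Disj_def Iff_def All_def)

lemma form_of_connectives [simp]:
  "form_of L Qs (Imp p q) \<longleftrightarrow> form_of L Qs p \<and> form_of L Qs q"
  "form_of L Qs (Disj p q) \<longleftrightarrow> form_of L Qs p \<and> form_of L Qs q"
  "form_of L Qs (Iff p q) \<longleftrightarrow> form_of L Qs p \<and> form_of L Qs q"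
  "form_of L Qs (All n p) \<longleftrightarrow> form_of L Qs p"
  by (auto simp: Imp_def Disj_def Iff_def All_def)

lemma trm_val_in_dom:
  assumes "is_structure L M" "trm_of L t" "range a \<subseteq> dom M" shows "trm_val M a t \<in> dom M"
  using assms(2)
proof (induction t)
  case (Var n) then show ?case using assms(3) by auto
next
  case (App f ts)
  then have "map (trm_val M a) ts \<in> tuples (dom M) (fun_arity L f)" by (auto simp: tuples_def)
  then show ?case using assms(1) App by (auto simp: is_structure_def)
qed

text \<open>
  Formulas are relativised to the reflexive points of a binary symbol. A single symbol thus carries
  both a reflexive order and the domain that it orders.
\<close>

definition brel :: "'v \<Rightarrow> 'v struct \<Rightarrow> 'v rel" where
  "brel w M = {(x, y). [x, y] \<in> rel_int M w}"

definition points :: "'v \<Rightarrow> 'v struct \<Rightarrow> 'v set" where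
  "points w M = {x. (x, x) \<in> brel w M}"

definition vocab_le :: "'v vocabulary \<Rightarrow> 'v vocabulary \<Rightarrow> bool" where
  "vocab_le L L' \<longleftrightarrow> funs L \<subseteq> funs L' \<and> (\<forall>f\<in>funs L. fun_arity L' f = fun_arity L f) \<and>
     rels L \<subseteq> rels L' \<and> (\<forall>R\<in>rels L. rel_arity L' R = rel_arity L R)"

fun guard :: "'v \<Rightarrow> nat list \<Rightarrow> 'v form \<Rightarrow> 'v form" where
  "guard w [] p = p"
| "guard w (v # vs) p = Conj (Rel w [Var v, Var v]) (guard w vs p)"

text \<open>
  A formula is translated by relativising it to the reflexive points of \<open>w\<close> and replacing the
  second quantifier by the formula that \<open>T\<close> builds from its arguments.
\<close>

fun tr :: "'v \<Rightarrow> ((nat list \<times> 'v form) list \<Rightarrow> 'v form) \<Rightarrow> 'v form \<Rightarrow> 'v form" where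
  "tr w T (Equal s t) = Equal s t"
| "tr w T (Rel R ts) = Rel R ts"
| "tr w T (Neg p) = Neg (tr w T p)"
| "tr w T (Conj p q) = Conj (tr w T p) (tr w T q)"
| "tr w T (Exists n p) = Exists n (Conj (Rel w [Var n, Var n]) (tr w T p))"
| "tr w T (Quant i bs) =
     (if i = 0 then Quant 0 else T) (map (\<lambda>(vs, p). (vs, guard w vs (tr w T p))) bs)"

definition quant_args :: "'v vocabulary \<Rightarrow> 'v gquant list \<Rightarrow> nat list \<Rightarrow> (nat list \<times> 'v form) list \<Rightarrow> bool" where
  "quant_args L Qs ns bs \<longleftrightarrow> map (\<lambda>(vs, p). length vs) bs = ns \<and>
     (\<forall>(vs, p)\<in>set bs. distinct vs \<and> form_of L Qs p)"

text \<open>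
  The arguments are required to consist of tuples of points, because \<open>Q\<close> is evaluated on the set of
  points and not on the whole domain.
\<close>

definition defines_quant ::
    "'v vocabulary \<Rightarrow> 'v gquant list \<Rightarrow> 'v \<Rightarrow> ((nat list \<times> 'v form) list \<Rightarrow> 'v form) \<Rightarrow> 'v gquant \<Rightarrow> 'v struct \<Rightarrow> bool" where
  "defines_quant L Qs w T Q M \<longleftrightarrow>
     (\<forall>a bs. range a \<subseteq> dom M \<and> quant_args L Qs (fst Q) bs \<and>
        (\<forall>e\<in>set bs. ext Qs M a e \<subseteq> lists (points w M)) \<longrightarrow>
        (sat Qs M a (T bs) \<longleftrightarrow> map (ext Qs M a) bs \<in> snd Q (points w M)))"

lemma sat_guard:
  "sat Qs M a (guard w vs p) \<longleftrightarrow> (\<forall>v\<in>set vs. a v \<in> points w M) \<and> sat Qs M a p"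
  by (induction vs) (auto simp: points_def brel_def)

lemma form_of_guard:
  "form_of L Qs (guard w vs p) \<longleftrightarrow> (vs = [] \<or> w \<in> rels L \<and> rel_arity L w = 2) \<and> form_of L Qs p"
  by (induction vs) auto

lemma unary_inject [simp]: "unary X = unary Y \<longleftrightarrow> X = Y"
  by (auto simp: unary_def inj_image_eq_iff inj_on_def)

lemma binary_inject [simp]: "binary X = binary Y \<longleftrightarrow> X = Y"
proof -
  have "inj (\<lambda>(x, y). [x, y])" by (auto simp: inj_on_def)
  then show ?thesis unfolding binary_def by (rule inj_image_eq_iff)
qed

lemma tuples_1: "S \<subseteq> tuples A 1 \<longleftrightarrow> (\<exists>X\<subseteq>A. S = unary X)"
proof
  assume S: "S \<subseteq> tuples A 1"
  have "S = unary {x \<in> A. [x] \<in> S}"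
  proof (intro set_eqI iffI)
    fix xs assume xs: "xs \<in> S"
    then have "length xs = 1" "set xs \<subseteq> A" using S by (auto simp: tuples_def)
    then obtain x where "xs = [x]" "x \<in> A" by (auto simp: length_Suc_conv)
    then show "xs \<in> unary {x \<in> A. [x] \<in> S}" using xs by (auto simp: unary_def)
  qed (auto simp: unary_def)
  then show "\<exists>X\<subseteq>A. S = unary X" by (intro exI[of _ "{x \<in> A. [x] \<in> S}"]) auto
qed (auto simp: unary_def tuples_def)

lemma tuples_2: "S \<subseteq> tuples A 2 \<longleftrightarrow> (\<exists>X\<subseteq>A \<times> A. S = binary X)"
proof
  assume S: "S \<subseteq> tuples A 2"
  have "S = binary {(x, y). x \<in> A \<and> y \<in> A \<and> [x, y] \<in> S}"
  proof (intro set_eqI iffI)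
    fix xs assume xs: "xs \<in> S"
    then have "length xs = 2" "set xs \<subseteq> A" using S by (auto simp: tuples_def)
    then obtain x y where "xs = [x, y]" "x \<in> A" "y \<in> A"
      by (auto simp: length_Suc_conv numeral_2_eq_2)
    then show "xs \<in> binary {(x, y). x \<in> A \<and> y \<in> A \<and> [x, y] \<in> S}" using xs by (auto simp: binary_def)
  qed (auto simp: binary_def)
  then show "\<exists>X\<subseteq>A \<times> A. S = binary X"
    by (intro exI[of _ "{(x, y). x \<in> A \<and> y \<in> A \<and> [x, y] \<in> S}"]) auto
qed (auto simp: binary_def tuples_def)

lemma unary_subset_lists: "unary X \<subseteq> lists A \<longleftrightarrow> X \<subseteq> A"
  by (auto simp: unary_def)

lemma Hartig_iff: "[unary X, unary Y] \<in> snd Hartig A \<longleftrightarrow> X \<subseteq> A \<and> Y \<subseteq> A \<and> X \<approx> Y"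
  by (auto simp: Hartig_def)

lemma Hartig_lists:
  assumes "D \<subseteq> A" "\<And>S. S \<in> set Ss \<Longrightarrow> S \<subseteq> lists D"
  shows "Ss \<in> snd Hartig A \<longleftrightarrow> Ss \<in> snd Hartig D"
proof
  assume "Ss \<in> snd Hartig A"
  then obtain X Y where S: "Ss = [unary X, unary Y]" "X \<approx> Y" by (auto simp: Hartig_def)
  then have "unary X \<subseteq> lists D" "unary Y \<subseteq> lists D"
    using assms(2)[of "unary X"] assms(2)[of "unary Y"] by simp_all
  then have "X \<subseteq> D" "Y \<subseteq> D" by (simp_all only: unary_subset_lists)
  then show "Ss \<in> snd Hartig D" using S by (simp add: Hartig_iff)
next
  assume "Ss \<in> snd Hartig D"
  then obtain X Y where S: "Ss = [unary X, unary Y]" "X \<subseteq> D" "Y \<subseteq> D" "X \<approx> Y" by (auto simp: Hartig_def)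
  then show "Ss \<in> snd Hartig A" using assms(1) by (metis Hartig_iff order_trans)
qed

lemma form_of_tr:
  assumes L: "vocab_le L L'" and w: "w \<in> rels L'" "rel_arity L' w = 2"
    and T: "\<And>bs. quant_args L' (Hartig # Qs) (fst Q) bs \<Longrightarrow> form_of L' (Hartig # Qs) (T bs)"
  shows "form_of L [Hartig, Q] p \<Longrightarrow> form_of L' (Hartig # Qs) (tr w T p)"
proof (induction p)
  case (Equal s t)
  have "trm_of L t \<Longrightarrow> trm_of L' t" for t
    by (induction t) (use L in \<open>auto simp: vocab_le_def\<close>)
  then show ?case using Equal by auto
next
  case (Rel R ts)
  have "trm_of L t \<Longrightarrow> trm_of L' t" for t
    by (induction t) (use L in \<open>auto simp: vocab_le_def\<close>)
  then show ?case using Rel L by (auto simp: vocab_le_def)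
next
  case (Exists n p)
  then show ?case using w by simp
next
  case (Quant i bs)
  define cs where "cs = map (\<lambda>(vs, p). (vs, guard w vs (tr w T p))) bs"
  have i: "i = 0 \<or> i = 1" using Quant(2) by auto
  have len: "map (\<lambda>(vs, p). length vs) cs = fst ([Hartig, Q] ! i)"
    using Quant(2) by (simp add: cs_def case_prod_unfold comp_def)
  have "\<forall>(vs, p)\<in>set cs. distinct vs \<and> form_of L' (Hartig # Qs) p"
  proof safe
    fix vs q assume "(vs, q) \<in> set cs"
    then obtain p where p: "(vs, p) \<in> set bs" "q = guard w vs (tr w T p)" by (auto simp: cs_def)
    then have "distinct vs" "form_of L [Hartig, Q] p" using Quant(2) by auto
    moreover have "form_of L' (Hartig # Qs) (tr w T p)"
      using Quant(1)[OF p(1), of p] calculation by simp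
    ultimately show "distinct vs" "form_of L' (Hartig # Qs) q" using w p by (auto simp: form_of_guard)
  qed
  then have "quant_args L' (Hartig # Qs) (fst ([Hartig, Q] ! i)) cs"
    using len by (simp add: quant_args_def)
  moreover have "tr w T (Quant i bs) = (if i = 0 then Quant 0 else T) cs" by (simp add: cs_def)
  ultimately show ?case using i T[of cs] by (auto simp: quant_args_def)
qed auto

text \<open>
  By induction on the formula. The guards confine the arguments of a quantifier to tuples of points,
  so both quantifiers are applied to the same sets.
\<close>

lemma sat_tr:
  assumes N: "is_substructure L N M" "dom N = points w M" and L: "vocab_le L L'"
    and w: "w \<in> rels L'" "rel_arity L' w = 2"
    and T: "\<And>bs. quant_args L' (Hartig # Qs) (fst Q) bs \<Longrightarrow> form_of L' (Hartig # Qs) (T bs)"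
    and def_Q: "defines_quant L' (Hartig # Qs) w T Q M"
  shows "form_of L [Hartig, Q] p \<Longrightarrow> range a \<subseteq> dom N \<Longrightarrow>
    sat [Hartig, Q] N a p \<longleftrightarrow> sat (Hartig # Qs) M a (tr w T p)"
proof (induction p arbitrary: a)
  have NM: "dom N \<subseteq> dom M" and Nst: "is_structure L N" using N by (auto simp: is_substructure_def)
  have trm: "trm_val N a t = trm_val M a t" if "trm_of L t" "range a \<subseteq> dom N" for a t
    using that(1)
  proof (induction t)
    case (App f ts)
    then have eq: "map (trm_val N a) ts = map (trm_val M a) ts" by auto
    have "trm_val N a t \<in> dom N" if "t \<in> set ts" for t
      using App(2) that trm_val_in_dom[OF Nst _ \<open>range a \<subseteq> dom N\<close>, of t] by simp
    then have "map (trm_val N a) ts \<in> tuples (dom N) (fun_arity L f)"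
      using App(2) by (simp add: tuples_def image_subset_iff)
    then have "fun_int N f (map (trm_val N a) ts) = fun_int M f (map (trm_val N a) ts)"
      using App(2) N(1) by (simp add: is_substructure_def)
    then show ?case using eq by (simp del: map_eq_conv)
  qed simp
  {
    case (Equal s t)
    then show ?case using trm by simp
  next
    case (Rel R ts)
    then have eq: "map (trm_val N a) ts = map (trm_val M a) ts" using trm by auto
    have "map (trm_val N a) ts \<in> tuples (dom N) (rel_arity L R)"
      using Rel trm_val_in_dom[OF Nst] by (auto simp: tuples_def)
    then have "map (trm_val N a) ts \<in> rel_int N R \<longleftrightarrow> map (trm_val N a) ts \<in> rel_int M R"
      using Rel N(1) by (simp add: is_substructure_def)
    then show ?case using eq by (simp del: map_eq_conv)
  next
    case (Neg p)
    then show ?case by simp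
  next
    case (Conj p q)
    then show ?case by simp
  next
    case (Exists n p)
    have "sat [Hartig, Q] N (a(n := x)) p \<longleftrightarrow> sat (Hartig # Qs) M (a(n := x)) (tr w T p)"
      if "x \<in> dom N" for x
    proof (rule Exists(1))
      show "range (a(n := x)) \<subseteq> dom N" using Exists(3) that by auto
    qed (use Exists(2) in simp)
    moreover have "x \<in> dom N \<longleftrightarrow> [x, x] \<in> rel_int M w" for x
      using N(2) by (auto simp: points_def brel_def)
    ultimately show ?case using NM by auto
  next
    case (Quant i bs)
    define g where "g = (\<lambda>(vs, p). (vs, guard w vs (tr w T p)))"
    have i: "i = 0 \<or> i = 1" using Quant(2) by auto
    have e: "ext [Hartig, Q] N a e = ext (Hartig # Qs) M a (g e) \<and> ext (Hartig # Qs) M a (g e) \<subseteq> lists (dom N)"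
      if e: "e \<in> set bs" for e
    proof -
      obtain vs p where ep: "e = (vs, p)" by (cases e)
      have vs: "distinct vs" "form_of L [Hartig, Q] p" using Quant(2) e ep by auto
      have IH: "sat [Hartig, Q] N b p \<longleftrightarrow> sat (Hartig # Qs) M b (tr w T p)" if "range b \<subseteq> dom N" for b
        using Quant(1)[OF e, of p b] vs(2) that ep by simp
      have img: "(\<forall>v\<in>set vs. assign a vs xs v \<in> points w M) \<longleftrightarrow> set xs \<subseteq> dom N"
        if "length xs = length vs" for xs
        unfolding N(2) image_assign[OF that vs(1), of a, symmetric] by blast
      have "xs \<in> ext [Hartig, Q] N a e \<longleftrightarrow> xs \<in> ext (Hartig # Qs) M a (g e)" for xs
        using IH[OF range_assign[OF Quant(3)], of xs vs] img[of xs] NM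
        by (auto simp: ext_def ep g_def tuples_def sat_guard)
      moreover have "xs \<in> lists (dom N)" if "xs \<in> ext [Hartig, Q] N a e" for xs
        using that by (auto simp: ext_def ep tuples_def)
      ultimately show ?thesis by blast
    qed
    then have m: "map (ext [Hartig, Q] N a) bs = map (ext (Hartig # Qs) M a) (map g bs)" by simp
    have sub: "S \<subseteq> lists (dom N)" if "S \<in> set (map (ext (Hartig # Qs) M a) (map g bs))" for S
    proof -
      obtain x where "x \<in> set bs" "S = ext (Hartig # Qs) M a (g x)" using \<open>S \<in> _\<close> by auto
      then show ?thesis using e[of x] by blast
    qed
    show ?case
    proof (cases "i = 0")
      case True
      have "sat [Hartig, Q] N a (Quant i bs) \<longleftrightarrow> map (ext (Hartig # Qs) M a) (map g bs) \<in> snd Hartig (dom N)"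
        unfolding sat_Quant m using True by simp
      also have "\<dots> \<longleftrightarrow> map (ext (Hartig # Qs) M a) (map g bs) \<in> snd Hartig (dom M)"
        using Hartig_lists[OF NM sub, of "map (ext (Hartig # Qs) M a) (map g bs)"] by blast
      also have "\<dots> \<longleftrightarrow> sat (Hartig # Qs) M a (tr w T (Quant i bs))"
        using True by (simp add: sat_Quant g_def)
      finally show ?thesis .
    next
      case False
      then have i1: "i = 1" using i by simp

      have "quant_args L' (Hartig # Qs) (fst Q) (map g bs)"
        unfolding quant_args_def
      proof
        show "map (\<lambda>(vs, p). length vs) (map g bs) = fst Q"
          using Quant(2) i1 by (simp add: g_def case_prod_unfold comp_def)
        show "\<forall>(vs, p)\<in>set (map g bs). distinct vs \<and> form_of L' (Hartig # Qs) p"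
        proof safe
          fix vs q assume "(vs, q) \<in> set (map g bs)"
          then obtain p where p: "(vs, p) \<in> set bs" "q = guard w vs (tr w T p)" by (auto simp: g_def)
          then have f: "distinct vs" "form_of L [Hartig, Q] p" using Quant(2) by auto
          then show "distinct vs" by simp
          show "form_of L' (Hartig # Qs) q"
            using form_of_tr[OF L w T f(2)] w p by (auto simp: form_of_guard)
        qed
      qed
      moreover have "\<forall>e\<in>set (map g bs). ext (Hartig # Qs) M a e \<subseteq> lists (points w M)"
        using sub N(2) by simp
      moreover have "range a \<subseteq> dom M" using Quant(3) NM by blast
      ultimately have "sat (Hartig # Qs) M a (T (map g bs)) \<longleftrightarrow>
          map (ext (Hartig # Qs) M a) (map g bs) \<in> snd Q (dom N)"
        using def_Q[unfolded defines_quant_def, rule_format, of a "map g bs"] N(2) by simp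
      moreover have "sat [Hartig, Q] N a (Quant i bs) \<longleftrightarrow>
          map (ext (Hartig # Qs) M a) (map g bs) \<in> snd Q (dom N)"
        unfolding sat_Quant m using i1 by simp
      ultimately show ?thesis using i1 by (simp add: g_def)
    qed
  }
qed

lemma is_substructure_refl: "is_structure L M \<Longrightarrow> is_substructure L M M"
  by (auto simp: is_substructure_def is_structure_def)

text \<open>
  The situation in which a quantifier \<open>Q\<close> can be replaced by the quantifiers \<open>Qs\<close>: a structure has
  an expansion, possibly to a larger domain, by few symbols, such that \<open>Q\<close> becomes definable on the
  original domain, uniformly in all elementary substructures.
\<close>

definition definable_expansion ::
    "'v gquant list \<Rightarrow> 'v gquant \<Rightarrow> 'v \<Rightarrow> 'v vocabulary \<Rightarrow> 'v::zfc_universe struct \<Rightarrow> bool" where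
  "definable_expansion Qs Q k L M \<longleftrightarrow>
     (\<exists>L' M' w T. symbols L' \<prec> elts k \<and> is_structure L' M' \<and> vocab_le L L' \<and>
        w \<in> rels L' \<and> rel_arity L' w = 2 \<and> is_substructure L M M' \<and> dom M = points w M' \<and>
        (\<forall>bs. quant_args L' (Hartig # Qs) (fst Q) bs \<longrightarrow> form_of L' (Hartig # Qs) (T bs)) \<and>
        (\<forall>B. elementary_substructure L' (Hartig # Qs) B M' \<longrightarrow>
           points w B \<noteq> {} \<and> defines_quant L' (Hartig # Qs) w T Q B))"

text \<open>
  A small elementary substructure of the expansion is cut down to its points. A structure of size
  less than \<open>k\<close> is its own small substructure, so only larger structures are expanded.
\<close>

theorem LST_at_transfer:
  fixes k :: "'v::zfc_universe"
  assumes k: "LST_at (Hartig # Qs) k"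
    and expand: "\<And>L M. symbols L \<prec> elts k \<Longrightarrow> is_structure L M \<Longrightarrow> elts k \<lesssim> dom M \<Longrightarrow>
      definable_expansion Qs Q k L M"
  shows "LST_at [Hartig, Q] k"
  unfolding LST_at_def
proof (intro conjI allI impI)
  show "infinite_cardinal k" using k by (simp add: LST_at_def)
  fix L :: "'v vocabulary" and M :: "'v struct"
  assume LM: "symbols L \<prec> elts k \<and> is_structure L M"
  show "\<exists>N. elementary_substructure L [Hartig, Q] N M \<and> dom N \<prec> elts k"
  proof (cases "dom M \<prec> elts k")
    case True
    then show ?thesis
      using is_substructure_refl LM by (auto simp: elementary_substructure_def intro!: exI[of _ M])
  next
    case False
    then have "elts k \<lesssim> dom M" by (simp add: not_lesspoll_iff)
    then obtain L' M' w T where L': "symbols L' \<prec> elts k" and M': "is_structure L' M'"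
      and LL': "vocab_le L L'" and w: "w \<in> rels L'" "rel_arity L' w = 2"
      and MM': "is_substructure L M M'" and D: "dom M = points w M'"
      and T: "\<And>bs. quant_args L' (Hartig # Qs) (fst Q) bs \<Longrightarrow> form_of L' (Hartig # Qs) (T bs)"
      and def_Q: "\<And>B. elementary_substructure L' (Hartig # Qs) B M' \<Longrightarrow>
           points w B \<noteq> {} \<and> defines_quant L' (Hartig # Qs) w T Q B"
      using expand LM unfolding definable_expansion_def by metis
    obtain B where B: "elementary_substructure L' (Hartig # Qs) B M'" "dom B \<prec> elts k"
      using k L' M' unfolding LST_at_def by blast
    have "elementary_substructure L' (Hartig # Qs) M' M'"
      using is_substructure_refl[OF M'] by (simp add: elementary_substructure_def)
    note def_M' = conjunct2[OF def_Q[OF this]] and def_B = def_Q[OF B(1)]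
    have BM': "is_substructure L' B M'" and Bst: "is_structure L' B"
      using B by (auto simp: elementary_substructure_def is_substructure_def)
    define D' where "D' = points w B"
    have w_eq: "rel_int B w = rel_int M' w \<inter> tuples (dom B) 2"
      using BM' w by (auto simp: is_substructure_def)
    then have D'_iff: "x \<in> D' \<longleftrightarrow> x \<in> dom M \<and> x \<in> dom B" for x
      by (auto simp: D'_def D points_def brel_def tuples_def)
    \<comment> \<open>relations of \<open>B\<close> may hold of elements outside \<open>D'\<close> and have to be restricted\<close>
    define N where "N = B\<lparr>dom := D', rel_int := \<lambda>R. rel_int B R \<inter> lists D'\<rparr>"
    have domN: "dom N = D'" by (simp add: N_def)
    have fun_eq: "fun_int B f xs = fun_int M f xs" "fun_int M f xs \<in> D'"
      if f: "f \<in> funs L" "xs \<in> tuples D' (fun_arity L f)" for f xs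
    proof -
      have xs: "xs \<in> tuples (dom B) (fun_arity L f)" "xs \<in> tuples (dom M) (fun_arity L f)"
        using f(2) D'_iff by (auto simp: tuples_def)
      have f': "f \<in> funs L'" "fun_arity L' f = fun_arity L f" using LL' f(1) by (auto simp: vocab_le_def)
      have "fun_int B f xs = fun_int M' f xs" using BM' f' xs by (auto simp: is_substructure_def)
      also have "\<dots> = fun_int M f xs" using MM' f(1) xs by (auto simp: is_substructure_def)
      finally show eq: "fun_int B f xs = fun_int M f xs" .
      have "fun_int B f xs \<in> dom B" using Bst f' xs by (auto simp: is_structure_def)
      moreover have "fun_int M f xs \<in> dom M" using LM f(1) xs by (auto simp: is_structure_def)
      ultimately show "fun_int M f xs \<in> D'" using D'_iff eq by simp
    qed
    have rel_sub: "rel_int B R \<inter> lists D' = rel_int M R \<inter> tuples D' (rel_arity L R)"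
      "rel_int B R \<inter> lists D' = rel_int B R \<inter> tuples D' (rel_arity L R)" if R: "R \<in> rels L" for R
    proof -
      have R': "R \<in> rels L'" "rel_arity L' R = rel_arity L R" using LL' R by (auto simp: vocab_le_def)
      have B1: "rel_int B R = rel_int M' R \<inter> tuples (dom B) (rel_arity L R)"
        using BM' R' by (auto simp: is_substructure_def)
      have M1: "rel_int M R = rel_int M' R \<inter> tuples (dom M) (rel_arity L R)"
        using MM' R by (auto simp: is_substructure_def)
      show "rel_int B R \<inter> lists D' = rel_int M R \<inter> tuples D' (rel_arity L R)"
        unfolding B1 M1 using D'_iff by (auto simp: tuples_def)
      show "rel_int B R \<inter> lists D' = rel_int B R \<inter> tuples D' (rel_arity L R)"
        unfolding B1 by (auto simp: tuples_def)
    qed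
    have "small (dom M)" using LM by (simp add: is_structure_def small_def)
    then have "small D'" by (rule small_subset) (use D'_iff in blast)
    then have Nst: "is_structure L N"
      using fun_eq rel_sub def_B by (auto simp: is_structure_def N_def small_def D'_def[symmetric])
    have NB: "is_substructure L N B"
      using Nst fun_eq rel_sub(2) D'_iff by (auto simp: is_substructure_def N_def)
    have NM: "is_substructure L N M"
      using Nst fun_eq rel_sub(1) D'_iff unfolding is_substructure_def by (auto simp: N_def)
    have "sat [Hartig, Q] N a p \<longleftrightarrow> sat [Hartig, Q] M a p"
      if p: "form_of L [Hartig, Q] p" and a: "range a \<subseteq> dom N" for p a
    proof -
      have "sat [Hartig, Q] N a p \<longleftrightarrow> sat (Hartig # Qs) B a (tr w T p)"
        using sat_tr[OF NB _ LL' w T conjunct2[OF def_B] p a] domN D'_def by blast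
      also have "\<dots> \<longleftrightarrow> sat (Hartig # Qs) M' a (tr w T p)"
      proof -
        have "form_of L' (Hartig # Qs) (tr w T p)" by (rule form_of_tr[OF LL' w T p])
        moreover have "range a \<subseteq> dom B" using a domN D'_iff by blast
        ultimately show ?thesis using B(1) unfolding elementary_substructure_def by blast
      qed
      also have "\<dots> \<longleftrightarrow> sat [Hartig, Q] M a p"
        using sat_tr[OF MM' D LL' w T def_M' p, of a] a domN D'_iff by blast
      finally show ?thesis .
    qed
    then have "elementary_substructure L [Hartig, Q] N M"
      using NM by (auto simp: elementary_substructure_def)
    moreover have "dom N \<prec> elts k"
      using B(2) domN D'_iff by (meson lesspoll_trans1 subsetI subset_imp_lepoll)
    ultimately show ?thesis by blast
  qed
qed

lemma form_of_mono:
  assumes "\<And>i. i < length Qs \<Longrightarrow> i < length Qs' \<and> fst (Qs' ! i) = fst (Qs ! i)"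
  shows "form_of L Qs p \<Longrightarrow> form_of L Qs' p"
  by (induction p) (use assms in \<open>auto 0 4\<close>)

lemma sat_agree:
  assumes "\<And>i. i < length Qs \<Longrightarrow> snd (Qs' ! i) (dom M) = snd (Qs ! i) (dom M)"
  shows "form_of L Qs p \<Longrightarrow> sat Qs M a p \<longleftrightarrow> sat Qs' M a p"
proof (induction p arbitrary: a)
  case (Quant i bs)
  have "ext Qs M a e = ext Qs' M a e" if e: "e \<in> set bs" for e
  proof -
    obtain vs p where ep: "e = (vs, p)" by (cases e)
    have "sat Qs M b p \<longleftrightarrow> sat Qs' M b p" for b
      using Quant(1)[OF e, of p b] Quant(2) e ep by auto
    then show ?thesis by (auto simp: ext_def ep)
  qed
  then have "map (ext Qs M a) bs = map (ext Qs' M a) bs" by simp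
  then show ?case using Quant(2) assms[of i] by (simp add: sat_Quant del: map_eq_conv)
qed auto

lemma LST_at_sublist:
  assumes Qs: "\<And>i. i < length Qs \<Longrightarrow> i < length Qs' \<and> Qs' ! i = Qs ! i"
    and k: "LST_at Qs' k"
  shows "LST_at Qs k"
proof -
  have "sat Qs M a p \<longleftrightarrow> sat Qs' M a p" "form_of L Qs' p" if "form_of L Qs p" for L M a p
    using sat_agree[of Qs Qs' M L p a] form_of_mono[of Qs Qs' L p] Qs that by auto
  then have "elementary_substructure L Qs N M" if "elementary_substructure L Qs' N M" for L N M
    using that unfolding elementary_substructure_def by blast
  then show ?thesis using k unfolding LST_at_def by blast
qed

section \<open>Expansions by a well-order\<close>

text \<open>
  Well-orders with a largest element: on an infinite domain \<open>A\<close> the proper initial segments then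
  realise all order types up to \<open>|A|\<close>, also in every elementary substructure.
\<close>

definition topped_wo :: "'v::zfc_universe rel \<Rightarrow> bool" where
  "topped_wo W \<longleftrightarrow> Well_order W \<and> small (Field W) \<and> has_max W"

lemma topped_wo_exists:
  fixes A :: "'v::zfc_universe set"
  assumes A: "small A" "A \<noteq> {}"
  obtains W where "topped_wo W" "Field W = A"
proof -
  obtain m where m: "m \<in> A" using A by blast
  have "small (A - {m})" using A(1) small_subset by blast
  then obtain a :: 'v where a: "Ord a" "elts a \<approx> A - {m}" by (rule zfc_choose_ordinal)
  define s where "s = set_of (insert a (elts a))"
  have s: "Ord s" "elts s = insert a (elts a)" using Ord_succ[OF a(1)] by (auto simp: s_def)
  have "elts s \<approx> insert m (A - {m})"
    unfolding s(2) by (rule insert_eqpoll_cong) (use a mem_not_refl in auto)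
  then have "elts s \<approx> A" using m by (simp add: insert_absorb)
  then obtain f where f: "bij_betw f (elts s) A" by (auto simp: eqpoll_def)
  define W where "W = dir_image (ord_rel s) f"
  have W: "Well_order W"
    unfolding W_def
    by (rule Well_order_dir_image[OF Well_order_ord_rel[OF s(1)]]) (use f in \<open>simp add: bij_betw_def\<close>)
  have F: "Field W = A"
    using f by (simp add: W_def dir_image_Field bij_betw_def)
  have "has_max W"
    unfolding has_max_def F
  proof
    show "f a \<in> A" using f s(2) by (auto simp: bij_betw_def)
    show "\<forall>x\<in>A. (x, f a) \<in> W"
    proof
      fix x assume "x \<in> A"
      then obtain y where y: "y \<in> elts s" "x = f y" using f by (auto simp: bij_betw_def)
      then have "(y, a) \<in> ord_rel s" using s(2) by (auto simp: ord_rel_def)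
      then show "(x, f a) \<in> W" using y(2) by (auto simp: W_def dir_image_def)
    qed
  qed
  then show thesis using that[of W] W F A(1) by (simp add: topped_wo_def)
qed

lemma coll_realises:
  assumes W: "topped_wo W" and inf: "infinite (Field W)"
    and s: "Ord s" "elts s \<subseteq> elts (vcard (Field W))"
  obtains x where "x \<in> Field W" "coll W x = s"
proof -
  have wo: "Well_order W" "small (Field W)" using W by (auto simp: topped_wo_def)
  obtain m where m: "m \<in> Field W" "\<forall>x\<in>Field W. (x, m) \<in> W"
    using W by (auto simp: topped_wo_def has_max_def)
  then have F: "Field W = insert m (underS W m)"
    by (auto simp: underS_def Field_def)
  then have "infinite (underS W m)" using inf by (metis finite_insert)
  then have "Field W \<approx> underS W m" using F infinite_insert_eqpoll by metis
  also have "underS W m \<approx> elts (coll W m)" by (rule underS_eqpoll_coll[OF wo])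
  finally have "vcard (Field W) = vcard (elts (coll W m))" by (rule vcard_cong)
  then have "elts s \<subseteq> elts (coll W m)"
    using s(2) vcard_elts_subset[OF Ord_coll[OF wo, of m]] by simp
  then have "s \<in> elts (coll W m) \<or> s = coll W m" using Ord_subset_iff[OF s(1) Ord_coll[OF wo]] by blast
  then show thesis using that m(1) elts_coll[OF wo] underS_in_Field by (metis imageE)
qed

lemma cofinality_segm:
  assumes "Well_order W" "small (Field W)" "x \<in> Field W"
  shows "cofinality (segm W x) = cofinality (ord_rel (coll W x))"
  using otype_props(2)[OF Well_order_segm[OF assms(1)] small_segm[OF assms(1,2)]]
    otype_segm[OF assms] cofinality_ordIso by metis

lemma Linear_order_segm: "Well_order W \<Longrightarrow> Linear_order (segm W x)"
  using Well_order_segm[of W x] by (simp add: well_order_on_def)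

lemma points_eq_Field: "Well_order (brel w M) \<Longrightarrow> points w M = Field (brel w M)"
  by (auto simp: points_def order_on_defs refl_on_def Field_def)

lemma brel_substructure:
  assumes "is_substructure L B M" "w \<in> rels L" "rel_arity L w = 2"
  shows "brel w B = Restr (brel w M) (dom B)"
  using assms by (auto simp: is_substructure_def brel_def tuples_def)

lemma brel_subset_dom:
  assumes "is_structure L M" "w \<in> rels L" "rel_arity L w = 2"
  shows "brel w M \<subseteq> dom M \<times> dom M"
proof -
  have "rel_int M w \<subseteq> tuples (dom M) 2" using assms by (metis is_structure_def)
  then show ?thesis by (auto simp: brel_def tuples_def)
qed

lemma elementary_sat:
  "elementary_substructure L Qs N M \<Longrightarrow> form_of L Qs p \<Longrightarrow> range a \<subseteq> dom N \<Longrightarrow>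
    sat Qs N a p \<longleftrightarrow> sat Qs M a p"
  by (simp add: elementary_substructure_def)

lemma elementary_structures:
  assumes "elementary_substructure L Qs N M"
  shows "is_substructure L N M" "is_structure L N" "dom N \<subseteq> dom M" "small (dom N)" "dom N \<noteq> {}"
  using assms by (auto simp: elementary_substructure_def is_substructure_def is_structure_def small_def)

abbreviation at2 :: "'v \<Rightarrow> nat \<Rightarrow> nat \<Rightarrow> 'v form" where
  "at2 w x y \<equiv> Rel w [Var x, Var y]"

definition below_fm :: "'v \<Rightarrow> nat \<Rightarrow> nat \<Rightarrow> 'v form" where
  "below_fm w x y = Conj (at2 w x y) (Neg (Equal (Var x) (Var y)))"

lemma sat_at2 [simp]: "sat Qs M a (at2 w x y) \<longleftrightarrow> (a x, a y) \<in> brel w M"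
  by (simp add: brel_def)

declare sat.simps(2) [simp del]

lemma sat_below_fm [simp]: "sat Qs M a (below_fm w x y) \<longleftrightarrow> a x \<in> underS (brel w M) (a y)"
  by (auto simp: below_fm_def underS_def)

lemma form_of_below_fm [simp]: "form_of L Qs (below_fm w x y) \<longleftrightarrow> w \<in> rels L \<and> rel_arity L w = 2"
  by (auto simp: below_fm_def)

text \<open>
  A well-order induces well-orders on all subsets, and the existence of a largest element is
  expressed by a first-order sentence.
\<close>

lemma topped_wo_elementary:
  assumes B: "elementary_substructure L Qs B M" and M: "is_structure L M"
    and w: "w \<in> rels L" "rel_arity L w = 2" and W: "topped_wo (brel w M)"
  shows "topped_wo (brel w B)" and "Field (brel w B) = Field (brel w M) \<inter> dom B"
    and "points w B \<noteq> {}"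
proof -
  note Bs = elementary_structures[OF B]
  have eq: "brel w B = Restr (brel w M) (dom B)" by (rule brel_substructure[OF Bs(1) w])
  have wo: "Well_order (brel w M)" using W by (simp add: topped_wo_def)
  have woB: "Well_order (brel w B)" unfolding eq by (rule Well_order_Restr[OF wo])
  have "Refl (brel w M)" using wo by (simp add: order_on_defs)
  then show F: "Field (brel w B) = Field (brel w M) \<inter> dom B"
    unfolding eq by (auto simp: Field_def refl_on_def)
  let ?p = "Exists 0 (Conj (at2 w 0 0) (All 1 (Imp (at2 w 1 1) (at2 w 1 0))))"
  have pts: "x \<in> Field (brel w M) \<longleftrightarrow> (x, x) \<in> brel w M" for x
    using points_eq_Field[OF wo] by (auto simp: points_def)
  have ptsB: "x \<in> Field (brel w B) \<longleftrightarrow> (x, x) \<in> brel w B" for x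
    using points_eq_Field[OF woB] by (auto simp: points_def)
  have FM: "Field (brel w M) \<subseteq> dom M" using brel_subset_dom[OF M w] by (auto simp: Field_def)
  obtain b where b: "b \<in> dom B" using Bs(5) by blast
  have "sat Qs M (\<lambda>_. b) ?p"
    using W FM unfolding topped_wo_def has_max_def by (auto simp: pts)
  moreover have "form_of L Qs ?p" using w by simp
  ultimately have "sat Qs B (\<lambda>_. b) ?p" using elementary_sat[OF B, of ?p "\<lambda>_. b"] b by simp
  then obtain m where m: "(m, m) \<in> brel w B" "\<forall>x\<in>dom B. (x, x) \<in> brel w B \<longrightarrow> (x, m) \<in> brel w B"
    by auto
  then have max: "has_max (brel w B)" unfolding has_max_def using ptsB F by blast
  then show "topped_wo (brel w B)"
    using woB small_subset[OF Bs(4)] F by (simp add: topped_wo_def)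
  show "points w B \<noteq> {}" using max points_eq_Field[OF woB] by (auto simp: has_max_def)
qed

section \<open>Formulas about initial segments\<close>

lemma Q_up_iff: "[binary X, binary Y, binary Z] \<in> snd (Q_up \<alpha>) A \<longleftrightarrow>
    X \<subseteq> A \<times> A \<and> Y \<subseteq> A \<times> A \<and> Z \<subseteq> A \<times> A \<and>
     Linear_order X \<and> Linear_order Y \<and> cofinality X = cofinality Y \<and>
     Well_order Z \<and> otype Z \<in> \<alpha> \<and> cofinality X \<in> Reg_at (elts (otype Z))"
  unfolding Q_up_def by simp

lemma R_up_iff: "[unary X, binary Z] \<in> snd (R_up \<alpha>) A \<longleftrightarrow>
    X \<subseteq> A \<and> Z \<subseteq> A \<times> A \<and> Well_order Z \<and> otype Z \<in> \<alpha> \<and> vcard X \<in> Reg_at (elts (otype Z))"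
  unfolding R_up_def by simp

lemma Q_ec_iff: "[binary X, binary Y] \<in> snd Q_ec A \<longleftrightarrow>
    X \<subseteq> A \<times> A \<and> Y \<subseteq> A \<times> A \<and> Linear_order X \<and> Linear_order Y \<and> cofinality X = cofinality Y"
  unfolding Q_ec_def by simp

definition fresh :: "(nat list \<times> 'v form) list \<Rightarrow> nat" where
  "fresh bs = Suc (Max (insert 0 (\<Union>(vs, p)\<in>set bs. set vs \<union> vars p)))"

lemma fresh_gt:
  assumes "(vs, p) \<in> set bs" "v \<in> set vs \<union> vars p" shows "v < fresh bs"
proof -
  let ?S = "insert 0 (\<Union>(vs, p)\<in>set bs. set vs \<union> vars p)"
  have "finite ?S" by (auto simp: finite_vars)
  moreover have "v \<in> ?S" using assms by auto
  ultimately show ?thesis unfolding fresh_def by (meson Max_ge le_imp_less_Suc)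
qed

lemma ext_fresh:
  assumes "e \<in> set bs" "\<And>n. n < fresh bs \<Longrightarrow> a n = b n"
  shows "ext Qs M a e = ext Qs M b e"
proof -
  obtain vs p where e: "e = (vs, p)" by (cases e)
  show ?thesis unfolding e by (rule ext_cong) (use fresh_gt assms e in blast)
qed

text \<open>The bound variables are chosen after \<open>n\<close>, which keeps them distinct from it.\<close>

definition seg :: "'v \<Rightarrow> nat \<Rightarrow> nat list \<times> 'v form" where
  "seg w n = ([Suc n, Suc (Suc n)], Conj (at2 w (Suc n) (Suc (Suc n))) (below_fm w (Suc (Suc n)) n))"

definition below :: "'v \<Rightarrow> nat \<Rightarrow> nat list \<times> 'v form" where
  "below w n = ([Suc n], below_fm w (Suc n) n)"

lemma ext_pair:
  "u \<noteq> v \<Longrightarrow> ext Qs M a ([u, v], p) = binary {(x, y). x \<in> dom M \<and> y \<in> dom M \<and> sat Qs M (a(u := x, v := y)) p}"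
proof -
  assume uv: "u \<noteq> v"
  have "xs \<in> tuples (dom M) 2 \<longleftrightarrow> (\<exists>x y. xs = [x, y] \<and> x \<in> dom M \<and> y \<in> dom M)" for xs
    by (auto simp: tuples_def numeral_2_eq_2 length_Suc_conv)
  then show ?thesis
    using uv by (auto simp: ext_def binary_def assign_pair numeral_2_eq_2[symmetric])
qed

lemma ext_single:
  "ext Qs M a ([u], p) = unary {x. x \<in> dom M \<and> sat Qs M (a(u := x)) p}"
proof -
  have "xs \<in> tuples (dom M) 1 \<longleftrightarrow> (\<exists>x. xs = [x] \<and> x \<in> dom M)" for xs
    by (auto simp: tuples_def length_Suc_conv)
  then show ?thesis by (auto simp: ext_def unary_def assign_single)
qed

lemma ext_seg:
  assumes "Well_order (brel w M)" "brel w M \<subseteq> dom M \<times> dom M"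
  shows "ext Qs M a (seg w n) = binary (segm (brel w M) (a n))"
proof -
  have t: "trans (brel w M)" "antisym (brel w M)" using assms(1) by (simp_all add: order_on_defs)
  have "{(x, y). x \<in> dom M \<and> y \<in> dom M \<and> (x, y) \<in> brel w M \<and> y \<in> underS (brel w M) (a n)}
      = segm (brel w M) (a n)"
    unfolding segm_def using assms(2) t by (auto simp: underS_def dest: transD antisymD)
  then show ?thesis by (simp add: seg_def ext_pair)
qed

lemma ext_below:
  assumes "brel w M \<subseteq> dom M \<times> dom M"
  shows "ext Qs M a (below w n) = unary (underS (brel w M) (a n))"
proof -
  have "{x. x \<in> dom M \<and> x \<in> underS (brel w M) (a n)} = underS (brel w M) (a n)"
    using assms by (auto simp: underS_def)
  then show ?thesis by (simp add: below_def ext_single)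
qed

lemma form_of_Quant2:
  assumes "i < length Qs" "fst (Qs ! i) = [length (fst e), length (fst f)]"
    "distinct (fst e)" "form_of L Qs (snd e)" "distinct (fst f)" "form_of L Qs (snd f)"
  shows "form_of L Qs (Quant i [e, f])"
  using assms by (cases e; cases f) auto

lemma form_of_Quant3:
  assumes "i < length Qs" "fst (Qs ! i) = [length (fst e), length (fst f), length (fst g)]"
    "distinct (fst e)" "form_of L Qs (snd e)" "distinct (fst f)" "form_of L Qs (snd f)"
    "distinct (fst g)" "form_of L Qs (snd g)"
  shows "form_of L Qs (Quant i [e, f, g])"
  using assms by (cases e; cases f; cases g) auto

text \<open>
  Substitution without renaming: the two variables of the formula are quantified existentially and
  equated with \<open>x\<close> and \<open>y\<close>.
\<close>

definition app :: "nat list \<times> 'v form \<Rightarrow> nat \<Rightarrow> nat \<Rightarrow> 'v form" where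
  "app e x y = (let u = fst e ! 0; v = fst e ! 1 in
     Exists u (Exists v (Conj (Equal (Var u) (Var x)) (Conj (Equal (Var v) (Var y)) (snd e)))))"

lemma sat_app:
  assumes "e = ([u, v], p)" "u \<noteq> v" "x \<notin> {u, v}" "y \<notin> {u, v}" "a x \<in> dom M" "a y \<in> dom M"
  shows "sat Qs M a (app e x y) \<longleftrightarrow> [a x, a y] \<in> ext Qs M a e"
  using assms by (auto simp: app_def ext_pair binary_def)

lemma quant_args_2:
  assumes "quant_args L Qs [m, n] bs"
  obtains e f where "bs = [e, f]" "length (fst e) = m" "length (fst f) = n" "distinct (fst e)" "distinct (fst f)"
    "form_of L Qs (snd e)" "form_of L Qs (snd f)"
  using assms by (auto simp: quant_args_def map_eq_Cons_conv split: prod.splits)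

lemma quant_args_3:
  assumes "quant_args L Qs [l, m, n] bs"
  obtains e f g where "bs = [e, f, g]" "length (fst e) = l" "length (fst f) = m" "length (fst g) = n"
    "distinct (fst e)" "distinct (fst f)" "distinct (fst g)"
    "form_of L Qs (snd e)" "form_of L Qs (snd f)" "form_of L Qs (snd g)"
  using assms by (auto simp: quant_args_def map_eq_Cons_conv split: prod.splits)

lemma ext_unary:
  assumes "length (fst e) = 1" "ext Qs M a e \<subseteq> lists D"
  obtains X where "X \<subseteq> D" "ext Qs M a e = unary X"
proof -
  have "ext Qs M a e \<subseteq> tuples D 1"
    using assms by (cases e) (auto simp: ext_def tuples_def)
  then show thesis using that unfolding tuples_1 by blast
qed

lemma ext_binary:
  assumes "length (fst e) = 2" "ext Qs M a e \<subseteq> lists D"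
  obtains X where "X \<subseteq> D \<times> D" "ext Qs M a e = binary X"
proof -
  have "ext Qs M a e \<subseteq> tuples D 2"
    using assms by (cases e) (auto simp: ext_def tuples_def)
  then show thesis using that by (auto simp: tuples_2)
qed

section \<open>Expanding structures\<close>

definition add_rels :: "'v set \<Rightarrow> ('v \<Rightarrow> nat) \<Rightarrow> 'v vocabulary \<Rightarrow> 'v vocabulary" where
  "add_rels S ar L = L\<lparr>rels := rels L \<union> S, rel_arity := \<lambda>R. if R \<in> S then ar R else rel_arity L R\<rparr>"

definition add_ints :: "'v set \<Rightarrow> ('v \<Rightarrow> 'v list set) \<Rightarrow> 'v struct \<Rightarrow> 'v struct" where
  "add_ints S I M = M\<lparr>rel_int := \<lambda>R. if R \<in> S then I R else rel_int M R\<rparr>"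

lemma add_rels_simps [simp]:
  "rels (add_rels S ar L) = rels L \<union> S" "funs (add_rels S ar L) = funs L"
  "fun_arity (add_rels S ar L) = fun_arity L"
  "rel_arity (add_rels S ar L) R = (if R \<in> S then ar R else rel_arity L R)"
  by (auto simp: add_rels_def)

lemma add_ints_simps [simp]:
  "dom (add_ints S I M) = dom M" "fun_int (add_ints S I M) = fun_int M"
  "rel_int (add_ints S I M) R = (if R \<in> S then I R else rel_int M R)"
  by (auto simp: add_ints_def)

lemma vocab_le_add_rels: "S \<inter> rels L = {} \<Longrightarrow> vocab_le L (add_rels S ar L)"
  by (auto simp: vocab_le_def)

lemma is_structure_add:
  assumes "is_structure L M" "S \<inter> rels L = {}" "\<And>R. R \<in> S \<Longrightarrow> I R \<subseteq> tuples (dom M) (ar R)"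
  shows "is_structure (add_rels S ar L) (add_ints S I M)"
  using assms by (auto simp: is_structure_def)

lemma is_substructure_add:
  assumes "is_substructure L N M" "S \<inter> rels L = {}"
  shows "is_substructure L N (add_ints S I M)"
  using assms by (auto simp: is_substructure_def)

lemma symbols_add_lesspoll:
  assumes "symbols L \<prec> elts k" "S \<prec> elts k" "infinite (elts k)"
  shows "symbols (add_rels S ar L) \<prec> elts k"
proof -
  have "symbols (add_rels S ar L) = symbols L \<union> Inr ` S"
    by (auto simp: symbols_def)
  moreover have "Inr ` S \<prec> elts k" using assms(2) image_lepoll lesspoll_trans1 by blast
  ultimately show ?thesis
    using assms card_of_Un_ordLess_infinite[OF assms(3), of "symbols L" "Inr ` S"]
    by (simp add: lesspoll_iff_card_of)
qed

lemma rels_lepoll_symbols: "rels L \<lesssim> symbols L"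
proof -
  have "rels L \<lesssim> (Inr :: 'a \<Rightarrow> 'a + 'a) ` rels L" by (rule eqpoll_imp_lepoll) (simp add: eqpoll_sym inj_on_image_eqpoll_self)
  also have "\<dots> \<lesssim> symbols L" by (rule subset_imp_lepoll) (auto simp: symbols_def)
  finally show ?thesis .
qed

lemma small_rels: "symbols L \<prec> elts (k :: 'v::zfc_universe) \<Longrightarrow> small (rels (L :: 'v vocabulary))"
  by (meson lepoll_trans lesspoll_imp_lepoll rels_lepoll_symbols small_elts small_lepoll)

lemma transfer_by_order:
  fixes k :: "'v::zfc_universe"
  assumes k: "LST_at (Hartig # Qs) k"
    and T: "\<And>L w bs. w \<in> rels L \<Longrightarrow> rel_arity L w = 2 \<Longrightarrow> quant_args L (Hartig # Qs) (fst Q) bs \<Longrightarrow>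
      form_of L (Hartig # Qs) (T w bs)"
    and def_Q: "\<And>L w B. is_structure L B \<Longrightarrow> topped_wo (brel w B) \<Longrightarrow> points w B = dom B \<Longrightarrow>
      brel w B \<subseteq> dom B \<times> dom B \<Longrightarrow> defines_quant L (Hartig # Qs) w (T w) Q B"
  shows "LST_at [Hartig, Q] k"
proof (rule LST_at_transfer[OF k])
  fix L :: "'v vocabulary" and M :: "'v struct"
  assume L: "symbols L \<prec> elts k" and M: "is_structure L M"
  define w where "w = tag (rels L) undefined"
  have w: "w \<notin> rels L" unfolding w_def by (rule tag_notin[OF small_rels[OF L]])
  have "small (dom M)" "dom M \<noteq> {}" using M by (auto simp: is_structure_def small_def)
  then obtain W where W: "topped_wo W" "Field W = dom M" by (rule topped_wo_exists)
  define L' where "L' = add_rels {w} (\<lambda>_. 2) L"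
  define M' where "M' = add_ints {w} (\<lambda>_. binary W) M"
  have wL': "w \<in> rels L'" "rel_arity L' w = 2" by (auto simp: L'_def)
  have "W \<subseteq> dom M \<times> dom M" using W(2) by (auto simp: Field_def)
  then have "binary W \<subseteq> tuples (dom M) 2" using tuples_2 by blast
  then have M': "is_structure L' M'"
    unfolding L'_def M'_def by (intro is_structure_add[OF M]) (use w in auto)
  have W': "brel w M' = W" by (auto simp: brel_def M'_def binary_def)
  have inf: "infinite (elts k)" using k by (simp add: LST_at_def infinite_cardinal_def)
  have "symbols L' \<prec> elts k"
    unfolding L'_def by (rule symbols_add_lesspoll[OF L _ inf]) (simp add: finite_lesspoll_infinite inf)
  moreover have "vocab_le L L'" unfolding L'_def by (rule vocab_le_add_rels) (use w in auto)
  moreover have "is_substructure L M M'"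
    unfolding M'_def by (rule is_substructure_add[OF is_substructure_refl[OF M]]) (use w in auto)
  moreover have "dom M = points w M'"
    using points_eq_Field[of w M'] W W' by (simp add: topped_wo_def)
  moreover have "points w B \<noteq> {} \<and> defines_quant L' (Hartig # Qs) w (T w) Q B"
    if B: "elementary_substructure L' (Hartig # Qs) B M'" for B
  proof -
    note Bs = elementary_structures[OF B]
    have tB: "topped_wo (brel w B)" "Field (brel w B) = dom B" "points w B \<noteq> {}"
      using topped_wo_elementary[OF B M' wL'] W W' Bs(3) by (auto simp: M'_def)
    then have "points w B = dom B" using points_eq_Field[of w B] by (simp add: topped_wo_def)
    then show ?thesis
      using def_Q[OF Bs(2) tB(1) _ brel_subset_dom[OF Bs(2) wL']] tB(3) by blast
  qed
  ultimately show "definable_expansion Qs Q k L M"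
    unfolding definable_expansion_def
    using wL' M' T[OF wL'] by (intro exI[of _ L'] exI[of _ M'] exI[of _ w] exI[of _ "T w"]) blast
qed

section \<open>Definability from initial segments\<close>

lemma elts_coll_subset_iff:
  assumes "Well_order W" "small (Field W)" "x \<in> Field W" "y \<in> Field W"
  shows "elts (coll W x) \<subseteq> elts (coll W y) \<longleftrightarrow> (x, y) \<in> W"
  using assms by (simp add: Ord_subset_iff Ord_coll coll_mem_iff coll_eq_iff wo_le_iff)

lemma segm_subset: "segm W x \<subseteq> Field W \<times> Field W"
  using underS_in_Field by (fastforce simp: segm_def)

lemma underS_subset: "Field W = A \<Longrightarrow> underS W x \<subseteq> A"
  by (auto dest: underS_in_Field)

text \<open>
  The initial segments realise all ordinals up to the cardinality of an infinite field, and the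
  elements of the classes are cardinals, so the cardinality of \<open>X\<close> can be read off from an equipollent segment.
\<close>

lemma vcard_in_Reg_at_iff:
  assumes W: "topped_wo W" and X: "X \<subseteq> Field W"
  shows "vcard X \<in> Reg_at G \<longleftrightarrow> (\<exists>l\<in>Field W. X \<approx> underS W l \<and> coll W l \<in> Reg_at G)"
proof
  have wo: "Well_order W" "small (Field W)" using W by (auto simp: topped_wo_def)
  have smX: "small X" using X wo small_subset by blast
  {
    assume R: "vcard X \<in> Reg_at G"
    have Xe: "elts (vcard X) \<approx> X" by (rule vcard_props(2)[OF smX])
    have "infinite X" using RegD(2)[OF Reg_at_Reg[OF R]] Xe eqpoll_finite_iff by blast
    then have inf: "infinite (Field W)" using X finite_subset by blast
    obtain l where l: "l \<in> Field W" "coll W l = vcard X"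
      by (rule coll_realises[OF W inf vcard_props(1)[OF smX] vcard_mono[OF wo(2) subset_imp_lepoll[OF X]]])
    then have "X \<approx> underS W l"
      using Xe underS_eqpoll_coll[OF wo, of l] eqpoll_sym eqpoll_trans by metis
    then show "\<exists>l\<in>Field W. X \<approx> underS W l \<and> coll W l \<in> Reg_at G" using l R by auto
  next
    assume "\<exists>l\<in>Field W. X \<approx> underS W l \<and> coll W l \<in> Reg_at G"
    then obtain l where l: "X \<approx> underS W l" "coll W l \<in> Reg_at G" by blast
    have "X \<approx> elts (coll W l)"
      using l(1) underS_eqpoll_coll[OF wo, of l] eqpoll_trans by blast
    then have "vcard X = vcard (elts (coll W l))" by (rule vcard_cong)
    also have "\<dots> = coll W l" using RegD(3)[OF Reg_at_Reg[OF l(2)]] by (simp add: infinite_cardinal_def)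
    finally show "vcard X \<in> Reg_at G" using l(2) by simp
  }
qed

text \<open>
  An ordinal is regular iff its cofinality is regular and differs from the cofinalities of all
  smaller ordinals. Hence cardinalities in \<open>Reg_at G\<close> are definable from cofinalities.
\<close>

lemma R_up_by_Q_up:
  assumes W: "topped_wo W" "Field W = A" and X: "X \<subseteq> A" and Z: "Z \<subseteq> A \<times> A"
  shows "[unary X, binary Z] \<in> snd (R_up \<alpha>) A \<longleftrightarrow>
    (\<exists>l\<in>A. [unary X, unary (underS W l)] \<in> snd Hartig A \<and>
      [binary (segm W l), binary (segm W l), binary Z] \<in> snd (Q_up \<alpha>) A \<and>
      (\<forall>n\<in>underS W l. [binary (segm W l), binary (segm W n), binary Z] \<notin> snd (Q_up \<alpha>) A))"
    (is "?L \<longleftrightarrow> ?R")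
proof -
  have wo: "Well_order W" "small (Field W)" using W by (auto simp: topped_wo_def)
  define G where "G = elts (otype Z)"
  let ?c = "\<lambda>l. cofinality (ord_rel (coll W l))"
  have seg: "segm W l \<subseteq> A \<times> A" for l using segm_subset[of W l] W(2) by simp
  have Q: "[binary (segm W l), binary (segm W n), binary Z] \<in> snd (Q_up \<alpha>) A \<longleftrightarrow>
      Well_order Z \<and> otype Z \<in> \<alpha> \<and> ?c l = ?c n \<and> ?c l \<in> Reg_at G" if "l \<in> A" "n \<in> A" for l n
    using that seg Z Linear_order_segm[OF wo(1)] cofinality_segm[OF wo] W(2)
    by (auto simp: Q_up_iff G_def)
  have reg: "coll W l \<in> Reg_at G \<longleftrightarrow> ?c l \<in> Reg_at G \<and> (\<forall>n\<in>underS W l. ?c l \<noteq> ?c n)" if l: "l \<in> A" for l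
  proof
    assume R: "coll W l \<in> Reg_at G"
    then have c: "?c l = coll W l" using RegD(4)[OF Reg_at_Reg] by blast
    have "?c n \<noteq> coll W l" if "n \<in> underS W l" for n
    proof -
      have "coll W n \<in> elts (coll W l)" using that by (simp add: elts_coll[OF wo])
      then show ?thesis
        using cofinality_ord_rel_le[OF Ord_coll[OF wo], of n] mem_not_refl[of "coll W n"] by auto
    qed
    then show "?c l \<in> Reg_at G \<and> (\<forall>n\<in>underS W l. ?c l \<noteq> ?c n)" using R c by metis
  next
    assume R: "?c l \<in> Reg_at G \<and> (\<forall>n\<in>underS W l. ?c l \<noteq> ?c n)"
    then have reg: "?c l \<in> Reg" using Reg_at_Reg by blast
    have "?c l \<notin> elts (coll W l)"
    proof
      assume "?c l \<in> elts (coll W l)"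
      then obtain n where "n \<in> underS W l" "coll W n = ?c l" by (auto simp: elts_coll[OF wo])
      then show False using R RegD(4)[OF reg] by metis
    qed
    then have "?c l = coll W l"
      using cofinality_ord_rel_le[OF Ord_coll[OF wo], of l] Ord_subset_iff[OF RegD(1)[OF reg] Ord_coll[OF wo], of l]
      by blast
    then show "coll W l \<in> Reg_at G" using R by simp
  qed
  have "?R \<longleftrightarrow> (\<exists>l\<in>A. X \<approx> underS W l \<and> Well_order Z \<and> otype Z \<in> \<alpha> \<and> coll W l \<in> Reg_at G)"
  proof (intro bex_cong refl)
    fix l assume l: "l \<in> A"
    have "n \<in> A" if "n \<in> underS W l" for n using that underS_in_Field W(2) by metis
    then show "[unary X, unary (underS W l)] \<in> snd Hartig A \<and>
        [binary (segm W l), binary (segm W l), binary Z] \<in> snd (Q_up \<alpha>) A \<and>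
        (\<forall>n\<in>underS W l. [binary (segm W l), binary (segm W n), binary Z] \<notin> snd (Q_up \<alpha>) A) \<longleftrightarrow>
        X \<approx> underS W l \<and> Well_order Z \<and> otype Z \<in> \<alpha> \<and> coll W l \<in> Reg_at G"
      using Q[OF l] reg[OF l] l X underS_subset[OF W(2)] by (auto simp: Hartig_iff)
  qed
  also have "\<dots> \<longleftrightarrow> ?L"
    using vcard_in_Reg_at_iff[OF W(1), of X G] X Z W(2) by (auto simp: R_up_iff G_def)
  finally show ?thesis by simp
qed

lemma ext_single_below:
  assumes "brel w M \<subseteq> dom M \<times> dom M"
  shows "ext Qs M a ([u], at2 w u n) = unary {x. (x, (a(u := x)) n) \<in> brel w M}"
proof -
  have "{x. x \<in> dom M \<and> (x, (a(u := x)) n) \<in> brel w M} = {x. (x, (a(u := x)) n) \<in> brel w M}"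
    using assms by auto
  then show ?thesis by (simp add: ext_single)
qed

definition R_up_fm :: "'v \<Rightarrow> (nat list \<times> 'v form) list \<Rightarrow> 'v form" where
  "R_up_fm w bs = (let n = fresh bs in
     Exists n (Conj (Quant 0 [bs ! 0, below w n])
       (Conj (Quant 1 [seg w n, seg w n, bs ! 1])
         (All (Suc n) (Imp (below_fm w (Suc n) n) (Neg (Quant 1 [seg w n, seg w (Suc n), bs ! 1])))))))"

lemma LST_at_Q_up_imp_R_up:
  assumes "LST_at [Hartig, Q_up \<alpha>] k" shows "LST_at [Hartig, R_up \<alpha>] k"
proof (rule transfer_by_order[where T = R_up_fm, OF assms])
  fix L :: "'a vocabulary" and w :: 'a and bs
  assume "w \<in> rels L" "rel_arity L w = 2" "quant_args L [Hartig, Q_up \<alpha>] (fst (R_up \<alpha>)) bs"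
  then show "form_of L [Hartig, Q_up \<alpha>] (R_up_fm w bs)"
    by (auto simp: R_up_fm_def Let_def Hartig_def Q_up_def R_up_def seg_def below_def numeral_2_eq_2
        intro!: form_of_Quant2 form_of_Quant3 elim!: quant_args_2)
next
  fix L :: "'a vocabulary" and w and B :: "'a struct"
  assume W: "topped_wo (brel w B)" "points w B = dom B" and sub: "brel w B \<subseteq> dom B \<times> dom B"
  let ?Qs = "[Hartig, Q_up \<alpha>]"
  have wo: "Well_order (brel w B)" using W by (simp add: topped_wo_def)
  have F: "Field (brel w B) = dom B" using points_eq_Field[OF wo] W by simp
  show "defines_quant L ?Qs w (R_up_fm w) (R_up \<alpha>) B"
    unfolding defines_quant_def
  proof (intro allI impI)
    fix a bs
    assume A: "range a \<subseteq> dom B \<and> quant_args L ?Qs (fst (R_up \<alpha>)) bs \<and>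
      (\<forall>e\<in>set bs. ext ?Qs B a e \<subseteq> lists (points w B))"
    then have "quant_args L ?Qs [1, 2] bs" by (simp add: R_up_def)
    then obtain e f where bs: "bs = [e, f]" "length (fst e) = 1" "length (fst f) = 2"
      by (rule quant_args_2)
    have "ext ?Qs B a e \<subseteq> lists (dom B)" "ext ?Qs B a f \<subseteq> lists (dom B)" using A bs W(2) by auto
    then obtain X Z where X: "X \<subseteq> dom B" "ext ?Qs B a e = unary X"
      and Z: "Z \<subseteq> dom B \<times> dom B" "ext ?Qs B a f = binary Z"
      using ext_unary[OF bs(2)] ext_binary[OF bs(3)] by metis
    define n where "n = fresh bs"
    have fr: "ext ?Qs B b e = unary X" "ext ?Qs B b f = binary Z" if "\<And>i. i < n \<Longrightarrow> b i = a i" for b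
      using ext_fresh[of e bs b a] ext_fresh[of f bs b a] that bs X Z by (auto simp: n_def)
    have un: "x \<in> underS (brel w B) l \<Longrightarrow> x \<in> dom B" for x l using underS_in_Field F by metis
    have "sat ?Qs B a (R_up_fm w bs) \<longleftrightarrow> [unary X, binary Z] \<in> snd (R_up \<alpha>) (dom B)"
      unfolding R_up_by_Q_up[OF W(1) F X(1) Z(1)] R_up_fm_def Let_def n_def[symmetric]
      using bs(1) un by (auto simp: sat_Quant ext_seg[OF wo sub] ext_below[OF sub] fr)
    then show "sat ?Qs B a (R_up_fm w bs) \<longleftrightarrow> map (ext ?Qs B a) bs \<in> snd (R_up \<alpha>) (points w B)"
      using X Z W(2) bs(1) by simp
  qed
qed

lemma infinite_iff_insert_eqpoll: "x \<notin> S \<Longrightarrow> infinite S \<longleftrightarrow> S \<approx> insert x S"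
proof -
  assume x: "x \<notin> S"
  have "\<not> S \<approx> insert x S" if "finite S"
    using that x eqpoll_iff_card[of S "insert x S"] by simp
  then show ?thesis using infinite_insert_eqpoll[of S x] eqpoll_sym[of "insert x S" S] by blast
qed

text \<open>
  The order type of \<open>Z\<close> must be 0, and uncountable successor cardinals are described by comparing
  segments. A segment is infinite iff adding a point does not change its size.
\<close>

lemma R_up_1_by_Hartig:
  assumes W: "topped_wo W" "Field W = A" and X: "X \<subseteq> A" and Z: "Z \<subseteq> A \<times> A"
  shows "[unary X, binary Z] \<in> snd (R_up ord1) A \<longleftrightarrow> Z = {} \<and>
    (\<exists>l\<in>A. X \<approx> underS W l \<and> (\<forall>n\<in>underS W l. \<not> underS W n \<approx> underS W l) \<and>
      (\<exists>n\<in>underS W l. underS W n \<approx> under W n \<and>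
        (\<forall>m\<in>underS W l. (n, m) \<in> W \<longrightarrow> underS W n \<approx> underS W m)))"
proof -
  have wo: "Well_order W" "small (Field W)" using W by (auto simp: topped_wo_def)
  have e: "elts (coll W n) \<approx> underS W n" for n
    by (rule eqpoll_sym[OF underS_eqpoll_coll[OF wo]])
  have ee: "elts (coll W n) \<approx> elts (coll W m) \<longleftrightarrow> underS W n \<approx> underS W m" for n m
    by (meson e eqpoll_sym eqpoll_trans)
  have inf: "infinite (elts (coll W n)) \<longleftrightarrow> underS W n \<approx> under W n" if "n \<in> A" for n
  proof -
    have "under W n = insert n (underS W n)"
      using wo that W(2) by (auto simp: under_def underS_def order_on_defs refl_on_def)
    moreover have "n \<notin> underS W n" by (auto simp: underS_def)
    ultimately show ?thesis
      using infinite_iff_insert_eqpoll[of n "underS W n"] eqpoll_finite_iff[OF e] by simp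
  qed
  have un: "n \<in> A" if "n \<in> underS W l" for n l using that underS_in_Field W(2) by metis
  have *: "coll W l \<in> Reg_at {} \<longleftrightarrow> (\<forall>n\<in>underS W l. \<not> underS W n \<approx> underS W l) \<and>
      (\<exists>n\<in>underS W l. underS W n \<approx> under W n \<and>
        (\<forall>m\<in>underS W l. (n, m) \<in> W \<longrightarrow> underS W n \<approx> underS W m))" if "l \<in> A" for l
    unfolding Reg_at_0_iff[OF Ord_coll[OF wo]] elts_coll[OF wo, of l] ball_simps bex_simps ee
    using inf un elts_coll_subset_iff[OF wo, unfolded W(2)] e eqpoll_trans eqpoll_sym
    by (simp add: ee[unfolded elts_coll[OF wo, of l]] elts_coll[OF wo, of l, symmetric])
  have "small (Field Z)"
    by (rule small_subset[OF wo(2)]) (use Z W(2) in \<open>auto simp: Field_def\<close>)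
  then have ot: "Well_order Z \<Longrightarrow> elts (otype Z) = {} \<longleftrightarrow> Z = {}"
    using otype_props(3)[of Z] by (auto simp: Field_def)
  have "Well_order ({} :: 'a rel)" by (auto simp: order_on_defs refl_on_def trans_def antisym_def total_on_def)
  then have Z0: "Well_order Z \<and> otype Z \<in> ord1 \<longleftrightarrow> Z = {}" and Z0': "Z = {} \<Longrightarrow> elts (otype Z) = {}"
    using ot by (auto simp: ord1_def)
  then show ?thesis
    using vcard_in_Reg_at_iff[OF W(1), of X "{}"] X Z W(2) * by (auto simp: R_up_iff)
qed

definition R_up_1_fm :: "'v \<Rightarrow> (nat list \<times> 'v form) list \<Rightarrow> 'v form" where
  "R_up_1_fm w bs = (let n = fresh bs in
     Conj (Neg (Exists n (Exists (Suc n) (app (bs ! 1) n (Suc n)))))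
       (Exists n (Conj (Quant 0 [bs ! 0, below w n])
         (Conj (All (Suc n) (Imp (below_fm w (Suc n) n) (Neg (Quant 0 [below w (Suc n), below w n]))))
           (Exists (Suc n) (Conj (below_fm w (Suc n) n)
             (Conj (Quant 0 [below w (Suc n), ([n + 2], at2 w (n + 2) (Suc n))])
               (All (n + 2) (Imp (Conj (below_fm w (n + 2) n) (at2 w (Suc n) (n + 2)))
                 (Quant 0 [below w (Suc n), below w (n + 2)]))))))))))"

lemma app_fresh:
  assumes "e \<in> set bs" "length (fst e) = 2" "distinct (fst e)" "x \<ge> fresh bs" "y \<ge> fresh bs"
    "\<And>n. n < fresh bs \<Longrightarrow> b n = a n" "ext Qs M a e = binary X" "b x \<in> dom M" "b y \<in> dom M"
  shows "sat Qs M b (app e x y) \<longleftrightarrow> (b x, b y) \<in> X"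
proof -
  obtain vs p where e: "e = (vs, p)" by (cases e)
  obtain u v where uv: "vs = [u, v]" "u \<noteq> v"
    using assms(2,3) e by (auto simp: numeral_2_eq_2 length_Suc_conv)
  have "u < fresh bs" "v < fresh bs" using fresh_gt[of vs p bs] assms(1) e uv by auto
  then have "sat Qs M b (app e x y) \<longleftrightarrow> [b x, b y] \<in> ext Qs M b e"
    by (intro sat_app[of e u v p]) (use assms e uv in auto)
  also have "ext Qs M b e = binary X" using ext_fresh[OF assms(1), of b a] assms by simp
  finally show ?thesis by (auto simp: binary_def)
qed

lemma form_of_app:
  assumes "form_of L Qs (snd e)" shows "form_of L Qs (app e x y)"
  using assms by (simp add: app_def Let_def)

lemma LST_at_Hartig_imp_R_up_1:
  assumes "LST_at [Hartig] k" shows "LST_at [Hartig, R_up ord1] k"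
proof (rule transfer_by_order[where T = R_up_1_fm, OF assms])
  fix L :: "'a vocabulary" and w :: 'a and bs
  assume "w \<in> rels L" "rel_arity L w = 2" "quant_args L [Hartig] (fst (R_up ord1 :: 'a gquant)) bs"
  then show "form_of L [Hartig] (R_up_1_fm w bs)"
    by (auto simp: R_up_1_fm_def Let_def Hartig_def R_up_def seg_def below_def numeral_2_eq_2
        intro!: form_of_Quant2 form_of_app elim!: quant_args_2)
next
  fix L :: "'a vocabulary" and w and B :: "'a struct"
  assume W: "topped_wo (brel w B)" "points w B = dom B" and sub: "brel w B \<subseteq> dom B \<times> dom B"
  let ?Qs = "[Hartig :: 'a gquant]"
  have wo: "Well_order (brel w B)" using W by (simp add: topped_wo_def)
  have F: "Field (brel w B) = dom B" using points_eq_Field[OF wo] W by simp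
  show "defines_quant L ?Qs w (R_up_1_fm w) (R_up ord1) B"
    unfolding defines_quant_def
  proof (intro allI impI)
    fix a bs
    assume A: "range a \<subseteq> dom B \<and> quant_args L ?Qs (fst (R_up ord1 :: 'a gquant)) bs \<and>
      (\<forall>e\<in>set bs. ext ?Qs B a e \<subseteq> lists (points w B))"
    then have "quant_args L ?Qs [1, 2] bs" by (simp add: R_up_def)
    then obtain e f where bs: "bs = [e, f]" "length (fst e) = 1" "length (fst f) = 2" "distinct (fst f)"
      by (rule quant_args_2)
    have "ext ?Qs B a e \<subseteq> lists (dom B)" "ext ?Qs B a f \<subseteq> lists (dom B)" using A bs W(2) by auto
    then obtain X Z where X: "X \<subseteq> dom B" "ext ?Qs B a e = unary X"
      and Z: "Z \<subseteq> dom B \<times> dom B" "ext ?Qs B a f = binary Z"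
      using ext_unary[OF bs(2)] ext_binary[OF bs(3)] by metis
    define n where "n = fresh bs"
    have fr: "ext ?Qs B b e = unary X" if "\<And>i. i < n \<Longrightarrow> b i = a i" for b
      using ext_fresh[of e bs b a] that bs X by (auto simp: n_def)
    have ap: "sat ?Qs B b (app f x y) \<longleftrightarrow> (b x, b y) \<in> Z"
      if "x \<ge> n" "y \<ge> n" "\<And>i. i < n \<Longrightarrow> b i = a i" "b x \<in> dom B" "b y \<in> dom B" for b x y
      using app_fresh[of f bs x y b a ?Qs B Z] that bs Z by (auto simp: n_def)
    have un: "underS (brel w B) l \<subseteq> dom B" "under (brel w B) l \<subseteq> dom B" for l
      using sub by (auto simp: underS_def under_def)
    have und: "{x. (x, l) \<in> brel w B} = under (brel w B) l" for l by (auto simp: under_def)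
    have bnd: "(\<forall>x\<in>dom B. x \<in> underS (brel w B) l \<longrightarrow> P x) \<longleftrightarrow> (\<forall>x\<in>underS (brel w B) l. P x)"
      "(\<exists>x\<in>dom B. x \<in> underS (brel w B) l \<and> P x) \<longleftrightarrow> (\<exists>x\<in>underS (brel w B) l. P x)"
      "(\<forall>x\<in>dom B. \<forall>y\<in>dom B. (x, y) \<notin> Z) \<longleftrightarrow> Z = {}" for l P
      using un(1)[of l] Z(1) by auto
    have "sat ?Qs B a (R_up_1_fm w bs) \<longleftrightarrow> [unary X, binary Z] \<in> snd (R_up ord1) (dom B)"
      unfolding R_up_1_by_Hartig[OF W(1) F X(1) Z(1)] R_up_1_fm_def Let_def n_def[symmetric]
      using bs(1) by (simp add: sat_Quant ext_below[OF sub] ext_single_below[OF sub] fr ap und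
          Hartig_iff X un bnd imp_conjL del: One_nat_def)
    then show "sat ?Qs B a (R_up_1_fm w bs) \<longleftrightarrow> map (ext ?Qs B a) bs \<in> snd (R_up ord1) (points w B)"
      using X Z W(2) bs(1) by simp
  qed
qed

text \<open>
  Every uncountable regular cardinal lies in some class and is therefore detected by \<open>Q_up On\<close> with
  a suitable segment. The cofinalities that are not detected are 0, 1 and \<open>\<omega>\<close>, according to whether
  the order is empty, has a largest element, or neither.
\<close>

lemma Q_ec_by_Q_up:
  assumes W: "topped_wo W" "Field W = A" and X: "X \<subseteq> A \<times> A" and Y: "Y \<subseteq> A \<times> A"
  shows "[binary X, binary Y] \<in> snd Q_ec A \<longleftrightarrow> Linear_order X \<and> Linear_order Y \<and>
    ((\<exists>g\<in>A. [binary X, binary Y, binary (segm W g)] \<in> snd (Q_up On) A) \<or>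
     (\<forall>g\<in>A. [binary X, binary X, binary (segm W g)] \<notin> snd (Q_up On) A) \<and>
     (\<forall>g\<in>A. [binary Y, binary Y, binary (segm W g)] \<notin> snd (Q_up On) A) \<and>
     (X = {} \<longleftrightarrow> Y = {}) \<and> (has_max X \<longleftrightarrow> has_max Y))" (is "?L \<longleftrightarrow> ?R")
proof -
  have wo: "Well_order W" "small (Field W)" using W by (auto simp: topped_wo_def)
  have seg: "segm W l \<subseteq> A \<times> A" for l using segm_subset[of W l] W(2) by simp
  have Q: "[binary X, binary Y, binary (segm W g)] \<in> snd (Q_up On) A \<longleftrightarrow>
      Linear_order X \<and> Linear_order Y \<and> cofinality X = cofinality Y \<and> cofinality X \<in> Reg_at (elts (coll W g))"
    if "X \<subseteq> A \<times> A" "Y \<subseteq> A \<times> A" "g \<in> A" for X Y g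
    using that seg otype_segm[OF wo, of g] W(2) Well_order_segm[OF wo(1)] Ord_coll[OF wo, of g]
    by (auto simp: Q_up_iff On_def)
  have sm: "small (Field X)" if "X \<subseteq> A \<times> A" for X
    by (rule small_subset[OF wo(2)]) (use that W(2) in \<open>auto simp: Field_def\<close>)
  have U: "(\<exists>g\<in>A. cofinality X \<in> Reg_at (elts (coll W g))) \<longleftrightarrow> cofinality X \<in> Reg \<and> cofinality X \<noteq> least_Reg"
    if X: "X \<subseteq> A \<times> A" "Linear_order X" for X
  proof
    assume "\<exists>g\<in>A. cofinality X \<in> Reg_at (elts (coll W g))"
    then show "cofinality X \<in> Reg \<and> cofinality X \<noteq> least_Reg"
      using Reg_at_Reg least_Reg_notin_Reg_at by metis
  next
    assume R: "cofinality X \<in> Reg \<and> cofinality X \<noteq> least_Reg"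
    obtain g where g: "Ord g" "cofinality X \<in> Reg_at (elts g)" "elts g \<subseteq> elts (cofinality X)"
      using Reg_at_exists[of "cofinality X"] R by blast
    have "Field X \<subseteq> Field W" using X W(2) by (auto simp: Field_def)
    then have le: "elts (cofinality X) \<subseteq> elts (vcard (Field W))"
      using cofinality_le_vcard[OF X(2) sm[OF X(1)]] vcard_mono[OF wo(2) subset_imp_lepoll] by blast
    have "infinite (elts (vcard (Field W)))"
      using RegD(2) R le finite_subset by blast
    then have "infinite (Field W)" using vcard_props(2)[OF wo(2)] eqpoll_finite_iff by blast
    then obtain x where "x \<in> Field W" "coll W x = g"
      using coll_realises[OF W(1) _ g(1)] g(3) le by blast
    then show "\<exists>g\<in>A. cofinality X \<in> Reg_at (elts (coll W g))" using g(2) W(2) by auto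
  qed
  have E: "X = {} \<longleftrightarrow> elts (cofinality X) = {}" if "X \<subseteq> A \<times> A" "Linear_order X" for X
    using cofinality_empty_iff[OF that(2) sm[OF that(1)]] by (auto simp: Field_def)
  have M: "has_max X \<longleftrightarrow> finite (elts (cofinality X)) \<and> elts (cofinality X) \<noteq> {}" if "X \<subseteq> A \<times> A" "Linear_order X" for X
    using cofinality_has_max_iff(1)[OF that(2) sm[OF that(1)]] cofinality_empty_iff[OF that(2) sm[OF that(1)]]
    by blast
  have eq: "cofinality X = cofinality Y"
    if lin: "Linear_order X" "Linear_order Y" and U': "\<not> (cofinality X \<in> Reg \<and> cofinality X \<noteq> least_Reg)"
      "\<not> (cofinality Y \<in> Reg \<and> cofinality Y \<noteq> least_Reg)" and EM: "X = {} \<longleftrightarrow> Y = {}" "has_max X \<longleftrightarrow> has_max Y"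
  proof (cases "X = {} \<or> has_max X")
    case True
    then show ?thesis
    proof
      assume "X = {}"
      then show ?thesis using E[OF X lin(1)] E[OF Y lin(2)] EM extensionality by metis
    next
      assume "has_max X"
      then show ?thesis
        using cofinality_has_max_iff(2)[OF lin(1) sm[OF X], of undefined]
          cofinality_has_max_iff(2)[OF lin(2) sm[OF Y], of undefined] EM by simp
    qed
  next
    case False
    then have "infinite (elts (cofinality X))" "infinite (elts (cofinality Y))"
      using E[OF X lin(1)] M[OF X lin(1)] E[OF Y lin(2)] M[OF Y lin(2)] EM by auto
    then show ?thesis
      using cofinality_in_Reg[OF lin(1) sm[OF X]] cofinality_in_Reg[OF lin(2) sm[OF Y]] U' by metis
  qed
  show ?thesis
  proof
    assume ?L
    then have L: "Linear_order X" "Linear_order Y" "cofinality X = cofinality Y" by (auto simp: Q_ec_iff)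
    have "X = {} \<longleftrightarrow> Y = {}" "has_max X \<longleftrightarrow> has_max Y"
      using E[OF X L(1)] E[OF Y L(2)] M[OF X L(1)] M[OF Y L(2)] L(3) by auto
    then show ?R using L Q[OF X Y] Q[OF X X] Q[OF Y Y] by auto
  next
    assume R: ?R
    then have L: "Linear_order X" "Linear_order Y" by auto
    have "cofinality X = cofinality Y"
    proof (cases "\<exists>g\<in>A. [binary X, binary Y, binary (segm W g)] \<in> snd (Q_up On) A")
      case True
      then show ?thesis using Q[OF X Y] by blast
    next
      case False
      then have "\<forall>g\<in>A. cofinality X \<notin> Reg_at (elts (coll W g))" "\<forall>g\<in>A. cofinality Y \<notin> Reg_at (elts (coll W g))"
        "X = {} \<longleftrightarrow> Y = {}" "has_max X \<longleftrightarrow> has_max Y"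
        using R L Q[OF X X] Q[OF Y Y] by auto
      then show ?thesis using eq[OF L] U[OF X L(1)] U[OF Y L(2)] by blast
    qed
    then show ?L using L X Y by (simp add: Q_ec_iff)
  qed
qed

lemma Linear_order_iff:
  "Linear_order X \<longleftrightarrow> (\<forall>x y. (x, y) \<in> X \<longrightarrow> (x, x) \<in> X \<and> (y, y) \<in> X) \<and>
     (\<forall>x y z. (x, y) \<in> X \<longrightarrow> (y, z) \<in> X \<longrightarrow> (x, z) \<in> X) \<and>
     (\<forall>x y. (x, y) \<in> X \<longrightarrow> (y, x) \<in> X \<longrightarrow> x = y) \<and>
     (\<forall>x y. (x, x) \<in> X \<longrightarrow> (y, y) \<in> X \<longrightarrow> (x, y) \<in> X \<or> (y, x) \<in> X)"
proof -
  have "trans X \<longleftrightarrow> (\<forall>x y z. (x, y) \<in> X \<longrightarrow> (y, z) \<in> X \<longrightarrow> (x, z) \<in> X)" by (auto simp: trans_def)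
  moreover have "antisym X \<longleftrightarrow> (\<forall>x y. (x, y) \<in> X \<longrightarrow> (y, x) \<in> X \<longrightarrow> x = y)" by (auto simp: antisym_def)
  moreover have r: "Refl X \<longleftrightarrow> (\<forall>x y. (x, y) \<in> X \<longrightarrow> (x, x) \<in> X \<and> (y, y) \<in> X)"
    by (auto simp: refl_on_def Field_def)
  moreover have "x \<in> Field X \<longleftrightarrow> (x, x) \<in> X" if "Refl X" for x
    using that by (auto simp: refl_on_def Field_def)
  then have "Total X \<longleftrightarrow> (\<forall>x y. (x, x) \<in> X \<longrightarrow> (y, y) \<in> X \<longrightarrow> (x, y) \<in> X \<or> (y, x) \<in> X)" if "Refl X"
    using that by (simp add: total_on_def) (metis that)
  moreover have "X \<subseteq> Field X \<times> Field X" by (auto simp: Field_def)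
  ultimately show ?thesis unfolding order_on_defs by blast
qed

lemma has_max_iff: "Linear_order X \<Longrightarrow> has_max X \<longleftrightarrow> (\<exists>m. (m, m) \<in> X \<and> (\<forall>x. (x, x) \<in> X \<longrightarrow> (x, m) \<in> X))"
  unfolding has_max_def order_on_defs refl_on_def Field_def by blast

definition linear_fm :: "nat list \<times> 'v form \<Rightarrow> nat \<Rightarrow> 'v form" where
  "linear_fm e n = (let x = n; y = n + 1; z = n + 2; le = app e in
     All x (All y (Conj (Imp (le x y) (Conj (le x x) (le y y)))
       (Conj (All z (Imp (le x y) (Imp (le y z) (le x z))))
         (Conj (Imp (le x y) (Imp (le y x) (Equal (Var x) (Var y))))
           (Imp (le x x) (Imp (le y y) (Disj (le x y) (le y x)))))))))"

definition empty_fm :: "nat list \<times> 'v form \<Rightarrow> nat \<Rightarrow> 'v form" where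
  "empty_fm e n = All n (All (Suc n) (Neg (app e n (Suc n))))"

definition max_fm :: "nat list \<times> 'v form \<Rightarrow> nat \<Rightarrow> 'v form" where
  "max_fm e n = Exists n (Conj (app e n n) (All (Suc n) (Imp (app e (Suc n) (Suc n)) (app e (Suc n) n))))"

definition Q_ec_fm :: "'v \<Rightarrow> (nat list \<times> 'v form) list \<Rightarrow> 'v form" where
  "Q_ec_fm w bs = (let n = fresh bs; e = bs ! 0; f = bs ! 1 in
     Conj (Conj (linear_fm e n) (linear_fm f n))
      (Disj (Exists n (Quant 1 [e, f, seg w n]))
        (Conj (Conj (All n (Neg (Quant 1 [e, e, seg w n]))) (All n (Neg (Quant 1 [f, f, seg w n]))))
          (Conj (Iff (empty_fm e n) (empty_fm f n)) (Iff (max_fm e n) (max_fm f n))))))"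

lemma LST_at_Q_up_On_imp_Q_ec:
  assumes "LST_at [Hartig, Q_up On] k" shows "LST_at [Hartig, Q_ec] k"
proof (rule transfer_by_order[where T = Q_ec_fm, OF assms])
  fix L :: "'a vocabulary" and w :: 'a and bs
  assume "w \<in> rels L" "rel_arity L w = 2" "quant_args L [Hartig, Q_up On] (fst (Q_ec :: 'a gquant)) bs"
  then show "form_of L [Hartig, Q_up On] (Q_ec_fm w bs)"
    by (auto simp: Q_ec_fm_def linear_fm_def empty_fm_def max_fm_def Let_def Q_ec_def Q_up_def seg_def numeral_2_eq_2
        intro!: form_of_Quant3 form_of_app elim!: quant_args_2)
next
  fix L :: "'a vocabulary" and w and B :: "'a struct"
  assume W: "topped_wo (brel w B)" "points w B = dom B" and sub: "brel w B \<subseteq> dom B \<times> dom B"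
  let ?Qs = "[Hartig, Q_up (On :: 'a set)]"
  have wo: "Well_order (brel w B)" using W by (simp add: topped_wo_def)
  have F: "Field (brel w B) = dom B" using points_eq_Field[OF wo] W by simp
  show "defines_quant L ?Qs w (Q_ec_fm w) Q_ec B"
    unfolding defines_quant_def
  proof (intro allI impI)
    fix a bs
    assume A: "range a \<subseteq> dom B \<and> quant_args L ?Qs (fst (Q_ec :: 'a gquant)) bs \<and>
      (\<forall>e\<in>set bs. ext ?Qs B a e \<subseteq> lists (points w B))"
    then have "quant_args L ?Qs [2, 2] bs" by (simp add: Q_ec_def)
    then obtain e f where bs: "bs = [e, f]" "length (fst e) = 2" "length (fst f) = 2"
        "distinct (fst e)" "distinct (fst f)"
      by (rule quant_args_2)
    have "ext ?Qs B a e \<subseteq> lists (dom B)" "ext ?Qs B a f \<subseteq> lists (dom B)" using A bs W(2) by auto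
    then obtain X Y where X: "X \<subseteq> dom B \<times> dom B" "ext ?Qs B a e = binary X"
      and Y: "Y \<subseteq> dom B \<times> dom B" "ext ?Qs B a f = binary Y"
      using ext_binary[OF bs(2)] ext_binary[OF bs(3)] by metis
    define n where "n = fresh bs"
    have fr: "ext ?Qs B b e = binary X" "ext ?Qs B b f = binary Y" if "\<And>i. i < n \<Longrightarrow> b i = a i" for b
      using ext_fresh[of e bs b a] ext_fresh[of f bs b a] that bs X Y by (auto simp: n_def)
    have macros: "sat ?Qs B b (linear_fm d n) \<longleftrightarrow> Linear_order V" "sat ?Qs B b (empty_fm d n) \<longleftrightarrow> V = {}"
        "Linear_order V \<Longrightarrow> sat ?Qs B b (max_fm d n) \<longleftrightarrow> has_max V"
      if d: "d \<in> set bs" "length (fst d) = 2" "distinct (fst d)" "ext ?Qs B a d = binary V" "V \<subseteq> dom B \<times> dom B"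
        and b: "\<And>i. i < n \<Longrightarrow> b i = a i" for b d V
    proof -
      have ap: "sat ?Qs B c (app d x y) \<longleftrightarrow> (c x, c y) \<in> V"
        if "x \<ge> n" "y \<ge> n" "\<And>i. i < n \<Longrightarrow> c i = a i" "c x \<in> dom B" "c y \<in> dom B" for c x y
        using app_fresh[of d bs x y c a ?Qs B V] that d by (auto simp: n_def)
      have Vd: "(x, y) \<in> V \<Longrightarrow> x \<in> dom B \<and> y \<in> dom B" for x y using d(5) by blast
      show "sat ?Qs B b (linear_fm d n) \<longleftrightarrow> Linear_order V"
        unfolding Linear_order_iff by (simp add: linear_fm_def Let_def ap b) (use Vd in blast)
      show "sat ?Qs B b (empty_fm d n) \<longleftrightarrow> V = {}"
        by (simp add: empty_fm_def ap b) (use Vd in auto)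
      show "sat ?Qs B b (max_fm d n) \<longleftrightarrow> has_max V" if "Linear_order V"
        unfolding has_max_iff[OF that] by (simp add: max_fm_def ap b) (use Vd in blast)
    qed
    note me = macros[of e X] and mf = macros[of f Y]
    have "sat ?Qs B a (Q_ec_fm w bs) \<longleftrightarrow> [binary X, binary Y] \<in> snd Q_ec (dom B)"
      unfolding Q_ec_by_Q_up[OF W(1) F X(1) Y(1)] Q_ec_fm_def Let_def n_def[symmetric]
      using me mf X Y bs by (simp add: sat_Quant ext_seg[OF wo sub] fr) blast
    then show "sat ?Qs B a (Q_ec_fm w bs) \<longleftrightarrow> map (ext ?Qs B a) bs \<in> snd Q_ec (points w B)"
      using X Y W(2) bs(1) by simp
  qed
qed

section \<open>Lowering the bound on the order types\<close>

text \<open>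
  Both families of quantifiers have the form: the last argument is a well-order of some type below
  the bound, and the other arguments stand in a relation that depends on this order type.
\<close>

definition rank_quant ::
    "nat list \<Rightarrow> ('v set \<Rightarrow> 'v list set list \<Rightarrow> 'v \<Rightarrow> bool) \<Rightarrow> 'v::zfc_universe set \<Rightarrow> 'v gquant" where
  "rank_quant ns S \<alpha> = (ns @ [2], \<lambda>A. {args @ [binary Z] | args Z.
     S A args (otype Z) \<and> Z \<subseteq> A \<times> A \<and> Well_order Z \<and> otype Z \<in> \<alpha>})"

lemma rank_quant_iff: "args @ [binary Z] \<in> snd (rank_quant ns S \<alpha>) A \<longleftrightarrow>
    S A args (otype Z) \<and> Z \<subseteq> A \<times> A \<and> Well_order Z \<and> otype Z \<in> \<alpha>"
  by (auto simp: rank_quant_def)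

text \<open>
  Two facts about the classes enter the comparison of bounds: they are disjoint, and in a given
  domain only their elements up to its cardinality can be tested.
\<close>

definition rank_determined :: "('v::zfc_universe set \<Rightarrow> 'v list set list \<Rightarrow> 'v \<Rightarrow> bool) \<Rightarrow> bool" where
  "rank_determined S \<longleftrightarrow>
     (\<forall>A args c d. S A args c \<and> S A args d \<and> Ord c \<and> Ord d \<longrightarrow> c = d) \<and>
     (\<forall>A args c. small A \<and> S A args c \<longrightarrow> (\<exists>m\<in>Reg_at (elts c). elts m \<subseteq> elts (vcard A)))"

lemma insert_lesspoll: "infinite K \<Longrightarrow> S \<prec> K \<Longrightarrow> insert x S \<prec> K"
proof (cases "finite S")
  case False
  then show "S \<prec> K \<Longrightarrow> insert x S \<prec> K" by (rule eq_lesspoll_trans[OF infinite_insert_eqpoll])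
qed (simp add: finite_lesspoll_infinite)

definition lower_fm :: "'v \<Rightarrow> 'v \<Rightarrow> (nat list \<times> 'v form) list \<Rightarrow> 'v form" where
  "lower_fm w P bs = (let n = fresh bs in
     Conj (Quant 1 bs) (Exists n (Conj (Rel P [Var n]) (Quant 1 (butlast bs @ [seg w n])))))"

lemma quant_args_snoc:
  assumes "quant_args L Qs (ns @ [2]) bs"
  obtains cs e where "bs = cs @ [e]" "length (fst e) = 2" "quant_args L Qs ns cs"
proof -
  have m: "map (\<lambda>(vs, p). length vs) bs = ns @ [2]" using assms by (simp add: quant_args_def)
  then have "bs \<noteq> []" by auto
  then obtain cs e where bs: "bs = cs @ [e]" by (metis append_butlast_last_id)
  then show thesis using that[of cs e] assms by (auto simp: quant_args_def case_prod_unfold)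
qed

lemma form_of_lower_fm:
  assumes "w \<in> rels L" "rel_arity L w = 2" "P \<in> rels L" "rel_arity L P = 1"
    and "quant_args L [Hartig, rank_quant ns S \<alpha>] (ns @ [2]) bs"
  shows "form_of L [Hartig, rank_quant ns S \<alpha>] (lower_fm w P bs)"
proof -
  obtain cs e where bs: "bs = cs @ [e]" "length (fst e) = 2" "quant_args L [Hartig, rank_quant ns S \<alpha>] ns cs"
    using assms(5) by (rule quant_args_snoc)
  then show ?thesis
    using assms by (auto simp: lower_fm_def Let_def rank_quant_def quant_args_def seg_def)
qed

text \<open>
  The order types below \<open>\<beta>\<close> are singled out by a predicate \<open>P\<close> for the initial segment of type
  \<open>\<beta>\<close>: since the order type is determined by the other arguments, it can be compared with that
  of an initial segment without any isomorphism.
\<close>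

lemma defines_lower:
  assumes S: "rank_determined S" and \<beta>: "\<beta> \<subseteq> \<alpha>" "\<beta> \<subseteq> On"
    and W: "topped_wo (brel w B)" "points w B = dom B" "brel w B \<subseteq> dom B \<times> dom B"
    and P: "coll (brel w B) ` {x \<in> dom B. [x] \<in> rel_int B P} = \<beta>"
  shows "defines_quant L [Hartig, rank_quant ns S \<alpha>] w (lower_fm w P) (rank_quant ns S \<beta>) B"
  unfolding defines_quant_def
proof (intro allI impI)
  let ?Qs = "[Hartig, rank_quant ns S \<alpha>]"
  have wo: "Well_order (brel w B)" "small (Field (brel w B))" using W by (auto simp: topped_wo_def)
  have F: "Field (brel w B) = dom B" using points_eq_Field[OF wo(1)] W by simp
  fix a bs
  assume A: "range a \<subseteq> dom B \<and> quant_args L ?Qs (fst (rank_quant ns S \<beta>)) bs \<and>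
    (\<forall>e\<in>set bs. ext ?Qs B a e \<subseteq> lists (points w B))"
  then have "quant_args L ?Qs (ns @ [2]) bs" by (simp add: rank_quant_def)
  then obtain cs e where bs: "bs = cs @ [e]" "length (fst e) = 2" by (rule quant_args_snoc)
  have "ext ?Qs B a e \<subseteq> lists (dom B)" using A bs W(2) by auto
  then obtain Z where Z: "Z \<subseteq> dom B \<times> dom B" "ext ?Qs B a e = binary Z"
    using ext_binary[OF bs(2)] by metis
  define args where "args = map (ext ?Qs B a) cs"
  define n where "n = fresh bs"
  have fr: "map (ext ?Qs B (a(n := x))) cs = args" for x
    unfolding args_def using ext_fresh[of _ bs "a(n := x)" a] bs(1) by (auto simp: n_def)
  have args: "map (ext ?Qs B a) bs = args @ [binary Z]" using bs Z by (simp add: args_def)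
  have "sat ?Qs B a (lower_fm w P bs) \<longleftrightarrow> args @ [binary Z] \<in> snd (rank_quant ns S \<alpha>) (dom B) \<and>
      (\<exists>x\<in>dom B. [x] \<in> rel_int B P \<and> args @ [binary (segm (brel w B) x)] \<in> snd (rank_quant ns S \<alpha>) (dom B))"
    unfolding lower_fm_def Let_def n_def[symmetric]
    by (simp add: sat_Quant args bs(1) fr ext_seg[OF wo(1) W(3)] sat.simps(2)) (simp add: args_def Z(2))
  also have "\<dots> \<longleftrightarrow> args @ [binary Z] \<in> snd (rank_quant ns S \<beta>) (dom B)"
  proof
    assume R: "args @ [binary Z] \<in> snd (rank_quant ns S \<alpha>) (dom B) \<and>
      (\<exists>x\<in>dom B. [x] \<in> rel_int B P \<and> args @ [binary (segm (brel w B) x)] \<in> snd (rank_quant ns S \<alpha>) (dom B))"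
    then obtain x where x: "x \<in> dom B" "[x] \<in> rel_int B P"
      "S (dom B) args (coll (brel w B) x)" using otype_segm[OF wo] F by (auto simp: rank_quant_iff)
    have Zw: "Well_order Z" "S (dom B) args (otype Z)" using R by (auto simp: rank_quant_iff)
    have "small (Field Z)" by (rule small_subset[OF wo(2)]) (use Z F in \<open>auto simp: Field_def\<close>)
    then have "Ord (otype Z)" using otype_props(1) Zw(1) by blast
    then have "otype Z = coll (brel w B) x"
      using S Zw(2) x(3) Ord_coll[OF wo] unfolding rank_determined_def by blast
    then have "otype Z \<in> \<beta>" using P x by blast
    then show "args @ [binary Z] \<in> snd (rank_quant ns S \<beta>) (dom B)" using R by (simp add: rank_quant_iff)
  next
    assume L: "args @ [binary Z] \<in> snd (rank_quant ns S \<beta>) (dom B)"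
    then have "otype Z \<in> \<beta>" by (simp add: rank_quant_iff)
    then obtain x where x: "x \<in> dom B" "[x] \<in> rel_int B P" "coll (brel w B) x = otype Z"
      using P by force
    then have "args @ [binary (segm (brel w B) x)] \<in> snd (rank_quant ns S \<alpha>) (dom B)"
      using L \<beta> otype_segm[OF wo] F Well_order_segm[OF wo(1)] segm_subset[of "brel w B" x]
      by (auto simp: rank_quant_iff)
    then show "args @ [binary Z] \<in> snd (rank_quant ns S \<alpha>) (dom B) \<and>
      (\<exists>x\<in>dom B. [x] \<in> rel_int B P \<and> args @ [binary (segm (brel w B) x)] \<in> snd (rank_quant ns S \<alpha>) (dom B))"
      using x L \<beta> by (auto simp: rank_quant_iff)
  qed
  finally show "sat ?Qs B a (lower_fm w P bs) \<longleftrightarrow> map (ext ?Qs B a) bs \<in> snd (rank_quant ns S \<beta>) (points w B)"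
    using args W(2) by simp
qed

text \<open>
  If \<open>b < k\<close>, then a name for each element of the initial segment of type \<open>b\<close> may be added to
  the vocabulary, and elementary substructures keep that segment.
\<close>

lemma LST_at_lower:
  fixes k :: "'v::zfc_universe"
  assumes S: "rank_determined S" and k: "LST_at [Hartig, rank_quant ns S \<alpha>] k"
    and b: "b \<in> elts k" "elts b \<subseteq> \<alpha>"
  shows "LST_at [Hartig, rank_quant ns S (elts b)] k"
proof (rule LST_at_transfer[OF k])
  fix L :: "'v vocabulary" and M :: "'v struct"
  assume L: "symbols L \<prec> elts k" and M: "is_structure L M" and kM: "elts k \<lesssim> dom M"
  have ick: "infinite_cardinal k" using k by (simp add: LST_at_def)
  then have ok: "Ord k" and inf: "infinite (elts k)" and vk: "vcard (elts k) = k"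
    by (auto simp: infinite_cardinal_def)
  have ob: "Ord b" using Ord_mem[OF ok b(1)] .
  have smM: "small (dom M)" "dom M \<noteq> {}" using M by (auto simp: is_structure_def small_def)
  then obtain W where W: "topped_wo W" "Field W = dom M" by (rule topped_wo_exists)
  have wo: "Well_order W" "small (Field W)" using W by (auto simp: topped_wo_def)
  \<comment> \<open>tags serve as new symbols: \<open>d < b\<close> names a point, \<open>b\<close> gives \<open>P\<close>, and the successor \<open>s\<close> of \<open>b\<close> gives \<open>w\<close>\<close>
  define s where "s = set_of (insert b (elts b))"
  have s: "elts s = insert b (elts b)" by (simp add: s_def elts_set_of small_insert)
  have snot: "s \<notin> insert b (elts b)"
    using mem_not_refl[of b] mem_not_sym[of b s] s by auto
  let ?t = "tag (rels L)"
  define N where "N = ?t ` insert s (insert b (elts b))"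
  define w where "w = ?t s"
  define P where "P = ?t b"
  have disj: "N \<inter> rels L = {}" using tag_notin[OF small_rels[OF L]] by (auto simp: N_def)
  have wN: "w \<in> N" "P \<in> N" "w \<noteq> P" using snot by (auto simp: N_def w_def P_def)
  have cN: "?t d \<in> N" "?t d \<noteq> w" "?t d \<noteq> P" if "d \<in> elts b" for d
    using that snot mem_not_refl by (auto simp: N_def w_def P_def)
  have "insert s (insert b (elts b)) \<prec> elts k"
    using insert_lesspoll[OF inf infinite_cardinal_limit(2)[OF ick b(1)]] .
  then have Nk: "N \<prec> elts k" unfolding N_def using image_lepoll lesspoll_trans1 by blast
  define ar where "ar = (\<lambda>R. if R = w then 2 else 1 :: nat)"
  define I where "I = (\<lambda>R. if R = w then binary W
      else if R = P then (\<lambda>x. [x]) ` {x \<in> dom M. coll W x \<in> elts b}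
      else (\<lambda>x. [x]) ` {x \<in> dom M. R = ?t (coll W x)})"
  define L' where "L' = add_rels N ar L"
  define M' where "M' = add_ints N I M"
  have wL': "w \<in> rels L'" "rel_arity L' w = 2" "P \<in> rels L'" "rel_arity L' P = 1"
    using wN by (auto simp: L'_def ar_def)
  have "W \<subseteq> dom M \<times> dom M" using W(2) by (auto simp: Field_def)
  then have "binary W \<subseteq> tuples (dom M) 2" using tuples_2 by blast
  then have M': "is_structure L' M'"
    unfolding L'_def M'_def by (intro is_structure_add[OF M disj]) (auto simp: I_def ar_def tuples_def)
  have W': "brel w M' = W" using wN by (auto simp: brel_def M'_def I_def binary_def)
  have "symbols L' \<prec> elts k" unfolding L'_def by (rule symbols_add_lesspoll[OF L Nk inf])
  moreover have "vocab_le L L'" unfolding L'_def by (rule vocab_le_add_rels[OF disj])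
  moreover have "is_substructure L M M'"
    unfolding M'_def by (rule is_substructure_add[OF is_substructure_refl[OF M] disj])
  moreover have "dom M = points w M'"
    using points_eq_Field[of w M'] W W' wo by simp
  moreover have "points w B \<noteq> {} \<and>
      defines_quant L' [Hartig, rank_quant ns S \<alpha>] w (lower_fm w P) (rank_quant ns S (elts b)) B"
    if B: "elementary_substructure L' [Hartig, rank_quant ns S \<alpha>] B M'" for B
  proof -
    note Bs = elementary_structures[OF B]
    have BM: "dom B \<subseteq> dom M" using Bs(3) by (simp add: M'_def)
    have tB: "topped_wo (brel w B)" "Field (brel w B) = dom B" "points w B \<noteq> {}"
      using topped_wo_elementary[OF B M' wL'(1,2)] W W' BM by auto
    have woB: "Well_order (brel w B)" "small (Field (brel w B))" using tB(1) by (auto simp: topped_wo_def)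
    have pB: "points w B = dom B" using points_eq_Field[OF woB(1)] tB(2) by simp
    have WB: "brel w B = Restr W (dom B)" using brel_substructure[OF Bs(1) wL'(1,2)] W' by simp
    have relB: "rel_int B R = rel_int M' R \<inter> tuples (dom B) (rel_arity L' R)" if "R \<in> rels L'" for R
      using Bs(1) that by (auto simp: is_substructure_def)
    \<comment> \<open>the names put the initial segment of type \<open>b\<close> into the substructure\<close>
    have inB: "x \<in> dom B" if x: "x \<in> dom M" "coll W x \<in> elts b" for x
    proof -
      let ?R = "?t (coll W x)"
      have R: "?R \<in> rels L'" "rel_arity L' ?R = 1" using cN[OF x(2)] by (auto simp: L'_def ar_def)
      have RM: "rel_int M' ?R = (\<lambda>y. [y]) ` {y \<in> dom M. coll W x = coll W y}"
        using cN[OF x(2)] by (simp add: M'_def I_def)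
      let ?p = "Exists 0 (Rel ?R [Var 0])"
      obtain e where e: "e \<in> dom B" using Bs(5) by blast
      have "sat [Hartig, rank_quant ns S \<alpha>] M' (\<lambda>_. e) ?p"
        using x RM by (auto simp: sat.simps(2) M'_def)
      then have "sat [Hartig, rank_quant ns S \<alpha>] B (\<lambda>_. e) ?p"
        using elementary_sat[OF B, of ?p "\<lambda>_. e"] e R by auto
      then obtain y where "y \<in> dom B" "[y] \<in> rel_int B ?R" by (auto simp: sat.simps(2))
      then have "y \<in> dom B" "y \<in> dom M" "coll W x = coll W y" using relB[OF R(1)] RM by auto
      then show ?thesis using coll_eq_iff[OF wo] x W(2) by metis
    qed
    have Peq: "{x \<in> dom B. [x] \<in> rel_int B P} = {x \<in> dom M. coll W x \<in> elts b}"
      using relB[OF wL'(3)] wL'(4) wN inB BM by (auto simp: M'_def I_def tuples_def)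
    have "coll (brel w B) x = coll W x" if x: "x \<in> dom M" "coll W x \<in> elts b" for x
    proof -
      have "y \<in> dom B" if y: "y \<in> underS W x" for y
      proof (rule inB)
        show "y \<in> dom M" using underS_in_Field[OF y] W(2) by simp
        have "coll W y \<in> elts (coll W x)" using y by (simp add: elts_coll[OF wo])
        then show "coll W y \<in> elts b" using Ord_trans[OF ob x(2)] by blast
      qed
      then have "underS W x \<subseteq> dom B" by blast
      then have "segm (brel w B) x = segm W x"
        unfolding segm_def WB using inB[OF x] by (auto simp: underS_def)
      then show ?thesis
        using otype_segm[OF woB, of x] otype_segm[OF wo, of x] inB[OF x] x(1) W(2) tB(2) by simp
    qed
    then have "coll (brel w B) ` {x \<in> dom B. [x] \<in> rel_int B P} = coll W ` {x \<in> dom M. coll W x \<in> elts b}"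
      unfolding Peq by (intro image_cong) auto
    also have "\<dots> = elts b"
    proof (intro equalityI subsetI)
      fix d assume d: "d \<in> elts b"
      have "elts k \<subseteq> elts (vcard (dom M))" using vcard_mono[OF smM(1) kM] vk by simp
      moreover have dk: "d \<in> elts k" using Ord_trans[OF ok b(1) d] .
      ultimately have "elts d \<subseteq> elts (vcard (Field W))" using Ord_mem_subset[OF ok dk] W(2) by auto
      moreover have "infinite (Field W)" using kM inf W(2) lepoll_iff finite_surj by metis
      ultimately obtain x where "x \<in> Field W" "coll W x = d"
        using coll_realises[OF W(1) _ Ord_mem[OF ob d]] by blast
      then show "d \<in> coll W ` {x \<in> dom M. coll W x \<in> elts b}" using d W(2) by auto
    qed auto
    finally have P: "coll (brel w B) ` {x \<in> dom B. [x] \<in> rel_int B P} = elts b" .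
    have "elts b \<subseteq> On" using Ord_mem[OF ob] by (auto simp: On_def)
    then show ?thesis
      using defines_lower[OF S b(2) _ tB(1) pB brel_subset_dom[OF Bs(2) wL'(1,2)] P] tB(3) by blast
  qed
  moreover have "form_of L' [Hartig, rank_quant ns S \<alpha>] (lower_fm w P bs)"
    if "quant_args L' [Hartig, rank_quant ns S \<alpha>] (fst (rank_quant ns S (elts b))) bs" for bs
    using form_of_lower_fm[OF wL'] that by (simp add: rank_quant_def)
  ultimately show "definable_expansion [rank_quant ns S \<alpha>] (rank_quant ns S (elts b)) k L M"
    unfolding definable_expansion_def
    using wL'(1,2) M' by (intro exI[of _ L'] exI[of _ M'] exI[of _ w] exI[of _ "lower_fm w P"]) blast
qed

text \<open>
  A class with index at least \<open>b\<close> has an element up to the cardinality of \<open>A\<close> only if the class with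
  index \<open>b\<close> has one (\<open>Reg_at_antimono\<close>).
\<close>

lemma rank_quant_agree:
  fixes b :: "'v::zfc_universe"
  assumes S: "rank_determined S" and b: "Ord b" "elts b \<subseteq> \<alpha>" "\<alpha> \<subseteq> On" and A: "small A"
    and none: "\<And>m. m \<in> Reg_at (elts b) \<Longrightarrow> \<not> elts m \<subseteq> elts (vcard A)"
  shows "snd (rank_quant ns S \<alpha>) A = snd (rank_quant ns S (elts b)) A"
proof -
  have "c \<in> elts b" if c: "c \<in> \<alpha>" "S A args c" for args c
  proof (rule ccontr)
    assume n: "c \<notin> elts b"
    have oc: "Ord c" using c(1) b(3) by (auto simp: On_def)
    then have bc: "elts b \<subseteq> elts c" using n Ord_not_mem[OF oc b(1)] by blast
    obtain m where m: "m \<in> Reg_at (elts c)" "elts m \<subseteq> elts (vcard A)"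
      using S A c(2) unfolding rank_determined_def by blast
    obtain t where "t \<in> Reg_at (elts b)" "elts t \<subseteq> elts m"
      using Reg_at_antimono[OF m(1) oc b(1) bc] by blast
    then show False using none m(2) by blast
  qed
  then show ?thesis using b(2) unfolding rank_quant_def by auto
qed

lemma elementary_agree:
  assumes N: "elementary_substructure L [Hartig, Q] N M"
    and Q: "fst Q' = fst Q" "snd Q' (dom M) = snd Q (dom M)" "snd Q' (dom N) = snd Q (dom N)"
  shows "elementary_substructure L [Hartig, Q'] N M"
proof -
  have "sat [Hartig, Q'] N a p \<longleftrightarrow> sat [Hartig, Q'] M a p" if p: "form_of L [Hartig, Q'] p" "range a \<subseteq> dom N" for a p
  proof -
    have "form_of L [Hartig, Q] p"
      by (rule form_of_mono[OF _ p(1)]) (auto simp: less_Suc_eq Q(1))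
    moreover have "sat [Hartig, Q'] A a p \<longleftrightarrow> sat [Hartig, Q] A a p" if "snd Q' (dom A) = snd Q (dom A)" for A
      by (rule sat_agree[OF _ p(1)]) (auto simp: less_Suc_eq that)
    ultimately show ?thesis using elementary_sat[OF N _ p(2)] Q by simp
  qed
  then show ?thesis using N by (simp add: elementary_substructure_def)
qed

lemma is_substructure_trans:
  assumes "is_substructure L A B" "is_substructure L B C" shows "is_substructure L A C"
proof -
  have "tuples (dom A) n \<subseteq> tuples (dom B) n" for n using assms by (auto simp: is_substructure_def tuples_def)
  then have "rel_int A R = rel_int C R \<inter> tuples (dom A) (rel_arity L R)" if "R \<in> rels L" for R
    using assms that by (auto simp: is_substructure_def)
  moreover have "fun_int A f xs = fun_int C f xs" if "f \<in> funs L" "xs \<in> tuples (dom A) (fun_arity L f)" for f xs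
  proof -
    have "xs \<in> tuples (dom B) (fun_arity L f)" using that(2) \<open>\<And>n. tuples (dom A) n \<subseteq> tuples (dom B) n\<close> by blast
    then show ?thesis using assms that by (simp add: is_substructure_def)
  qed
  ultimately show ?thesis using assms by (auto simp: is_substructure_def)
qed

lemma elementary_trans:
  assumes "elementary_substructure L Qs A B" "elementary_substructure L Qs B C"
  shows "elementary_substructure L Qs A C"
  unfolding elementary_substructure_def
proof (intro conjI allI impI)
  show "is_substructure L A C"
    using assms is_substructure_trans by (auto simp: elementary_substructure_def)
  fix p and a :: "nat \<Rightarrow> 'a" assume p: "form_of L Qs p \<and> range a \<subseteq> dom A"
  then have "range a \<subseteq> dom B" using elementary_structures(3)[OF assms(1)] by blast
  then show "sat Qs A a p \<longleftrightarrow> sat Qs C a p"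
    using elementary_sat[OF assms(1)] elementary_sat[OF assms(2)] p by blast
qed

text \<open>
  The property at \<open>l\<close> yields a substructure of size less than \<open>l\<close>. There the two quantifiers agree,
  so that the property at \<open>k\<close> for the larger bound can be used.
\<close>

lemma LST_at_lower_small:
  fixes k l :: "'v::zfc_universe"
  assumes S: "rank_determined S" and b: "Ord b" "elts b \<subseteq> \<alpha>" "\<alpha> \<subseteq> On"
    and k: "LST_at [Hartig, rank_quant ns S \<alpha>] k"
    and l: "LST_at [Hartig, rank_quant ns S (elts b)] l" "elts k \<subseteq> elts l"
    and min: "\<And>m. m \<in> Reg_at (elts b) \<Longrightarrow> elts l \<subseteq> elts m"
  shows "LST_at [Hartig, rank_quant ns S (elts b)] k"
  unfolding LST_at_def
proof (intro conjI allI impI)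
  show "infinite_cardinal k" using k by (simp add: LST_at_def)
  have icl: "infinite_cardinal l" using l by (simp add: LST_at_def)
  fix L :: "'v vocabulary" and M :: "'v struct" assume LM: "symbols L \<prec> elts k \<and> is_structure L M"
  then have "symbols L \<prec> elts l" using l(2) lesspoll_trans2 subset_imp_lepoll by blast
  then obtain A where A: "elementary_substructure L [Hartig, rank_quant ns S (elts b)] A M" "dom A \<prec> elts l"
    using l(1) LM unfolding LST_at_def by blast
  note As = elementary_structures[OF A(1)]
  obtain N where N: "elementary_substructure L [Hartig, rank_quant ns S \<alpha>] N A" "dom N \<prec> elts k"
    using k LM As(2) unfolding LST_at_def by blast
  note Ns = elementary_structures[OF N(1)]
  have agree: "snd (rank_quant ns S \<alpha>) D = snd (rank_quant ns S (elts b)) D" if D: "D \<subseteq> dom A" for D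
  proof (rule rank_quant_agree[OF S b])
    show sD: "small D" using small_subset[OF As(4) D] .
    have "D \<prec> elts l" using A(2) D lesspoll_trans1 subset_imp_lepoll by blast
    then have "vcard D \<in> elts l" using lesspoll_cardinal_iff[OF icl sD] by blast
    then show "\<not> elts m \<subseteq> elts (vcard D)" if "m \<in> Reg_at (elts b)" for m
      using min[OF that] mem_not_refl by blast
  qed
  have "elementary_substructure L [Hartig, rank_quant ns S (elts b)] N A"
    by (rule elementary_agree[OF N(1)]) (use agree Ns(3) in \<open>auto simp: rank_quant_def\<close>)
  then show "\<exists>N. elementary_substructure L [Hartig, rank_quant ns S (elts b)] N M \<and> dom N \<prec> elts k"
    using elementary_trans A(1) N(2) by blast
qed

lemma LST_at_lower_empty:
  fixes k :: "'v::zfc_universe"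
  assumes S: "rank_determined S" and b: "Ord b" "elts b \<subseteq> \<alpha>" "\<alpha> \<subseteq> On"
    and k: "LST_at [Hartig, rank_quant ns S \<alpha>] k" and empty: "Reg_at (elts b) = {}"
  shows "LST_at [Hartig, rank_quant ns S (elts b)] k"
  unfolding LST_at_def
proof (intro conjI allI impI)
  show "infinite_cardinal k" using k by (simp add: LST_at_def)
  fix L :: "'v vocabulary" and M :: "'v struct" assume LM: "symbols L \<prec> elts k \<and> is_structure L M"
  then obtain N where N: "elementary_substructure L [Hartig, rank_quant ns S \<alpha>] N M" "dom N \<prec> elts k"
    using k unfolding LST_at_def by blast
  note Ns = elementary_structures[OF N(1)]
  have sM: "small (dom M)" using LM by (simp add: is_structure_def small_def)
  have "elementary_substructure L [Hartig, rank_quant ns S (elts b)] N M"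
    by (rule elementary_agree[OF N(1)])
      (use rank_quant_agree[OF S b sM] rank_quant_agree[OF S b Ns(4)] empty in \<open>auto simp: rank_quant_def\<close>)
  then show "\<exists>N. elementary_substructure L [Hartig, rank_quant ns S (elts b)] N M \<and> dom N \<prec> elts k"
    using N(2) by blast
qed

lemma min_or_infty_cases:
  assumes "C \<subseteq> On"
  obtains "C = {}" "min_or_infty C = On"
  | c where "c \<in> C" "Ord c" "min_or_infty C = elts c" "\<And>d. d \<in> C \<Longrightarrow> elts c \<subseteq> elts d"
proof (cases "C = {}")
  case False
  then have "C \<inter> On \<noteq> {}" using assms by blast
  note l = least_Ord_props[OF this]
  show thesis
    by (rule that(2)[OF l(1,2)]) (use False l(3) assms in \<open>auto simp: min_or_infty_def On_def\<close>)
qed (auto simp: min_or_infty_def)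

lemma elts_subset_On: "Ord a \<Longrightarrow> elts a \<subseteq> On"
  using Ord_mem by (auto simp: On_def)

lemma elts_neq_On: "elts a \<noteq> On"
  using not_small_On by (metis small_elts)

theorem LST_rank_quant_lower:
  fixes b :: "'v::zfc_universe"
  assumes S: "rank_determined S" and b: "Ord b" "elts b \<subseteq> \<alpha>" "\<alpha> \<subseteq> On"
  shows "LST [Hartig, rank_quant ns S \<alpha>] \<supseteq> LST [Hartig, rank_quant ns S (elts b)] \<or>
    elts b \<supseteq> LST [Hartig, rank_quant ns S \<alpha>] \<and>
    LST [Hartig, rank_quant ns S (elts b)] \<supset> min_or_infty (Reg_at (elts b))"
proof -
  let ?A = "{k. LST_at [Hartig, rank_quant ns S \<alpha>] k}"
  let ?B = "{k. LST_at [Hartig, rank_quant ns S (elts b)] k}"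
  have AB: "?A \<subseteq> On" "?B \<subseteq> On" by (auto simp: On_def dest: LST_at_Ord)
  have R: "Reg_at (elts b) \<subseteq> On" using Reg_at_Reg RegD(1) by (auto simp: On_def)
  have B_On: "min_or_infty ?B \<subseteq> On"
    by (rule min_or_infty_cases[OF AB(2)]) (auto dest: subsetD[OF elts_subset_On])
  show ?thesis
    unfolding LST_eq
  proof (cases rule: min_or_infty_cases[OF AB(1)])
    case 1
    then show "min_or_infty ?A \<supseteq> min_or_infty ?B \<or>
      elts b \<supseteq> min_or_infty ?A \<and> min_or_infty ?B \<supset> min_or_infty (Reg_at (elts b))" using B_On by simp
  next
    case (2 k)
    have k: "LST_at [Hartig, rank_quant ns S \<alpha>] k" using 2 by simp
    show "min_or_infty ?A \<supseteq> min_or_infty ?B \<or>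
      elts b \<supseteq> min_or_infty ?A \<and> min_or_infty ?B \<supset> min_or_infty (Reg_at (elts b))"
    proof (rule disjCI[THEN iffD1[OF disj_commute]])
      assume n: "\<not> min_or_infty ?B \<subseteq> min_or_infty ?A"
      have nk: "\<not> LST_at [Hartig, rank_quant ns S (elts b)] k"
      proof
        assume "LST_at [Hartig, rank_quant ns S (elts b)] k"
        then have "min_or_infty ?B \<subseteq> min_or_infty {k}" by (intro min_or_infty_mono AB(2)) auto
        also have "min_or_infty {k} = elts k"
          by (rule min_or_infty_cases[of "{k}"]) (use 2 in \<open>auto simp: On_def\<close>)
        finally show False using n 2 by simp
      qed
      have kb: "elts k \<subseteq> elts b"
        using LST_at_lower[OF S k _ b(2)] nk Ord_not_mem[OF b(1) 2(2)] by blast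
      have "min_or_infty ?B \<supset> min_or_infty (Reg_at (elts b))"
      proof (cases rule: min_or_infty_cases[OF R])
        case 1
        then show ?thesis using LST_at_lower_empty[OF S b k] nk by blast
      next
        case (2 r)
        note r = this
        show ?thesis
        proof (cases rule: min_or_infty_cases[OF AB(2)])
          case 1
          show ?thesis unfolding 1(2) r(3) using elts_subset_On[OF r(2)] elts_neq_On[of r] by blast
        next
          case (2 l)
          have l: "LST_at [Hartig, rank_quant ns S (elts b)] l" using 2 by simp
          have kl: "elts k \<subseteq> elts l"
            using n 2 \<open>min_or_infty ?A = elts k\<close> Ord_subset_linear[OF \<open>Ord k\<close> 2(2)] by simp
          have "\<not> elts l \<subseteq> elts r"
          proof
            assume lr: "elts l \<subseteq> elts r"
            have "LST_at [Hartig, rank_quant ns S (elts b)] k"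
              by (rule LST_at_lower_small[OF S b k l kl]) (use r(4) lr in blast)
            then show False using nk by blast
          qed
          then show ?thesis using Ord_subset_linear[OF r(2) 2(2)] r(3) 2(3) by auto
        qed
      qed
      then show "elts b \<supseteq> min_or_infty ?A \<and> min_or_infty ?B \<supset> min_or_infty (Reg_at (elts b))"
        using kb 2 by simp
    qed
  qed
qed

lemma Q_up_eq_rank_quant: "Q_up \<alpha> = rank_quant [2, 2] (\<lambda>A args c. \<exists>X Y. args = [binary X, binary Y] \<and>
    X \<subseteq> A \<times> A \<and> Y \<subseteq> A \<times> A \<and> Linear_order X \<and> Linear_order Y \<and> cofinality X = cofinality Y \<and>
    cofinality X \<in> Reg_at (elts c)) \<alpha>"
  unfolding Q_up_def rank_quant_def prod.inject
proof (intro conjI ext, goal_cases)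
  case (2 A)
  show ?case by (rule set_eqI) (auto; blast)
qed simp

lemma R_up_eq_rank_quant: "R_up \<alpha> = rank_quant [1] (\<lambda>A args c. \<exists>X. args = [unary X] \<and> X \<subseteq> A \<and>
    vcard X \<in> Reg_at (elts c)) \<alpha>"
  unfolding R_up_def rank_quant_def prod.inject
proof (intro conjI ext, goal_cases)
  case (2 A)
  show ?case by (rule set_eqI) (auto; blast)
qed simp

lemma rank_determined_Q_up: "rank_determined (\<lambda>A args c. \<exists>X Y. args = [binary X, binary Y] \<and>
    X \<subseteq> A \<times> A \<and> Y \<subseteq> A \<times> A \<and> Linear_order X \<and> Linear_order Y \<and> cofinality X = cofinality Y \<and>
    cofinality X \<in> Reg_at (elts c))"
  unfolding rank_determined_def
proof (intro conjI allI impI, goal_cases)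
  case (1 A args c d)
  then show ?case using Reg_at_disjoint by auto
next
  case (2 A args c)
  then obtain X where X: "X \<subseteq> A \<times> A" "Linear_order X" "cofinality X \<in> Reg_at (elts c)" by blast
  have F: "Field X \<subseteq> A" using X(1) by (auto simp: Field_def)
  have s: "small A" "small (Field X)" using 2 small_subset[OF _ F] by auto
  have "elts (cofinality X) \<subseteq> elts (vcard A)"
    using cofinality_le_vcard[OF X(2) s(2)] vcard_mono[OF s(1) subset_imp_lepoll[OF F]] by blast
  then show ?case using X(3) by blast
qed

lemma rank_determined_R_up: "rank_determined (\<lambda>A args c. \<exists>X. args = [unary X] \<and> X \<subseteq> A \<and>
    vcard X \<in> Reg_at (elts c))"
  unfolding rank_determined_def
proof (intro conjI allI impI, goal_cases)
  case (1 A args c d)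
  then show ?case using Reg_at_disjoint by auto
next
  case (2 A args c)
  then show ?case using vcard_mono subset_imp_lepoll by blast
qed

section \<open>The hierarchy of regular cardinals along a well-order\<close>

text \<open>
  Along a well-order \<open>W\<close>, the relation \<open>H m g\<close> saying that the order type below \<open>m\<close> belongs to
  the class indexed by the order type below \<open>g\<close> is the unique solution of a recursion that
  mentions only cofinalities of initial segments.
\<close>

definition regular_point :: "'v::zfc_universe rel \<Rightarrow> 'v \<Rightarrow> bool" where
  "regular_point W m \<longleftrightarrow> (\<exists>c. c \<in> underS W m) \<and>
     (\<forall>c\<in>underS W m. \<exists>c'\<in>underS W m. c \<in> underS W c') \<and>
     (\<forall>c\<in>underS W m. cofinality (segm W c) \<noteq> cofinality (segm W m))"

definition left_over :: "'v::zfc_universe rel \<Rightarrow> 'v rel \<Rightarrow> 'v \<Rightarrow> 'v \<Rightarrow> bool" where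
  "left_over W H m g \<longleftrightarrow> regular_point W m \<and> (\<forall>c\<in>underS W g. (m, c) \<notin> H)"

definition hierarchy_rec :: "'v::zfc_universe rel \<Rightarrow> 'v rel \<Rightarrow> bool" where
  "hierarchy_rec W H \<longleftrightarrow> (\<forall>m\<in>Field W. \<forall>g\<in>Field W. (m, g) \<in> H \<longleftrightarrow>
     left_over W H m g \<and> (\<exists>c\<in>underS W m. left_over W H c g) \<and>
     (\<exists>x\<in>underS W m. \<forall>c\<in>underS W m. left_over W H c g \<longrightarrow> (c, x) \<in> W))"

definition hierarchy :: "'v::zfc_universe rel \<Rightarrow> 'v rel \<Rightarrow> bool" where
  "hierarchy W H \<longleftrightarrow> (\<forall>m\<in>Field W. \<forall>g\<in>Field W. (m, g) \<in> H \<longleftrightarrow> coll W m \<in> Reg_at (elts (coll W g)))"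

context
  fixes W :: "'v::zfc_universe rel"
  assumes wo: "Well_order W" "small (Field W)"
begin

lemma regular_point_iff:
  assumes m: "m \<in> Field W" shows "regular_point W m \<longleftrightarrow> coll W m \<in> Reg"
proof -
  have mem: "c \<in> Field W" if "c \<in> underS W m" for c using that by (rule underS_in_Field)
  have 1: "(\<exists>c. c \<in> underS W m) \<longleftrightarrow> elts (coll W m) \<noteq> {}" by (auto simp: elts_coll[OF wo])
  have 2: "(\<forall>c\<in>underS W m. \<exists>c'\<in>underS W m. c \<in> underS W c') \<longleftrightarrow>
      (\<forall>x\<in>elts (coll W m). \<exists>y\<in>elts (coll W m). x \<in> elts y)"
    unfolding elts_coll[OF wo, of m] using coll_mem_iff[OF wo mem mem] by auto
  have 3: "(\<forall>c\<in>underS W m. cofinality (segm W c) \<noteq> cofinality (segm W m)) \<longleftrightarrow>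
      (\<forall>x\<in>elts (coll W m). cofinality (ord_rel x) \<noteq> cofinality (ord_rel (coll W m)))"
    unfolding elts_coll[OF wo, of m] using cofinality_segm[OF wo mem] cofinality_segm[OF wo m] by auto
  show ?thesis unfolding regular_point_def 1 2 3 Reg_iff_limit[OF Ord_coll[OF wo]] ..
qed

lemma left_over_iff:
  assumes H: "\<And>m c. m \<in> Field W \<Longrightarrow> c \<in> underS W g \<Longrightarrow> (m, c) \<in> H \<longleftrightarrow> coll W m \<in> Reg_at (elts (coll W c))"
    and m: "m \<in> Field W"
  shows "left_over W H m g \<longleftrightarrow> coll W m \<in> Reg_from (elts (coll W g))"
  unfolding left_over_def Reg_from_iff elts_coll[OF wo, of g] using regular_point_iff[OF m] H[OF m] by auto

lemma hierarchy_step: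
  assumes H: "\<And>m c. m \<in> Field W \<Longrightarrow> c \<in> underS W g \<Longrightarrow> (m, c) \<in> H \<longleftrightarrow> coll W m \<in> Reg_at (elts (coll W c))"
    and m: "m \<in> Field W"
  shows "left_over W H m g \<and> (\<exists>c\<in>underS W m. left_over W H c g) \<and>
     (\<exists>x\<in>underS W m. \<forall>c\<in>underS W m. left_over W H c g \<longrightarrow> (c, x) \<in> W) \<longleftrightarrow>
     coll W m \<in> Reg_at (elts (coll W g))"
proof -
  let ?C = "Reg_from (elts (coll W g))"
  have mem: "c \<in> Field W" if "c \<in> underS W m" for c using that by (rule underS_in_Field)
  have lo: "left_over W H c g \<longleftrightarrow> coll W c \<in> ?C" if "c \<in> Field W" for c by (rule left_over_iff[OF H that])
  have 1: "(\<exists>c\<in>underS W m. left_over W H c g) \<longleftrightarrow> (\<exists>c\<in>?C. c \<in> elts (coll W m))"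
    unfolding elts_coll[OF wo, of m] using lo mem by auto
  have 2: "(\<forall>c\<in>underS W m. left_over W H c g \<longrightarrow> (c, x) \<in> W) \<longleftrightarrow>
      (\<forall>c\<in>?C. c \<in> elts (coll W m) \<longrightarrow> elts c \<subseteq> elts (coll W x))" if "x \<in> Field W" for x
    unfolding elts_coll[OF wo, of m] using lo mem elts_coll_subset_iff[OF wo mem that] by auto
  have 3: "(\<exists>x\<in>underS W m. \<forall>c\<in>underS W m. left_over W H c g \<longrightarrow> (c, x) \<in> W) \<longleftrightarrow>
      (\<exists>x\<in>elts (coll W m). \<forall>c\<in>?C. c \<in> elts (coll W m) \<longrightarrow> elts c \<subseteq> elts x)"
    unfolding elts_coll[OF wo, of m] using 2[unfolded elts_coll[OF wo, of m]] mem by auto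
  show ?thesis unfolding 1 3 lo[OF m] Reg_at_iff[of "coll W m"] ..
qed

lemma hierarchy_rec_iff: "hierarchy_rec W H \<longleftrightarrow> hierarchy W H"
proof
  assume H: "hierarchy W H"
  show "hierarchy_rec W H"
    unfolding hierarchy_rec_def
  proof (intro ballI)
    fix m g assume mg: "m \<in> Field W" "g \<in> Field W"
    have "(m, c) \<in> H \<longleftrightarrow> coll W m \<in> Reg_at (elts (coll W c))" if "m \<in> Field W" "c \<in> underS W g" for m c
      using H that underS_in_Field unfolding hierarchy_def by metis
    from hierarchy_step[OF this mg(1)]
    show "(m, g) \<in> H \<longleftrightarrow> left_over W H m g \<and> (\<exists>c\<in>underS W m. left_over W H c g) \<and>
       (\<exists>x\<in>underS W m. \<forall>c\<in>underS W m. left_over W H c g \<longrightarrow> (c, x) \<in> W)"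
      using H mg unfolding hierarchy_def by blast
  qed
next
  assume R: "hierarchy_rec W H"
  have "m \<in> Field W \<Longrightarrow> g \<in> Field W \<Longrightarrow> (m, g) \<in> H \<longleftrightarrow> coll W m \<in> Reg_at (elts (coll W g))" for m g
  proof (induction g arbitrary: m rule: wo_inductS[OF wo])
    case (1 g)
    have "(m, c) \<in> H \<longleftrightarrow> coll W m \<in> Reg_at (elts (coll W c))" if "m \<in> Field W" "c \<in> underS W g" for m c
      using 1(1)[OF that(2,1)] underS_in_Field[OF that(2)] by blast
    from hierarchy_step[OF this 1(2)] show ?case
      using R[unfolded hierarchy_rec_def, THEN bspec, OF 1(2), THEN bspec, OF 1(3)] by simp
  qed
  then show "hierarchy W H" unfolding hierarchy_def by blast
qed

end

section \<open>Comparing a well-order with initial segments\<close>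

text \<open>
  Isomorphisms and embeddings appear as relations \<open>F\<close> that are not required to be functional. For
  linear orders \<open>Z\<close> and \<open>W\<close>, preservation and reflection of the order force \<open>F\<close> to be functional and
  injective on the relevant points.
\<close>

definition order_matching :: "'v rel \<Rightarrow> 'v rel \<Rightarrow> 'v rel \<Rightarrow> bool" where
  "order_matching Z F W \<longleftrightarrow> (\<forall>x y x' y'. (x, y) \<in> F \<longrightarrow> (x', y') \<in> F \<longrightarrow> (x, x) \<in> Z \<longrightarrow> (x', x') \<in> Z \<longrightarrow>
     ((x, x') \<in> Z \<longleftrightarrow> (y, y') \<in> W))"

definition segm_isomorphism :: "'v rel \<Rightarrow> 'v rel \<Rightarrow> 'v rel \<Rightarrow> 'v \<Rightarrow> bool" where
  "segm_isomorphism Z F W g \<longleftrightarrow> (\<forall>x. (x, x) \<in> Z \<longrightarrow> (\<exists>y\<in>underS W g. (x, y) \<in> F)) \<and>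
     (\<forall>y\<in>underS W g. \<exists>x. (x, x) \<in> Z \<and> (x, y) \<in> F) \<and> order_matching Z F W"

definition order_embedding :: "'v rel \<Rightarrow> 'v rel \<Rightarrow> 'v rel \<Rightarrow> bool" where
  "order_embedding Z F W \<longleftrightarrow> (\<forall>y. (y, y) \<in> W \<longrightarrow> (\<exists>x. (x, x) \<in> Z \<and> (x, y) \<in> F)) \<and> order_matching Z F W"

definition no_minimum :: "'v rel \<Rightarrow> 'v rel \<Rightarrow> bool" where
  "no_minimum Z S \<longleftrightarrow> (\<exists>x. (x, x) \<in> Z \<and> (x, x) \<in> S) \<and>
     (\<forall>x. (x, x) \<in> Z \<longrightarrow> (x, x) \<in> S \<longrightarrow> (\<exists>y. (y, x) \<in> Z \<and> y \<noteq> x \<and> (y, y) \<in> S))"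

lemma refl_Field: "Linear_order r \<Longrightarrow> x \<in> Field r \<longleftrightarrow> (x, x) \<in> r"
  by (auto simp: order_on_defs refl_on_def Field_def)

lemma segm_isomorphism_otype:
  assumes wo: "Well_order W" "small (Field W)" and g: "g \<in> Field W" and Z: "Linear_order Z" "small (Field Z)"
    and F: "segm_isomorphism Z F W g"
  shows "Well_order Z" "otype Z = coll W g"
proof -
  obtain h where h: "\<And>y. y \<in> underS W g \<Longrightarrow> (h y, h y) \<in> Z \<and> (h y, y) \<in> F"
    using F unfolding segm_isomorphism_def by metis
  have ord: "(x, x') \<in> Z \<longleftrightarrow> (y, y') \<in> W"
    if "(x, y) \<in> F" "(x', y') \<in> F" "(x, x) \<in> Z" "(x', x') \<in> Z" for x y x' y'
    using F that unfolding segm_isomorphism_def order_matching_def by blast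
  have asym: "antisym Z" "antisym W" and rW: "Refl W" using Z wo by (auto simp: order_on_defs)
  have inj: "inj_on h (Field (segm W g))"
  proof (rule inj_onI)
    fix y y' assume y: "y \<in> Field (segm W g)" "y' \<in> Field (segm W g)" "h y = h y'"
    then have "y \<in> underS W g" "y' \<in> underS W g" using Field_segm[OF wo(1)] by auto
    then have "(y, y') \<in> W" "(y', y) \<in> W" using h ord y(3) by metis+
    then show "y = y'" using asym(2) by (simp add: antisym_def)
  qed
  have onto: "\<exists>y\<in>underS W g. x = h y" if x: "(x, x) \<in> Z" for x
  proof -
    obtain y where y: "y \<in> underS W g" "(x, y) \<in> F" using F x unfolding segm_isomorphism_def by blast
    then have "(y, y) \<in> W" using underS_in_Field[OF y(1)] rW by (auto simp: refl_on_def)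
    then have "(x, h y) \<in> Z" "(h y, x) \<in> Z" using ord h y x by metis+
    then show ?thesis using asym(1) y(1) by (auto simp: antisym_def)
  qed
  have "Z = dir_image (segm W g) h"
  proof (intro set_eqI iffI)
    fix p assume p: "p \<in> Z"
    obtain x x' where xx: "p = (x, x')" by (cases p)
    then have "(x, x) \<in> Z" "(x', x') \<in> Z" using p refl_Field[OF Z(1)] by (auto simp: Field_def)
    then obtain y y' where y: "y \<in> underS W g" "y' \<in> underS W g" "x = h y" "x' = h y'" using onto by metis
    then have "(y, y') \<in> W" using p xx ord h by metis
    then show "p \<in> dir_image (segm W g) h" using y xx by (auto simp: dir_image_def segm_def)
  next
    fix p assume "p \<in> dir_image (segm W g) h"
    then obtain y y' where "p = (h y, h y')" "(y, y') \<in> W" "y \<in> underS W g" "y' \<in> underS W g"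
      by (auto simp: dir_image_def segm_def)
    then show "p \<in> Z" using ord h by metis
  qed
  then show wZ: "Well_order Z" "otype Z = coll W g"
  proof -
    assume eq: "Z = dir_image (segm W g) h"
    show w: "Well_order Z" unfolding eq by (rule Well_order_dir_image[OF Well_order_segm[OF wo(1)] inj])
    have "(segm W g, Z) \<in> ordIso" unfolding eq by (rule dir_image_ordIso[OF Well_order_segm[OF wo(1)] inj])
    then have "otype (segm W g) = otype Z"
      using otype_ordIso_iff[OF Well_order_segm[OF wo(1)] small_segm[OF wo] w Z(2)] by blast
    then show "otype Z = coll W g" using otype_segm[OF wo g] by simp
  qed
qed

text \<open>
  The comparability of well-orders, in a form in which each case asserts the existence of a
  binary relation. A set without a minimum is represented by a part of the diagonal.
\<close>

lemma linear_order_trichotomy: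
  assumes W: "Well_order W" and Z: "Linear_order Z"
  shows "(\<exists>S. S \<subseteq> Id \<inter> Z \<and> no_minimum Z S) \<or>
    (\<exists>g\<in>Field W. \<exists>F. F \<subseteq> Field Z \<times> Field W \<and> segm_isomorphism Z F W g) \<or>
    (\<exists>F. F \<subseteq> Field Z \<times> Field W \<and> order_embedding Z F W)"
proof (cases "wf (Z - Id)")
  case False
  then have "\<exists>Q x. x \<in> Q \<and> (\<forall>z\<in>Q. \<exists>y. (y, z) \<in> Z - Id \<and> y \<in> Q)"
    unfolding wf_eq_minimal by meson
  then obtain Q x where Q: "x \<in> Q" "\<And>z. z \<in> Q \<Longrightarrow> \<exists>y. (y, z) \<in> Z - Id \<and> y \<in> Q"
    by auto
  define S where "S = {(x, x) | x. x \<in> Q \<and> (x, x) \<in> Z}"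
  have "no_minimum Z S"
    unfolding no_minimum_def
  proof (intro conjI allI impI)
    obtain y where "(y, x) \<in> Z" "y \<in> Q" using Q by blast
    then show "\<exists>x. (x, x) \<in> Z \<and> (x, x) \<in> S" using refl_Field[OF Z, of y] by (auto simp: S_def Field_def)
    fix z assume "(z, z) \<in> Z" "(z, z) \<in> S"
    then obtain y where y: "(y, z) \<in> Z" "y \<noteq> z" "y \<in> Q" using Q(2)[of z] by (auto simp: S_def)
    then have "(y, y) \<in> Z" using refl_Field[OF Z, of y] by (auto simp: Field_def)
    then show "\<exists>y. (y, z) \<in> Z \<and> y \<noteq> z \<and> (y, y) \<in> S" using y by (auto simp: S_def)
  qed
  moreover have "S \<subseteq> Id \<inter> Z" by (auto simp: S_def)
  ultimately show ?thesis by blast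
next
  case True
  then have wZ: "Well_order Z" using Z by (simp add: well_order_on_def)
  have rZ: "x \<in> Field Z \<longleftrightarrow> (x, x) \<in> Z" for x by (rule refl_Field[OF Z])
  have lW: "Linear_order W" using W by (simp add: well_order_on_def)
  show ?thesis
  proof (cases "(Z, W) \<in> ordLess")
    case True
    then obtain g where g: "g \<in> Field W" "(Z, segm W g) \<in> ordIso"
      using ordLess_iff_ordIso_Restr[OF W wZ] unfolding segm_def by blast
    then obtain f where f: "iso Z (segm W g) f" by (auto simp: ordIso_def)
    have im: "f ` Field Z = underS W g" using f Field_segm[OF W] by (auto simp: iso_iff2 bij_betw_def)
    have ord: "(x, y) \<in> Z \<longleftrightarrow> (f x, f y) \<in> W" if "x \<in> Field Z" "y \<in> Field Z" for x y
      using f that im by (auto simp: iso_iff2 segm_def)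
    define F where "F = {(x, f x) | x. x \<in> Field Z}"
    have "segm_isomorphism Z F W g"
      unfolding segm_isomorphism_def order_matching_def
    proof (intro conjI allI impI ballI)
      show "\<exists>y\<in>underS W g. (x, y) \<in> F" if "(x, x) \<in> Z" for x
        using that im rZ by (auto simp: F_def)
      show "\<exists>x. (x, x) \<in> Z \<and> (x, y) \<in> F" if "y \<in> underS W g" for y
        using that im[symmetric] rZ by (auto simp: F_def)
    qed (use ord in \<open>auto simp: F_def\<close>)
    moreover have "F \<subseteq> Field Z \<times> Field W" using im underS_subset_Field by (fastforce simp: F_def)
    ultimately show ?thesis using g(1) by blast
  next
    case False
    then have "(W, Z) \<in> ordLeq" using not_ordLess_iff_ordLeq[OF W wZ] by blast
    then obtain f where f: "embed W Z f" by (auto simp: ordLeq_def)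
    have sub: "f ` Field W \<subseteq> Field Z" using embed_Field[OF f] .
    have inj: "inj_on f (Field W)" using embed_inj_on[OF W f] .
    have comp: "(y, y') \<in> W \<Longrightarrow> (f y, f y') \<in> Z" for y y'
      using embed_compat[OF f] by (auto simp: compat_def)
    have ord: "(f y, f y') \<in> Z \<longleftrightarrow> (y, y') \<in> W" if y: "y \<in> Field W" "y' \<in> Field W" for y y'
    proof
      assume l: "(f y, f y') \<in> Z"
      show "(y, y') \<in> W"
      proof (rule ccontr)
        assume n: "(y, y') \<notin> W"
        have "y \<noteq> y'" using n refl_Field[OF lW] y(1) by blast
        moreover have "Total W" using lW by (simp add: order_on_defs)
        ultimately have "(y', y) \<in> W" "y \<noteq> y'" using n y unfolding total_on_def by blast+
        then have "f y = f y'" using comp[of y' y] l Z by (auto simp: order_on_defs antisym_def)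
        then show False using inj y \<open>y \<noteq> y'\<close> by (auto simp: inj_on_def)
      qed
    qed (rule comp)
    define F where "F = {(f y, y) | y. y \<in> Field W}"
    have "order_embedding Z F W"
      unfolding order_embedding_def order_matching_def
    proof (intro conjI allI impI)
      show "\<exists>x. (x, x) \<in> Z \<and> (x, y) \<in> F" if "(y, y) \<in> W" for y
      proof -
        have "y \<in> Field W" using that by (auto simp: Field_def)
        then show ?thesis using sub rZ by (auto simp: F_def)
      qed
    qed (use ord in \<open>auto simp: F_def\<close>)
    moreover have "F \<subseteq> Field Z \<times> Field W" using sub by (auto simp: F_def)
    ultimately show ?thesis by blast
  qed
qed

text \<open>
  The last case does not occur if \<open>Z\<close> indexes a class with an element \<open>m\<close> of size at most the
  field of \<open>W\<close>: then \<open>otype Z \<le> m\<close>, and \<open>m\<close> is the order type of a proper initial segment.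
\<close>

lemma not_order_embedding:
  assumes W: "topped_wo W" and Z: "Well_order Z" "small (Field Z)"
    and m: "m \<in> Reg_at (elts (otype Z))" "elts m \<subseteq> elts (vcard (Field W))"
  shows "\<not> order_embedding Z F W"
proof
  assume F: "order_embedding Z F W"
  have wo: "Well_order W" "small (Field W)" using W by (auto simp: topped_wo_def)
  have lW: "Linear_order W" using wo by (simp add: well_order_on_def)
  have lZ: "Linear_order Z" using Z by (simp add: well_order_on_def)
  obtain h where h: "\<And>y. y \<in> Field W \<Longrightarrow> (h y, h y) \<in> Z \<and> (h y, y) \<in> F"
    using F refl_Field[OF lW] unfolding order_embedding_def by metis
  have ord: "(h y, h y') \<in> Z \<longleftrightarrow> (y, y') \<in> W" if "y \<in> Field W" "y' \<in> Field W" for y y'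
    using F h that unfolding order_embedding_def order_matching_def by blast
  have hF: "h y \<in> Field Z" if "y \<in> Field W" for y using h[OF that] refl_Field[OF lZ] by blast
  have strict: "h y \<in> underS Z (h y')" if y: "y \<in> underS W y'" "y' \<in> Field W" for y y'
  proof -
    have yF: "y \<in> Field W" using underS_in_Field[OF y(1)] .
    have yy: "(y, y') \<in> W" "y \<noteq> y'" using y(1) by (auto simp: underS_def)
    have "(y', y) \<notin> W" using yy lW by (auto simp: order_on_defs antisym_def)
    then have "(h y, h y') \<in> Z" "(h y', h y) \<notin> Z" using ord yF y(2) yy by auto
    then show ?thesis by (auto simp: underS_def)
  qed
  have le: "elts (coll W y) \<subseteq> elts (coll Z (h y))" if "y \<in> Field W" for y
    using that
  proof (induction y rule: wo_inductS[OF wo])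
    case (1 y)
    show ?case
    proof
      fix z assume "z \<in> elts (coll W y)"
      then obtain x where x: "x \<in> underS W y" "z = coll W x" by (auto simp: elts_coll[OF wo])
      have xF: "x \<in> Field W" using underS_in_Field[OF x(1)] .
      have "coll Z (h x) \<in> elts (coll Z (h y))"
        using strict[OF x(1) 1(2)] by (simp add: elts_coll[OF Z])
      moreover have "z \<in> elts (coll Z (h x)) \<or> z = coll Z (h x)"
        using 1(1)[OF x(1) xF] x(2) Ord_subset_iff[OF Ord_coll[OF wo] Ord_coll[OF Z]] by blast
      ultimately show "z \<in> elts (coll Z (h y))" using Ord_trans[OF Ord_coll[OF Z]] by blast
    qed
  qed
  have mR: "m \<in> Reg" using Reg_at_Reg m(1) by blast
  have "infinite (elts (vcard (Field W)))" using RegD(2)[OF mR] m(2) finite_subset by blast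
  then have "infinite (Field W)" using vcard_props(2)[OF wo(2)] eqpoll_finite_iff by blast
  then obtain l where l: "l \<in> Field W" "coll W l = m"
    using coll_realises[OF W _ RegD(1)[OF mR] m(2)] by blast
  have "coll Z (h l) \<in> elts (otype Z)" using hF[OF l(1)] otype_props(3)[OF Z] by blast
  moreover have "elts (otype Z) \<subseteq> elts m" using Reg_at_index_le[OF m(1) otype_props(1)[OF Z]] .
  ultimately have "coll Z (h l) \<in> elts (coll Z (h l))" using le[OF l(1)] l(2) by blast
  then show False using mem_not_refl by blast
qed

section \<open>Extensions by codes for binary relations\<close>

text \<open>
  The points of \<open>w\<close> form the original domain; further elements code binary relations between
  points by means of a ternary symbol.
\<close>

definition coded :: "'v \<Rightarrow> 'v \<Rightarrow> 'v struct \<Rightarrow> 'v \<Rightarrow> 'v rel" where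
  "coded w e M r = {(x, y). x \<in> points w M \<and> y \<in> points w M \<and> [r, x, y] \<in> rel_int M e}"

definition coded_fm :: "'v \<Rightarrow> 'v \<Rightarrow> nat \<Rightarrow> nat \<Rightarrow> nat \<Rightarrow> 'v form" where
  "coded_fm w e r x y = Conj (at2 w x x) (Conj (at2 w y y) (Rel e [Var r, Var x, Var y]))"

lemma sat_coded_fm [simp]: "sat Qs M a (coded_fm w e r x y) \<longleftrightarrow> (a x, a y) \<in> coded w e M (a r)"
  by (auto simp: coded_fm_def coded_def points_def brel_def sat.simps(2))

lemma form_of_coded_fm [simp]:
  "form_of L Qs (coded_fm w e r x y) \<longleftrightarrow> w \<in> rels L \<and> rel_arity L w = 2 \<and> e \<in> rels L \<and> rel_arity L e = 3"
  by (auto simp: coded_fm_def)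

lemma relation_eq_on:
  assumes "R \<subseteq> D \<times> D" "S \<subseteq> D \<times> D"
  shows "(\<forall>x\<in>D. \<forall>y\<in>D. (x, y) \<in> R \<longleftrightarrow> (x, y) \<in> S) \<longleftrightarrow> R = S"
proof
  assume eq: "\<forall>x\<in>D. \<forall>y\<in>D. (x, y) \<in> R \<longleftrightarrow> (x, y) \<in> S"
  show "R = S"
    by (intro equalityI subrelI) (use eq assms in blast)+
qed simp

lemma fst_quantifiers [simp]:
  "fst Hartig = [1, 1]" "fst Q_ec = [2, 2]" "fst (Q_up \<alpha>) = [2, 2, 2]"
  by (simp_all add: Hartig_def Q_ec_def Q_up_def)

text \<open>
  The numbering of variables avoids capture: in \<open>regular_fm\<close> and \<open>left_over_fm\<close> the bound variables
  start at \<open>c\<close>, in the formulas about codes they follow the variable \<open>f\<close> or \<open>s\<close> of the second code,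
  and these formulas are used with smaller numbers for the other arguments.
\<close>

definition regular_fm :: "'v \<Rightarrow> nat \<Rightarrow> nat \<Rightarrow> 'v form" where
  "regular_fm w m c = Conj (Exists c (below_fm w c m))
    (Conj (All c (Imp (below_fm w c m) (Exists (Suc c) (Conj (below_fm w (Suc c) m) (below_fm w c (Suc c))))))
      (All c (Imp (below_fm w c m) (Neg (Quant 1 [seg w c, seg w m])))))"

definition left_over_fm :: "'v \<Rightarrow> 'v \<Rightarrow> nat \<Rightarrow> nat \<Rightarrow> nat \<Rightarrow> 'v form" where
  "left_over_fm w h m g c = Conj (regular_fm w m c) (All c (Imp (below_fm w c g) (Neg (at2 h m c))))"

definition hierarchy_fm :: "'v \<Rightarrow> 'v \<Rightarrow> 'v form" where
  "hierarchy_fm w h = All 0 (Imp (at2 w 0 0) (All 1 (Imp (at2 w 1 1) (Iff (at2 h 0 1)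
     (Conj (left_over_fm w h 0 1 2) (Conj
       (Exists 2 (Conj (below_fm w 2 0) (left_over_fm w h 2 1 3)))
       (Exists 3 (Conj (below_fm w 3 0)
         (All 2 (Imp (Conj (below_fm w 2 0) (left_over_fm w h 2 1 4)) (at2 w 2 3)))))))))))"

definition matching_fm :: "'v \<Rightarrow> 'v \<Rightarrow> nat \<Rightarrow> nat \<Rightarrow> 'v form" where
  "matching_fm w e r f = (let x = f + 1; y = f + 2; x' = f + 3; y' = f + 4 in
     All x (All y (All x' (All y'
       (Imp (Conj (Conj (coded_fm w e f x y) (coded_fm w e f x' y')) (Conj (coded_fm w e r x x) (coded_fm w e r x' x')))
         (Iff (coded_fm w e r x x') (at2 w y y')))))))"

definition isomorphism_fm :: "'v \<Rightarrow> 'v \<Rightarrow> nat \<Rightarrow> nat \<Rightarrow> nat \<Rightarrow> 'v form" where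
  "isomorphism_fm w e r f g = (let x = f + 1; y = f + 2 in
     Conj (All x (Imp (coded_fm w e r x x) (Exists y (Conj (below_fm w y g) (coded_fm w e f x y)))))
       (Conj (All y (Imp (below_fm w y g) (Exists x (Conj (coded_fm w e r x x) (coded_fm w e f x y)))))
         (matching_fm w e r f)))"

definition embedding_fm :: "'v \<Rightarrow> 'v \<Rightarrow> nat \<Rightarrow> nat \<Rightarrow> 'v form" where
  "embedding_fm w e r f = (let x = f + 1; y = f + 2 in
     Conj (All y (Imp (at2 w y y) (Exists x (Conj (coded_fm w e r x x) (coded_fm w e f x y)))))
       (matching_fm w e r f))"

definition no_minimum_fm :: "'v \<Rightarrow> 'v \<Rightarrow> nat \<Rightarrow> nat \<Rightarrow> 'v form" where
  "no_minimum_fm w e r s = (let x = s + 1; y = s + 2 in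
     Conj (Exists x (Conj (coded_fm w e r x x) (coded_fm w e s x x)))
       (All x (Imp (Conj (coded_fm w e r x x) (coded_fm w e s x x))
         (Exists y (Conj (Conj (coded_fm w e r y x) (Neg (Equal (Var y) (Var x)))) (coded_fm w e s y y))))))"

definition trichotomy_fm :: "'v \<Rightarrow> 'v \<Rightarrow> 'v form" where
  "trichotomy_fm w e = All 0 (Imp (Quant 1 [([1, 2], coded_fm w e 0 1 2), ([1, 2], coded_fm w e 0 1 2)])
     (Disj (Exists 2 (no_minimum_fm w e 0 2))
       (Disj (Exists 1 (Conj (at2 w 1 1) (Exists 2 (isomorphism_fm w e 0 2 1))))
         (Exists 2 (embedding_fm w e 0 2)))))"

definition comprehension_fm :: "'v \<Rightarrow> 'v \<Rightarrow> nat list \<times> 'v form \<Rightarrow> 'v form" where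
  "comprehension_fm w e d = (let n = fresh [d] in
     Exists n (All (n + 1) (All (n + 2) (Iff (coded_fm w e n (n + 1) (n + 2))
       (Conj (Conj (at2 w (n + 1) (n + 1)) (at2 w (n + 2) (n + 2))) (app d (n + 1) (n + 2)))))))"

definition Q_up_On_fm :: "'v \<Rightarrow> 'v \<Rightarrow> 'v \<Rightarrow> (nat list \<times> 'v form) list \<Rightarrow> 'v form" where
  "Q_up_On_fm w e h bs = (let m = fresh bs; g = m + 1; r = m + 2; f = m + 3; x = m + 4; y = m + 5 in
     Conj (Conj (Quant 1 [bs ! 0, bs ! 1]) (Quant 1 [bs ! 2, bs ! 2]))
       (Exists m (Conj (at2 w m m) (Conj (Quant 1 [bs ! 0, seg w m])
         (Exists g (Conj (at2 w g g) (Conj (at2 h m g)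
           (Exists r (Conj (All x (All y (Iff (coded_fm w e r x y) (app (bs ! 2) x y))))
             (Exists f (isomorphism_fm w e r f g)))))))))))"

abbreviation (input) "Qs_ec \<equiv> [Hartig, Q_ec]"

context
  fixes M :: "'v::zfc_universe struct" and w :: 'v
  assumes W: "topped_wo (brel w M)" and sub: "brel w M \<subseteq> dom M \<times> dom M"
begin

lemma brel_wo: "Well_order (brel w M)" "small (Field (brel w M))"
  using W by (auto simp: topped_wo_def)

lemma points_Field: "x \<in> Field (brel w M) \<longleftrightarrow> (x, x) \<in> brel w M"
  using points_eq_Field[OF brel_wo(1)] by (auto simp: points_def)

lemma points_dom: "points w M \<subseteq> dom M"
  using sub by (auto simp: points_def)

lemma underS_dom: "x \<in> underS (brel w M) y \<Longrightarrow> x \<in> dom M"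
  using sub by (auto simp: underS_def)

lemma coded_sub: "(x, y) \<in> coded w e M r \<Longrightarrow> x \<in> dom M \<and> y \<in> dom M \<and> x \<in> points w M \<and> y \<in> points w M"
  using points_dom by (auto simp: coded_def)

lemma Q_ec_mem: "X \<subseteq> dom M \<times> dom M \<Longrightarrow> Y \<subseteq> dom M \<times> dom M \<Longrightarrow>
    [binary X, binary Y] \<in> snd Q_ec (dom M) \<longleftrightarrow> Linear_order X \<and> Linear_order Y \<and> cofinality X = cofinality Y"
  by (simp add: Q_ec_iff)

lemma segm_sub: "segm (brel w M) m \<subseteq> dom M \<times> dom M"
  using sub by (auto simp: segm_def)

lemma sat_regular_fm:
  assumes "m < c" shows "sat Qs_ec M a (regular_fm w m c) \<longleftrightarrow> regular_point (brel w M) (a m)"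
  unfolding regular_fm_def regular_point_def
  using assms underS_dom
  by (simp add: sat_Quant ext_seg[OF brel_wo(1) sub] Q_ec_mem segm_sub Linear_order_segm[OF brel_wo(1)]) blast

lemma sat_left_over_fm:
  assumes "m < c" "g < c"
  shows "sat Qs_ec M a (left_over_fm w h m g c) \<longleftrightarrow> left_over (brel w M) (brel h M) (a m) (a g)"
  unfolding left_over_fm_def left_over_def
  using assms underS_dom by (simp add: sat_regular_fm) blast

lemma sat_hierarchy_fm: "sat Qs_ec M a (hierarchy_fm w h) \<longleftrightarrow> hierarchy_rec (brel w M) (brel h M)"
proof -
  let ?W = "brel w M"
  have F: "x \<in> Field ?W \<longleftrightarrow> x \<in> dom M \<and> (x, x) \<in> ?W" for x using points_Field sub by auto
  have bnd: "(\<exists>c\<in>dom M. c \<in> underS ?W l \<and> P c) \<longleftrightarrow> (\<exists>c\<in>underS ?W l. P c)"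
    "(\<forall>c\<in>dom M. c \<in> underS ?W l \<longrightarrow> P c) \<longleftrightarrow> (\<forall>c\<in>underS ?W l. P c)" for l P using underS_dom by blast+
  have pts: "(\<forall>c\<in>dom M. (c, c) \<in> ?W \<longrightarrow> P c) \<longleftrightarrow> (\<forall>c\<in>Field ?W. P c)" for P using F by blast
  show ?thesis
    unfolding hierarchy_fm_def hierarchy_rec_def
    by (simp add: sat_left_over_fm bnd pts imp_conjL)
qed

lemma sat_matching_fm:
  assumes "r < f"
  shows "sat Qs_ec M a (matching_fm w e r f) \<longleftrightarrow> order_matching (coded w e M (a r)) (coded w e M (a f)) (brel w M)"
  unfolding matching_fm_def order_matching_def Let_def
  using assms coded_sub by (simp add: imp_conjL) blast

lemma sat_isomorphism_fm:
  assumes "r < f" "g < f"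
  shows "sat Qs_ec M a (isomorphism_fm w e r f g) \<longleftrightarrow>
    segm_isomorphism (coded w e M (a r)) (coded w e M (a f)) (brel w M) (a g)"
proof -
  let ?Z = "coded w e M (a r)" and ?W = "brel w M"
  have bnd: "(\<exists>c\<in>dom M. c \<in> underS ?W l \<and> P c) \<longleftrightarrow> (\<exists>c\<in>underS ?W l. P c)"
    "(\<forall>c\<in>dom M. c \<in> underS ?W l \<longrightarrow> P c) \<longleftrightarrow> (\<forall>c\<in>underS ?W l. P c)" for l P using underS_dom by blast+
  have cd: "(\<exists>c\<in>dom M. (c, c) \<in> ?Z \<and> P c) \<longleftrightarrow> (\<exists>c. (c, c) \<in> ?Z \<and> P c)"
    "(\<forall>c\<in>dom M. (c, c) \<in> ?Z \<longrightarrow> P c) \<longleftrightarrow> (\<forall>c. (c, c) \<in> ?Z \<longrightarrow> P c)" for P using coded_sub by blast+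
  show ?thesis
    unfolding isomorphism_fm_def segm_isomorphism_def Let_def
    using assms by (simp add: sat_matching_fm bnd cd)
qed

lemma sat_embedding_fm:
  assumes "r < f"
  shows "sat Qs_ec M a (embedding_fm w e r f) \<longleftrightarrow>
    order_embedding (coded w e M (a r)) (coded w e M (a f)) (brel w M)"
proof -
  let ?Z = "coded w e M (a r)" and ?W = "brel w M"
  have cd: "(\<exists>c\<in>dom M. (c, c) \<in> ?Z \<and> P c) \<longleftrightarrow> (\<exists>c. (c, c) \<in> ?Z \<and> P c)"
    "(\<forall>c\<in>dom M. (c, c) \<in> ?W \<longrightarrow> P c) \<longleftrightarrow> (\<forall>c. (c, c) \<in> ?W \<longrightarrow> P c)" for P using coded_sub sub by blast+
  show ?thesis
    unfolding embedding_fm_def order_embedding_def Let_def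
    using assms by (simp add: sat_matching_fm cd)
qed

lemma sat_no_minimum_fm:
  assumes "r < s"
  shows "sat Qs_ec M a (no_minimum_fm w e r s) \<longleftrightarrow> no_minimum (coded w e M (a r)) (coded w e M (a s))"
  unfolding no_minimum_fm_def no_minimum_def Let_def
  using assms coded_sub by (simp add: imp_conjL) blast

lemma sat_trichotomy_fm:
  "sat Qs_ec M a (trichotomy_fm w e) \<longleftrightarrow> (\<forall>r\<in>dom M. Linear_order (coded w e M r) \<longrightarrow>
     (\<exists>s\<in>dom M. no_minimum (coded w e M r) (coded w e M s)) \<or>
     (\<exists>g\<in>Field (brel w M). \<exists>f\<in>dom M. segm_isomorphism (coded w e M r) (coded w e M f) (brel w M) g) \<or>
     (\<exists>f\<in>dom M. order_embedding (coded w e M r) (coded w e M f) (brel w M)))"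
proof -
  have pts: "(\<exists>c\<in>dom M. (c, c) \<in> brel w M \<and> P c) \<longleftrightarrow> (\<exists>c\<in>Field (brel w M). P c)" for P
    using points_Field sub by blast
  have "{(x, y). x \<in> dom M \<and> y \<in> dom M \<and> (x, y) \<in> coded w e M r} = coded w e M r" for r
    using coded_sub by auto
  moreover have "coded w e M r \<subseteq> dom M \<times> dom M" for r using coded_sub by auto
  ultimately show ?thesis
    unfolding trichotomy_fm_def
    by (simp add: sat_Quant ext_pair Q_ec_mem sat_no_minimum_fm sat_isomorphism_fm sat_embedding_fm pts)
qed

lemma sat_comprehension_fm:
  assumes d: "length (fst d) = 2" "distinct (fst d)" and a: "range a \<subseteq> dom M"
    and X: "ext Qs_ec M a d = binary X"
  shows "sat Qs_ec M a (comprehension_fm w e d) \<longleftrightarrow>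
    (\<exists>r\<in>dom M. coded w e M r = X \<inter> (points w M \<times> points w M))"
proof -
  define n where "n = fresh [d]"
  have ap: "sat Qs_ec M b (app d x y) \<longleftrightarrow> (b x, b y) \<in> X"
    if "x \<ge> n" "y \<ge> n" "\<And>i. i < n \<Longrightarrow> b i = a i" "b x \<in> dom M" "b y \<in> dom M" for b x y
    using app_fresh[of d "[d]" x y b a Qs_ec M X] that d X by (auto simp: n_def)
  have "(\<forall>x\<in>dom M. \<forall>y\<in>dom M. (x, y) \<in> coded w e M r \<longleftrightarrow> ((x, x) \<in> brel w M \<and> (y, y) \<in> brel w M) \<and> (x, y) \<in> X)
      \<longleftrightarrow> coded w e M r = X \<inter> (points w M \<times> points w M)" for r
    using coded_sub points_dom by (auto simp: points_def) blast+
  then show ?thesis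
    unfolding comprehension_fm_def Let_def n_def[symmetric] by (simp add: ap)
qed

lemma sat_Q_up_On_fm:
  assumes bs: "bs = [d1, d2, d3]" "length (fst d3) = 2" "distinct (fst d3)"
    and X: "ext Qs_ec M a d1 = binary X" "X \<subseteq> points w M \<times> points w M"
    and Y: "ext Qs_ec M a d2 = binary Y" "Y \<subseteq> points w M \<times> points w M"
    and Z: "ext Qs_ec M a d3 = binary Z" "Z \<subseteq> points w M \<times> points w M"
  shows "sat Qs_ec M a (Q_up_On_fm w e h bs) \<longleftrightarrow>
    Linear_order X \<and> Linear_order Y \<and> cofinality X = cofinality Y \<and> Linear_order Z \<and>
    (\<exists>m\<in>Field (brel w M). cofinality X = cofinality (segm (brel w M) m) \<and>
      (\<exists>g\<in>Field (brel w M). (m, g) \<in> brel h M \<and>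
        (\<exists>r\<in>dom M. coded w e M r = Z \<and>
          (\<exists>f\<in>dom M. segm_isomorphism Z (coded w e M f) (brel w M) g))))"
proof -
  define n where "n = fresh bs"
  have sub': "X \<subseteq> dom M \<times> dom M" "Y \<subseteq> dom M \<times> dom M" "Z \<subseteq> dom M \<times> dom M"
    using X Y Z points_dom by blast+
  have fr: "ext Qs_ec M b d1 = binary X" "ext Qs_ec M b d2 = binary Y" "ext Qs_ec M b d3 = binary Z"
    if "\<And>i. i < n \<Longrightarrow> b i = a i" for b
    using ext_fresh[of d1 bs b a] ext_fresh[of d2 bs b a] ext_fresh[of d3 bs b a] that bs X Y Z
    by (auto simp: n_def)
  have ap: "sat Qs_ec M b (app d3 x y) \<longleftrightarrow> (b x, b y) \<in> Z"
    if "x \<ge> n" "y \<ge> n" "\<And>i. i < n \<Longrightarrow> b i = a i" "b x \<in> dom M" "b y \<in> dom M" for b x y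
    using app_fresh[of d3 bs x y b a Qs_ec M Z] that bs Z by (auto simp: n_def)
  have cd: "(\<forall>x\<in>dom M. \<forall>y\<in>dom M. (x, y) \<in> coded w e M r \<longleftrightarrow> (x, y) \<in> Z) \<longleftrightarrow> coded w e M r = Z" for r
  proof (rule relation_eq_on)
    show "coded w e M r \<subseteq> dom M \<times> dom M" using coded_sub by auto
  qed (rule sub'(3))
  have pts: "(\<exists>c\<in>dom M. (c, c) \<in> brel w M \<and> P c) \<longleftrightarrow> (\<exists>c\<in>Field (brel w M). P c)" for P
    using points_Field sub by blast
  have bs_nth: "bs ! 0 = d1" "bs ! 1 = d2" "bs ! 2 = d3" by (simp_all add: bs(1))
  show ?thesis
    unfolding Q_up_On_fm_def Let_def n_def[symmetric] bs_nth
    by (simp add: sat_Quant fr ext_seg[OF brel_wo(1) sub] Q_ec_mem sub' segm_sub Linear_order_segm[OF brel_wo(1)]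
        ap cd pts sat_isomorphism_fm cong: conj_cong)
qed

end

text \<open>
  The truth of the formulas \<open>hierarchy_fm\<close> and \<open>trichotomy_fm\<close> does not depend on the assignment, so
  one assignment suffices. Comprehension is a scheme: all definable binary relations have codes.
  As the last three conditions are given by formulas, they pass to elementary substructures.
\<close>

definition coding_structure :: "'v::zfc_universe vocabulary \<Rightarrow> 'v \<Rightarrow> 'v \<Rightarrow> 'v \<Rightarrow> 'v struct \<Rightarrow> bool" where
  "coding_structure L w e h M \<longleftrightarrow> topped_wo (brel w M) \<and>
     (\<exists>a. range a \<subseteq> dom M \<and> sat Qs_ec M a (hierarchy_fm w h)) \<and>
     (\<exists>a. range a \<subseteq> dom M \<and> sat Qs_ec M a (trichotomy_fm w e)) \<and>
     (\<forall>a d. range a \<subseteq> dom M \<and> length (fst d) = 2 \<and> distinct (fst d) \<and> form_of L Qs_ec (snd d) \<longrightarrow>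
        sat Qs_ec M a (comprehension_fm w e d))"

text \<open>
  For a true well-order \<open>Z\<close> whose order type indexes the class of the cofinality of \<open>X\<close>, the
  trichotomy leaves only an isomorphism with a segment. Conversely, any coded isomorphism is a true
  one, and the hierarchy and cofinalities are computed correctly.
\<close>

lemma Q_up_On_defined:
  assumes M: "is_structure L M" and w: "w \<in> rels L" "rel_arity L w = 2"
    and C: "coding_structure L w e h M"
  shows "defines_quant L Qs_ec w (Q_up_On_fm w e h) (Q_up On) M"
  unfolding defines_quant_def
proof (intro allI impI)
  let ?W = "brel w M"
  note sub = brel_subset_dom[OF M w]
  have W: "topped_wo ?W" using C by (simp add: coding_structure_def)
  note wo = brel_wo[OF W sub]
  have pF: "points w M = Field ?W" using points_eq_Field[OF wo(1)] .
  have H: "hierarchy ?W (brel h M)"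
    using C sat_hierarchy_fm[OF W sub] hierarchy_rec_iff[OF wo] by (auto simp: coding_structure_def)
  fix a bs
  assume A: "range a \<subseteq> dom M \<and> quant_args L Qs_ec (fst (Q_up (On :: 'a set))) bs \<and>
    (\<forall>d\<in>set bs. ext Qs_ec M a d \<subseteq> lists (points w M))"
  then have "quant_args L Qs_ec [2, 2, 2] bs" by (simp add: Q_up_def)
  then obtain d1 d2 d3 where bs: "bs = [d1, d2, d3]" "length (fst d1) = 2" "length (fst d2) = 2" "length (fst d3) = 2"
    "distinct (fst d3)" "form_of L Qs_ec (snd d3)"
    by (rule quant_args_3)
  have l: "ext Qs_ec M a d1 \<subseteq> lists (points w M)" "ext Qs_ec M a d2 \<subseteq> lists (points w M)"
    "ext Qs_ec M a d3 \<subseteq> lists (points w M)" using A bs by auto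
  obtain X where X: "X \<subseteq> points w M \<times> points w M" "ext Qs_ec M a d1 = binary X" by (rule ext_binary[OF bs(2) l(1)])
  obtain Y where Y: "Y \<subseteq> points w M \<times> points w M" "ext Qs_ec M a d2 = binary Y" by (rule ext_binary[OF bs(3) l(2)])
  obtain Z where Z: "Z \<subseteq> points w M \<times> points w M" "ext Qs_ec M a d3 = binary Z" by (rule ext_binary[OF bs(4) l(3)])
  have small_Field: "small (Field V)" "Field V \<subseteq> Field ?W" if "V \<subseteq> points w M \<times> points w M" for V
  proof -
    show "Field V \<subseteq> Field ?W" using that pF by (auto simp: Field_def)
    then show "small (Field V)" by (rule small_subset[OF wo(2)])
  qed
  have "(\<exists>m\<in>Field ?W. cofinality X = cofinality (segm ?W m) \<and>
      (\<exists>g\<in>Field ?W. (m, g) \<in> brel h M \<and>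
        (\<exists>r\<in>dom M. coded w e M r = Z \<and> (\<exists>f\<in>dom M. segm_isomorphism Z (coded w e M f) ?W g)))) \<longleftrightarrow>
    Well_order Z \<and> cofinality X \<in> Reg_at (elts (otype Z))" (is "?L \<longleftrightarrow> ?R")
    if lin: "Linear_order X" "Linear_order Z"
  proof
    assume ?L
    then obtain m g f where m: "m \<in> Field ?W" "cofinality X = cofinality (segm ?W m)"
      and g: "g \<in> Field ?W" "(m, g) \<in> brel h M" "segm_isomorphism Z (coded w e M f) ?W g" by blast
    note iso = segm_isomorphism_otype[OF wo g(1) lin(2) small_Field(1)[OF Z(1)] g(3)]
    have R: "coll ?W m \<in> Reg_at (elts (coll ?W g))" using H m(1) g(1,2) by (simp add: hierarchy_def)
    have "cofinality X = coll ?W m"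
      using m cofinality_segm[OF wo m(1)] RegD(4)[OF Reg_at_Reg[OF R]] by simp
    then show ?R using iso R by simp
  next
    assume R: ?R
    then have wZ: "Well_order Z" and mu: "cofinality X \<in> Reg_at (elts (otype Z))" by auto
    note sZ = small_Field(1)[OF Z(1)]
    have muR: "cofinality X \<in> Reg" using Reg_at_Reg[OF mu] .
    have le: "elts (cofinality X) \<subseteq> elts (vcard (Field ?W))"
      using cofinality_le_vcard[OF lin(1) small_Field(1)[OF X(1)]]
        vcard_mono[OF wo(2) subset_imp_lepoll[OF small_Field(2)[OF X(1)]]] by blast
    have "infinite (elts (vcard (Field ?W)))" using RegD(2)[OF muR] le finite_subset by blast
    then have inf: "infinite (Field ?W)" using vcard_props(2)[OF wo(2)] eqpoll_finite_iff by blast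
    obtain m where m: "m \<in> Field ?W" "coll ?W m = cofinality X"
      by (rule coll_realises[OF W inf RegD(1)[OF muR] le])
    \<comment> \<open>the trichotomy, applied to a code of \<open>Z\<close>, provides an isomorphism inside the structure\<close>
    have "sat Qs_ec M a (comprehension_fm w e d3)"
      using C A bs(4-6) unfolding coding_structure_def by blast
    then obtain r where r: "r \<in> dom M" "coded w e M r = Z"
      using sat_comprehension_fm[OF W sub bs(4,5) _ Z(2), of e] A Z(1) by (auto simp: Int_absorb2)
    have tri: "(\<exists>s\<in>dom M. no_minimum Z (coded w e M s)) \<or>
        (\<exists>g\<in>Field ?W. \<exists>f\<in>dom M. segm_isomorphism Z (coded w e M f) ?W g) \<or>
        (\<exists>f\<in>dom M. order_embedding Z (coded w e M f) ?W)"
      using C lin(2) r unfolding coding_structure_def sat_trichotomy_fm[OF W sub] by blast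
    have "\<not> no_minimum Z S" for S
    proof
      assume S: "no_minimum Z S"
      then obtain x where x: "x \<in> {x. (x, x) \<in> Z \<and> (x, x) \<in> S}" unfolding no_minimum_def by blast
      have wf: "wf (Z - Id)" using wZ by (simp add: well_order_on_def)
      obtain z where z: "z \<in> {x. (x, x) \<in> Z \<and> (x, x) \<in> S}"
        "\<And>y. (y, z) \<in> Z - Id \<Longrightarrow> y \<notin> {x. (x, x) \<in> Z \<and> (x, x) \<in> S}" by (rule wfE_min[OF wf x]) blast
      then obtain y where y: "(y, z) \<in> Z" "y \<noteq> z" "(y, y) \<in> S" using S unfolding no_minimum_def by blast
      then have "(y, y) \<in> Z" using refl_Field[OF lin(2), of y] by (auto simp: Field_def)
      then show False using z(2) y by blast
    qed
    moreover have "\<not> order_embedding Z F ?W" for F by (rule not_order_embedding[OF W wZ sZ mu le])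
    ultimately obtain g f where gf: "g \<in> Field ?W" "f \<in> dom M" "segm_isomorphism Z (coded w e M f) ?W g"
      using tri by blast
    have "otype Z = coll ?W g" by (rule segm_isomorphism_otype[OF wo gf(1) lin(2) sZ gf(3)])
    then have "(m, g) \<in> brel h M" using H m gf(1) mu by (simp add: hierarchy_def)
    moreover have "cofinality X = cofinality (segm ?W m)"
      using cofinality_segm[OF wo m(1)] m(2) RegD(4)[OF muR] by simp
    ultimately show ?L using m(1) gf r by blast
  qed
  then have "sat Qs_ec M a (Q_up_On_fm w e h bs) \<longleftrightarrow> Linear_order X \<and> Linear_order Y \<and> cofinality X = cofinality Y \<and>
      Linear_order Z \<and> Well_order Z \<and> cofinality X \<in> Reg_at (elts (otype Z))"
    unfolding sat_Q_up_On_fm[OF W sub bs(1,4,5) X(2,1) Y(2,1) Z(2,1)] by blast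
  also have "\<dots> \<longleftrightarrow> [binary X, binary Y, binary Z] \<in> snd (Q_up On) (points w M)"
    using X(1) Y(1) Z(1) otype_props(1)[of Z] small_Field(1)[OF Z(1)]
    by (auto simp: Q_up_iff On_def well_order_on_def)
  finally show "sat Qs_ec M a (Q_up_On_fm w e h bs) \<longleftrightarrow> map (ext Qs_ec M a) bs \<in> snd (Q_up On) (points w M)"
    using X Y Z bs(1) by simp
qed

lemma form_of_seg_simps [simp]:
  "length (fst (seg w n)) = 2" "distinct (fst (seg w n))"
  "form_of L Qs (snd (seg w n)) \<longleftrightarrow> w \<in> rels L \<and> rel_arity L w = 2"
  by (auto simp: seg_def)

lemma form_of_coding_fms:
  assumes w: "w \<in> rels L" "rel_arity L w = 2" and h: "h \<in> rels L" "rel_arity L h = 2"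
    and e: "e \<in> rels L" "rel_arity L e = 3"
  shows "form_of L Qs_ec (hierarchy_fm w h)" "form_of L Qs_ec (trichotomy_fm w e)"
    "form_of L Qs_ec (snd d) \<Longrightarrow> form_of L Qs_ec (comprehension_fm w e d)"
    "quant_args L Qs_ec (fst (Q_up \<alpha>)) bs \<Longrightarrow> form_of L Qs_ec (Q_up_On_fm w e h bs)"
proof -
  have "form_of L Qs_ec (Quant 1 [seg w c, seg w m])" for c m
    by (rule form_of_Quant2) (use w in \<open>auto simp: Q_ec_def\<close>)
  then have "form_of L Qs_ec (left_over_fm w h m g c)" for m g c
    using w h by (simp add: left_over_fm_def regular_fm_def)
  then show "form_of L Qs_ec (hierarchy_fm w h)" using w h by (simp add: hierarchy_fm_def)
  have iso: "form_of L Qs_ec (isomorphism_fm w e r f g)" for r f g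
    using w e by (simp add: isomorphism_fm_def matching_fm_def Let_def)
  then show "form_of L Qs_ec (trichotomy_fm w e)"
    using w e by (simp add: trichotomy_fm_def embedding_fm_def matching_fm_def no_minimum_fm_def Let_def Q_ec_def)
  show "form_of L Qs_ec (comprehension_fm w e d)" if "form_of L Qs_ec (snd d)"
    using w e that by (simp add: comprehension_fm_def Let_def form_of_app)
  show "form_of L Qs_ec (Q_up_On_fm w e h bs)" if "quant_args L Qs_ec (fst (Q_up \<alpha>)) bs"
  proof -
    have "quant_args L Qs_ec [2, 2, 2] bs" using that by (simp add: Q_up_def)
    then obtain d1 d2 d3 where bs: "bs = [d1, d2, d3]" and d: "length (fst d1) = 2" "length (fst d2) = 2"
      "length (fst d3) = 2" "distinct (fst d1)" "distinct (fst d2)" "distinct (fst d3)"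
      "form_of L Qs_ec (snd d1)" "form_of L Qs_ec (snd d2)" "form_of L Qs_ec (snd d3)"
      by (rule quant_args_3)
    have "form_of L Qs_ec (Quant 1 [d1, d2])" "form_of L Qs_ec (Quant 1 [d3, d3])"
      "form_of L Qs_ec (Quant 1 [d1, seg w n])" for n
      by (rule form_of_Quant2; use d w in simp)+
    then show ?thesis
      using w h e iso d(9) unfolding bs
      by (simp add: Q_up_On_fm_def Let_def form_of_app del: form_of.simps(6))
  qed
qed

lemma coding_structure_elementary:
  assumes B: "elementary_substructure L Qs_ec B M" and M: "is_structure L M"
    and w: "w \<in> rels L" "rel_arity L w = 2" and h: "h \<in> rels L" "rel_arity L h = 2"
    and e: "e \<in> rels L" "rel_arity L e = 3" and C: "coding_structure L w e h M"
  shows "coding_structure L w e h B"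
proof -
  note Bs = elementary_structures[OF B] and fms = form_of_coding_fms[OF w h e]
  have WM: "topped_wo (brel w M)" using C by (simp add: coding_structure_def)
  note subM = brel_subset_dom[OF M w] and subB = brel_subset_dom[OF Bs(2) w]
  obtain b where b: "b \<in> dom B" using Bs(5) by blast
  then have rb: "range (\<lambda>_::nat. b) \<subseteq> dom B" by auto
  have "sat Qs_ec M (\<lambda>_. b) (hierarchy_fm w h)" "sat Qs_ec M (\<lambda>_. b) (trichotomy_fm w e)"
    using C by (auto simp: coding_structure_def sat_hierarchy_fm[OF WM subM] sat_trichotomy_fm[OF WM subM])
  then have 1: "sat Qs_ec B (\<lambda>_. b) (hierarchy_fm w h)" "sat Qs_ec B (\<lambda>_. b) (trichotomy_fm w e)"
    using elementary_sat[OF B _ rb] fms(1,2) by blast+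
  have 2: "sat Qs_ec B a (comprehension_fm w e d)"
    if a: "range a \<subseteq> dom B" and d: "length (fst d) = 2 \<and> distinct (fst d) \<and> form_of L Qs_ec (snd d)" for a d
  proof -
    have "range a \<subseteq> dom M" using a Bs(3) by blast
    then have "sat Qs_ec M a (comprehension_fm w e d)" using C d unfolding coding_structure_def by blast
    then show ?thesis using elementary_sat[OF B fms(3) a] d by blast
  qed
  show ?thesis
    unfolding coding_structure_def
    using topped_wo_elementary(1)[OF B M w WM] 1 2 rb by blast
qed

lemma coding_structureI:
  assumes M: "is_structure L M" and w: "w \<in> rels L" "rel_arity L w = 2"
    and W: "topped_wo (brel w M)" and H: "hierarchy (brel w M) (brel h M)"
    and full: "\<And>R. R \<subseteq> points w M \<times> points w M \<Longrightarrow> \<exists>r\<in>dom M. coded w e M r = R"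
  shows "coding_structure L w e h M"
proof -
  note sub = brel_subset_dom[OF M w]
  note wo = brel_wo[OF W sub]
  have pF: "points w M = Field (brel w M)" using points_eq_Field[OF wo(1)] .
  obtain b where "b \<in> dom M" using M by (auto simp: is_structure_def)
  then have rb: "range (\<lambda>_::nat. b) \<subseteq> dom M" by auto
  have "sat Qs_ec M (\<lambda>_. b) (hierarchy_fm w h)"
    using H by (simp add: sat_hierarchy_fm[OF W sub] hierarchy_rec_iff[OF wo])
  moreover have "sat Qs_ec M (\<lambda>_. b) (trichotomy_fm w e)"
    unfolding sat_trichotomy_fm[OF W sub]
  proof (intro ballI impI)
    fix r assume r: "r \<in> dom M" and lin: "Linear_order (coded w e M r)"
    let ?Z = "coded w e M r" and ?W = "brel w M"
    have Zs: "?Z \<subseteq> points w M \<times> points w M" by (auto simp: coded_def)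
    then have "Field ?Z \<times> Field ?W \<subseteq> points w M \<times> points w M" using pF by (auto simp: Field_def)
    then have code: "\<exists>r\<in>dom M. coded w e M r = F" if "F \<subseteq> Field ?Z \<times> Field ?W \<or> F \<subseteq> Id \<inter> ?Z" for F
      using full[of F] that Zs by blast
    show "(\<exists>s\<in>dom M. no_minimum ?Z (coded w e M s)) \<or>
        (\<exists>g\<in>Field ?W. \<exists>f\<in>dom M. segm_isomorphism ?Z (coded w e M f) ?W g) \<or>
        (\<exists>f\<in>dom M. order_embedding ?Z (coded w e M f) ?W)"
      using linear_order_trichotomy[OF wo(1) lin] code by metis
  qed
  moreover have "sat Qs_ec M a (comprehension_fm w e d)"
    if a: "range a \<subseteq> dom M" and d: "length (fst d) = 2" "distinct (fst d)" for a d
  proof -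
    have "ext Qs_ec M a d \<subseteq> tuples (dom M) 2" using d by (cases d) (auto simp: ext_def)
    then obtain X where X: "ext Qs_ec M a d = binary X" by (auto simp: tuples_2)
    show ?thesis unfolding sat_comprehension_fm[OF W sub d a X] by (rule full) auto
  qed
  ultimately show ?thesis using W rb unfolding coding_structure_def by blast
qed

text \<open>
  Every infinite structure has such an extension: since the domain \<open>A\<close> is equipollent to
  \<open>A \<times> A\<close>, the subsets of \<open>A\<close> serve as codes.
\<close>

lemma coding_extension:
  fixes L :: "'v::zfc_universe vocabulary" and M :: "'v struct"
  assumes L: "small (rels L)" and M: "is_structure L M" and inf: "infinite (dom M)"
  obtains N ar M' w e h where "finite N" "N \<inter> rels L = {}" "is_structure (add_rels N ar L) M'"
    "w \<in> N" "ar w = 2" "e \<in> N" "ar e = 3" "h \<in> N" "ar h = 2"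
    "is_substructure L M M'" "dom M = points w M'" "coding_structure (add_rels N ar L) w e h M'"
proof -
  define A where "A = dom M"
  have smA: "small A" "A \<noteq> {}" using M by (auto simp: is_structure_def small_def A_def)
  then obtain W where W: "topped_wo W" "Field W = A" by (rule topped_wo_exists)
  have "A \<times> A \<approx> A"
    using card_of_Times_same_infinite inf unfolding A_def eqpoll_iff_card_of_ordIso by blast
  then obtain pr where pr: "inj_on pr (A \<times> A)" "pr ` (A \<times> A) \<subseteq> A"
    by (auto simp: eqpoll_def bij_betw_def)
  define C where "C = tag A ` {s. elts s \<subseteq> A}"
  have smC: "small C" unfolding C_def by (intro small_image small_Pow_codes smA)
  have CA: "tag A s \<notin> A" for s by (rule tag_notin[OF smA(1)])
  obtain a0 where a0: "a0 \<in> A" using smA by blast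
  define M0 where "M0 = M\<lparr>dom := A \<union> C, fun_int := \<lambda>f xs. if set xs \<subseteq> A then fun_int M f xs else a0\<rparr>"
  have M0: "is_structure L M0"
    unfolding is_structure_def
  proof (intro conjI ballI)
    have "small (dom M0)" unfolding M0_def using small_Un[OF smA(1) smC] by simp
    then show "dom M0 \<in> range elts" by (simp add: small_def)
    show "dom M0 \<noteq> {}" using a0 by (auto simp: M0_def)
    show "fun_int M0 f xs \<in> dom M0" if "f \<in> funs L" "xs \<in> tuples (dom M0) (fun_arity L f)" for f xs
      using that M a0 by (auto simp: M0_def is_structure_def tuples_def A_def)
    show "rel_int M0 R \<subseteq> tuples (dom M0) (rel_arity L R)" if "R \<in> rels L" for R
    proof -
      have "rel_int M R \<subseteq> tuples A (rel_arity L R)" using that M by (simp add: is_structure_def A_def)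
      also have "\<dots> \<subseteq> tuples (A \<union> C) (rel_arity L R)" by (auto simp: tuples_def)
      finally show ?thesis by (simp add: M0_def)
    qed
  qed
  have MM0: "is_substructure L M M0"
  proof -
    have "\<forall>R\<in>rels L. rel_int M R = rel_int M R \<inter> tuples (dom M) (rel_arity L R)"
      using is_substructure_refl[OF M] by (simp add: is_substructure_def)
    then show ?thesis
      unfolding is_substructure_def using M by (auto simp: M0_def A_def tuples_def)
  qed
  \<comment> \<open>three different sets to be tagged as new symbols\<close>
  define z0 z1 z2 where "z0 = (undefined :: 'v)" and "z1 = set_of {z0}" and "z2 = set_of {z1}"
  have z: "elts z1 = {z0}" "elts z2 = {z1}"
    using small_doubleton[of z0 z0] small_doubleton[of z1 z1] by (simp_all add: z1_def z2_def elts_set_of)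
  have zne: "z0 \<noteq> z1" "z1 \<noteq> z2" "z0 \<noteq> z2"
    using mem_not_refl[of z0] mem_not_refl[of z1] mem_not_sym[of z0 z1] z by auto
  define w where "w = tag (rels L) z0"
  define e where "e = tag (rels L) z1"
  define h where "h = tag (rels L) z2"
  define N where "N = {w, e, h}"
  have ne: "w \<noteq> e" "e \<noteq> h" "w \<noteq> h" using zne by (simp_all add: w_def e_def h_def)
  have disj: "N \<inter> rels L = {}" using tag_notin[OF L] by (auto simp: N_def w_def e_def h_def)
  define ar where "ar = (\<lambda>R. if R = e then 3 else 2 :: nat)"
  define H where "H = {(m, g). m \<in> A \<and> g \<in> A \<and> coll W m \<in> Reg_at (elts (coll W g))}"
  define E where "E = {[tag A s, x, y] | s x y. elts s \<subseteq> A \<and> x \<in> A \<and> y \<in> A \<and> pr (x, y) \<in> elts s}"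
  define I where "I = (\<lambda>R. if R = w then binary W else if R = h then binary H else E)"
  define L' where "L' = add_rels N ar L"
  define M' where "M' = add_ints N I M0"
  have WA: "W \<subseteq> A \<times> A" using W(2) by (auto simp: Field_def)
  have dM': "dom M' = A \<union> C" by (simp add: M'_def M0_def)
  have "I R \<subseteq> tuples (dom M0) (ar R)" if "R \<in> N" for R
    using that WA ne by (auto simp: N_def I_def ar_def binary_def H_def E_def tuples_def M0_def C_def)
  then have M': "is_structure L' M'" unfolding L'_def M'_def by (intro is_structure_add[OF M0 disj])
  have wL: "w \<in> rels L'" "rel_arity L' w = 2" using ne by (auto simp: L'_def N_def ar_def)
  have bw: "brel w M' = W" by (auto simp: brel_def M'_def N_def I_def binary_def)
  have bh: "brel h M' = H" using ne by (auto simp: brel_def M'_def N_def I_def binary_def)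
  have wo: "Well_order W" using W(1) by (simp add: topped_wo_def)
  have pA: "points w M' = A" using points_eq_Field[of w M'] bw W(2) wo by simp
  have "\<exists>r\<in>dom M'. coded w e M' r = R" if R: "R \<subseteq> points w M' \<times> points w M'" for R
  proof -
    define s where "s = set_of (pr ` R)"
    have RA: "R \<subseteq> A \<times> A" using R pA by simp
    have prR: "pr ` R \<subseteq> A" using RA pr(2) by blast
    have s: "elts s = pr ` R" unfolding s_def by (rule elts_set_of[OF small_subset[OF smA(1) prR]])
    have 1: "[tag A s, x, y] \<in> E \<longleftrightarrow> x \<in> A \<and> y \<in> A \<and> pr (x, y) \<in> pr ` R" for x y
      using prR s by (auto simp: E_def)
    have 2: "pr (x, y) \<in> pr ` R \<longleftrightarrow> (x, y) \<in> R" if "x \<in> A" "y \<in> A" for x y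
      using inj_on_image_mem_iff[OF pr(1), of "(x, y)" R] that RA by simp
    have "rel_int M' e = E" using ne by (simp add: M'_def N_def I_def)
    then have "(x, y) \<in> coded w e M' (tag A s) \<longleftrightarrow> x \<in> A \<and> y \<in> A \<and> pr (x, y) \<in> pr ` R" for x y
      unfolding coded_def pA by (simp add: 1) blast
    then have "(x, y) \<in> coded w e M' (tag A s) \<longleftrightarrow> (x, y) \<in> R" for x y using 2 RA by blast
    then have "coded w e M' (tag A s) = R" by auto
    moreover have "tag A s \<in> dom M'" using s prR by (auto simp: dM' C_def)
    ultimately show ?thesis by blast
  qed
  moreover have "hierarchy (brel w M') (brel h M')"
    unfolding bw bh hierarchy_def by (auto simp: H_def W(2))
  ultimately have "coding_structure L' w e h M'"
    using coding_structureI[OF M' wL] W(1) bw by simp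
  moreover have "is_substructure L M M'"
    unfolding M'_def by (rule is_substructure_add[OF MM0 disj])
  ultimately show thesis
    using that[of N ar M' w e h] disj M' pA ne by (auto simp: L'_def N_def ar_def A_def)
qed

lemma LST_at_Q_ec_imp_Q_up_On:
  fixes k :: "'v::zfc_universe"
  assumes k: "LST_at [Hartig, Q_ec] k" shows "LST_at [Hartig, Q_up On] k"
proof (rule LST_at_transfer[OF k])
  fix L :: "'v vocabulary" and M :: "'v struct"
  assume L: "symbols L \<prec> elts k" and M: "is_structure L M" and kM: "elts k \<lesssim> dom M"
  have infk: "infinite (elts k)" using k by (simp add: LST_at_def infinite_cardinal_def)
  then have "infinite (dom M)" using kM lepoll_iff finite_surj by metis
  then obtain N ar M' w e h where N: "finite N" "N \<inter> rels L = {}" and M': "is_structure (add_rels N ar L) M'"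
    and whe: "w \<in> N" "ar w = 2" "e \<in> N" "ar e = 3" "h \<in> N" "ar h = 2"
    and MM': "is_substructure L M M'" "dom M = points w M'" and C: "coding_structure (add_rels N ar L) w e h M'"
    using coding_extension[OF small_rels[OF L] M] by blast
  let ?L = "add_rels N ar L"
  have s: "w \<in> rels ?L" "rel_arity ?L w = 2" "h \<in> rels ?L" "rel_arity ?L h = 2" "e \<in> rels ?L" "rel_arity ?L e = 3"
    using whe by auto
  have "symbols ?L \<prec> elts k" by (rule symbols_add_lesspoll[OF L finite_lesspoll_infinite[OF infk N(1)] infk])
  moreover have "points w B \<noteq> {} \<and> defines_quant ?L Qs_ec w (Q_up_On_fm w e h) (Q_up On) B"
    if B: "elementary_substructure ?L Qs_ec B M'" for B
  proof
    have "topped_wo (brel w M')" using C by (simp add: coding_structure_def)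
    then show "points w B \<noteq> {}" using topped_wo_elementary(3)[OF B M' s(1,2)] by blast
    show "defines_quant ?L Qs_ec w (Q_up_On_fm w e h) (Q_up On) B"
      by (rule Q_up_On_defined[OF elementary_structures(2)[OF B] s(1,2) coding_structure_elementary[OF B M' s C]])
  qed
  ultimately show "definable_expansion [Q_ec] (Q_up On) k L M"
    unfolding definable_expansion_def
    using M' vocab_le_add_rels[OF N(2), of ar] s(1,2) MM' form_of_coding_fms(4)[OF s]
    by (intro exI[of _ ?L] exI[of _ M'] exI[of _ w] exI[of _ "Q_up_On_fm w e h"]) blast
qed

section \<open>The comparison of the numbers\<close>

lemma R_up_0_empty: "snd (R_up ord0) A = {}"
  by (simp add: R_up_def ord0_def)

lemma LST_at_Hartig_imp_R_up_0:
  assumes "LST_at [Hartig] k" shows "LST_at [Hartig, R_up ord0] k"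
proof (rule transfer_by_order[where T = "\<lambda>w bs. Neg (Exists 0 (Equal (Var 0) (Var 0)))", OF assms])
  fix L :: "'a vocabulary" and w and B :: "'a struct"
  assume "is_structure L B"
  then show "defines_quant L [Hartig] w (\<lambda>bs. Neg (Exists 0 (Equal (Var 0) (Var 0)))) (R_up ord0) B"
    by (auto simp: defines_quant_def R_up_0_empty is_structure_def)
qed simp

theorem theorem4p1:
  fixes \<alpha> \<beta> :: "'v::zfc_universe set"
  assumes "\<alpha> \<in> ext_On" and "\<beta> \<in> ext_On" and "\<beta> \<subset> \<alpha>"
  shows "(LST [Hartig, Q_ec] :: 'v set) = LST [Hartig, Q_up On] \<and>
    LST [Hartig, Q_up \<alpha>] \<supseteq> LST [Hartig, R_up \<alpha>] \<and>
    (LST [Hartig, Q_up \<alpha>] \<supseteq> LST [Hartig, Q_up \<beta>] \<or>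
       \<beta> \<supseteq> LST [Hartig, Q_up \<alpha>] \<and> LST [Hartig, Q_up \<beta>] \<supset> min_or_infty (Reg_at \<beta>)) \<and>
    (LST [Hartig, R_up \<alpha>] \<supseteq> LST [Hartig, R_up \<beta>] \<or>
       \<beta> \<supseteq> LST [Hartig, R_up \<alpha>] \<and> LST [Hartig, R_up \<beta>] \<supset> min_or_infty (Reg_at \<beta>)) \<and>
    (LST [Hartig, R_up ord1] :: 'v set) = LST [Hartig, R_up ord0] \<and>
    (LST [Hartig, R_up ord0] :: 'v set) = LST [Hartig]"
proof -
  have \<alpha>: "\<alpha> \<subseteq> On"
    using assms(1) elts_subset_On by (auto simp: ext_On_def On_def)
  then have "\<beta> \<noteq> On" using assms(3) by blast
  then obtain b where b: "Ord b" "\<beta> = elts b" using assms(2) by (auto simp: ext_On_def On_def)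
  have b\<alpha>: "elts b \<subseteq> \<alpha>" using assms(3) b by blast
  have drop: "LST_at [Hartig] k" if "LST_at [Hartig, Q] k" for Q and k :: 'v
    by (rule LST_at_sublist[OF _ that]) auto
  have "(LST [Hartig, Q_ec] :: 'v set) = LST [Hartig, Q_up On]"
    by (rule equalityI[OF LST_antimono LST_antimono])
      (erule LST_at_Q_up_On_imp_Q_ec LST_at_Q_ec_imp_Q_up_On)+
  moreover have "LST [Hartig, Q_up \<alpha>] \<supseteq> LST [Hartig, R_up \<alpha>]"
    by (rule LST_antimono[OF LST_at_Q_up_imp_R_up])
  moreover have "LST [Hartig, Q_up \<alpha>] \<supseteq> LST [Hartig, Q_up \<beta>] \<or>
       \<beta> \<supseteq> LST [Hartig, Q_up \<alpha>] \<and> LST [Hartig, Q_up \<beta>] \<supset> min_or_infty (Reg_at \<beta>)"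
    unfolding Q_up_eq_rank_quant b(2)
    by (rule LST_rank_quant_lower[OF rank_determined_Q_up b(1) b\<alpha> \<alpha>])
  moreover have "LST [Hartig, R_up \<alpha>] \<supseteq> LST [Hartig, R_up \<beta>] \<or>
       \<beta> \<supseteq> LST [Hartig, R_up \<alpha>] \<and> LST [Hartig, R_up \<beta>] \<supset> min_or_infty (Reg_at \<beta>)"
    unfolding R_up_eq_rank_quant b(2)
    by (rule LST_rank_quant_lower[OF rank_determined_R_up b(1) b\<alpha> \<alpha>])
  moreover have R0: "(LST [Hartig, R_up ord0] :: 'v set) = LST [Hartig]"
    by (rule equalityI[OF LST_antimono LST_antimono]) (erule LST_at_Hartig_imp_R_up_0 drop)+
  moreover have "(LST [Hartig, R_up ord1] :: 'v set) = LST [Hartig]"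
    by (rule equalityI[OF LST_antimono LST_antimono]) (erule LST_at_Hartig_imp_R_up_1 drop)+
  ultimately show ?thesis by simp
qed

end
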